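(* Let $(A,B,C)$ be a random triple with values in $\mathbb{R}^+\times\mathbb{R}\times\mathbb{R}$ and law $\widetilde\mu$, and let $(A_n,B_n,C_n)$, $n\ge1$, be i.i.d. copies of it. Consider the Letac recursion $$\widetilde X_n = B_n + A_n\max\{\widetilde X_{n-1}, C_n\} = \max\{A_n\widetilde X_{n-1}+B_n,\ A_nC_n+B_n\},\quad n\ge1.$$ Assume $\mathbb{E}\log A<0$, $\mathbb{E}A^\alpha=1$ for some $\alpha>0$, $\mathbb{E}[|B|^\alpha + A^\alpha\log^+A]<\infty$, the law of $\log A$ is non-arithmetic, and $\mathbb{E}[A^\alpha|C|^\alpha]<\infty$. Then the stationary solution $\widetilde X$ satisfies $\mathbb{P}[\widetilde X>t]\sim C_L t^{-\alpha}$ as $t\to\infty$ for some constant $C_L\ge0$. For $(a,b)$ with $a\ne1$ let $x(a,b)=\frac{b}{1-a}$ be the fixed point of $x\mapsto ax+b$, and define $$N_1=\sup\{ac+b:(a,b,c)\in\mathrm{supp}\,\widetilde\mu\},\quad N_2=\sup\{x(a,b):(a,b,c)\in\mathrm{supp}\,\widetilde\mu,\ a<1\},\quad N_3=\inf\{x(a,b):(a,b,c)\in\mathrm{supp}\,\widetilde\mu,\ a>1\}$$ (possibly $N_1=\infty$, $N_2=\infty$ or $N_3=-\infty$). Assume $\mathbb{P}[A=1,B>0]=0$. Then $C_L>0$ if and only if $N_3<\max\{N_1,N_2\}=N$.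
   Context: Letac model for random difference equations; positivity of the tail constant is reduced to unboundedness at $+\infty$ of the support of the law of $\widetilde X$. *)

theory Defs
  imports "HOL-Probability.Probability"
begin

definition measure_support :: "'a::metric_space measure \<Rightarrow> 'a set" where
  "measure_support M = {x. \<forall>e>0. emeasure M (ball x e) > 0}"

definition letac_map :: "(real \<times> real \<times> real) \<times> real \<Rightarrow> real" where
  "letac_map = (\<lambda>((a, b, c), x). max (a * x + b) (a * c + b))"

definition letac_stationary :: "(real \<times> real \<times> real) measure \<Rightarrow> real measure \<Rightarrow> bool" where
  "letac_stationary \<mu> \<nu> \<longleftrightarrow> prob_space \<nu> \<and> sets \<nu> = sets borel \<and>
     \<nu> = distr (\<mu> \<Otimes>\<^sub>M \<nu>) borel letac_map"

text \<open>Law of log A (A > 0 a.s.) is arithmetic: concentrated on d*Z for some d > 0.\<close>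
definition log_arithmetic :: "(real \<times> real \<times> real) measure \<Rightarrow> bool" where
  "log_arithmetic \<mu> \<longleftrightarrow> (\<exists>d>0. AE (a, b, c) in \<mu>. \<exists>k::int. ln a = d * of_int k)"

definition N1 :: "(real \<times> real \<times> real) measure \<Rightarrow> ereal" where
  "N1 \<mu> = Sup ((\<lambda>(a, b, c). ereal (a * c + b)) ` measure_support \<mu>)"

definition N2 :: "(real \<times> real \<times> real) measure \<Rightarrow> ereal" where
  "N2 \<mu> = Sup ((\<lambda>(a, b, c). ereal (b / (1 - a))) ` {(a, b, c) \<in> measure_support \<mu>. a < 1})"

definition N3 :: "(real \<times> real \<times> real) measure \<Rightarrow> ereal" where
  "N3 \<mu> = Inf ((\<lambda>(a, b, c). ereal (b / (1 - a))) ` {(a, b, c) \<in> measure_support \<mu>. a > 1})"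

end

theory Submission
  imports Defs
begin

text \<open>Under the tilted law \<open>A\<^sup>\<alpha> d\<mu>\<close> the law \<open>\<rho>\<close> of \<open>ln A\<close> has positive mean \<open>m\<close>, and
  \<open>r(s) = e\<^bsup>\<alpha>s\<^esup> P(X > e\<^sup>s)\<close> solves the renewal equation \<open>r = r * \<rho> + h\<close> with integrable \<open>h\<close> (Goldie's
  implicit renewal). The potential of \<open>\<rho>\<close> is bounded by a maximum principle, hence so is \<open>r\<close>. The
  primitive \<open>G\<close> of \<open>r\<close> is therefore Lipschitz; the Choquet--Deny argument makes its increments
  slowly varying, and \<open>\<integral> G(s) - G(s - x) \<rho>(dx) \<rightarrow> \<integral> h\<close> then forces \<open>r \<rightarrow> (\<integral> h) / m\<close>, without
  Blackwell's theorem.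

  Positivity: if the support of \<open>X\<close> is unbounded above, start the recursion above a large level \<open>y\<close>.
  Then \<open>X\<close> exceeds \<open>t\<close> if some partial product \<open>A\<^sub>1 \<dots> A\<^sub>n\<close> exceeds \<open>2t/y\<close> and the perpetuity built
  from \<open>\<bar>B\<bar>\<close> stays below \<open>t\<close>. Both probabilities are of order \<open>t\<^bsup>-\<alpha>\<^esup>\<close>, but the first carries the
  factor \<open>y\<^sup>\<alpha>\<close> and wins for large \<open>y\<close>. Finally, the support is bounded above
  exactly if some level \<open>S\<close> satisfies \<open>ac + b \<le> S\<close> and \<open>aS + b \<le> S\<close> on the support of the law,
  that is, if \<open>max N1 N2 \<le> S \<le> N3\<close>.\<close>

section \<open>Renewal theorem for a law with positive drift\<close>

text \<open>The obstacle is regularity: h is only known to be integrable, and r(s) is at first only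
  bounded by C exp(\<gamma> s). Two facts make up for this. An exponent \<beta> < \<alpha> with E
  A^\<beta> < 1 gives, for \<gamma> = \<alpha> - \<beta>, an integral of exp(-\<gamma> x) under
  \<rho> below 1, so convolution with \<rho> contracts functions of growth exp(\<gamma> s). This one
  inequality yields the positive drift, the bounded potential and the vanishing remainder when the
  renewal equation is iterated. And since tails are monotone, r(t) \<le> exp(\<alpha> (t - s)) r(s)
  for s \<le> t, which permits passing from averages over short intervals back to values of r.
  Moments of X are controlled only up to order \<beta>, so h is estimated by coupling the recursion
  with pure multiplication by A: the difference of \<alpha>-th powers costs order \<alpha> in the
  coefficients, but only order \<beta> in the state. The same machinery serves X, the maximum of the
  partial products, and the finite iterates of the perpetuity built from the absolute values of B;
  for the latter, bounds uniform in the number of steps replace a limit law.\<close>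

lemma AE_measure_support:
  fixes M :: "'a::{metric_space, second_countable_topology} measure"
  assumes "sets M = sets borel"
  shows "AE x in M. x \<in> measure_support M"
proof -
  define F where "F = {ball x e | (x::'a) e. e > 0 \<and> emeasure M (ball x e) = 0}"
  have op: "\<And>S. S \<in> F \<Longrightarrow> open S" by (auto simp: F_def)
  obtain F' where F': "F' \<subseteq> F" "countable F'" "\<Union>F' = \<Union>F"
    using Lindelof[OF op] by blast
  have nul: "S \<in> null_sets M" if "S \<in> F'" for S
    using that F' assms by (auto simp: F_def null_sets_def)
  have "(\<Union>S\<in>F'. S) \<in> null_sets M"
    by (rule null_sets_UN') (use F' nul in auto)
  moreover have "{x. x \<notin> measure_support M} \<subseteq> \<Union>F"
  proof
    fix x assume "x \<in> {x. x \<notin> measure_support M}"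
    then obtain e where "e > 0" "\<not> emeasure M (ball x e) > 0" by (auto simp: measure_support_def)
    then have "ball x e \<in> F" by (auto simp: F_def)
    with \<open>e > 0\<close> show "x \<in> \<Union>F" by (meson UnionI centre_in_ball)
  qed
  ultimately show ?thesis
    using F'(3) by (intro AE_I'[of "\<Union>F"]) auto
qed

lemma shift_at_top: "filterlim (\<lambda>s. s - c) at_top at_top" for c :: real
  using filterlim_tendsto_add_at_top[OF tendsto_const filterlim_ident, of "-c"] by simp

lemma measurable_abs_lipschitz:
  fixes g :: "real \<Rightarrow> real"
  assumes "\<And>s t. \<bar>g s - g t\<bar> \<le> L * \<bar>s - t\<bar>"
  shows "g \<in> borel_measurable borel"
proof -
  have "0 \<le> L" using order_trans[OF abs_ge_zero assms[of 1 0]] by simp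
  then have "L-lipschitz_on UNIV g"
    using assms by (auto intro!: lipschitz_onI simp: dist_real_def)
  then show ?thesis
    by (intro borel_measurable_continuous_onI lipschitz_on_continuous_on)
qed

lemma nn_integral_exp_atMost:
  fixes c s :: real
  assumes "c > 0"
  shows "(\<integral>\<^sup>+ v. ennreal (exp (c * v)) * indicator {..s} v \<partial>lborel) = ennreal (exp (c * s) / c)"
proof -
  have "(\<integral>\<^sup>+ v. ennreal (exp (c * v)) * indicator {..s} v \<partial>lborel)
     = (\<integral>\<^sup>+ v. ennreal (exp (- c * v)) * indicator {- s ..} v \<partial>lborel)"
    by (subst nn_integral_real_affine[where c="-1" and t=0]) (auto intro!: nn_integral_cong simp: indicator_def)
  also have "\<dots> = ennreal (0 - (- exp (- c * (- s)) / c))"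
  proof (rule nn_integral_FTC_atLeast)
    show "((\<lambda>v. - exp (- c * v) / c) has_real_derivative exp (- c * v)) (at v)" for v
      using assms by (auto intro!: derivative_eq_intros)
    have "filterlim (\<lambda>v. - c * v) at_bot at_top"
      using assms by (intro filterlim_tendsto_neg_mult_at_bot[OF tendsto_const _ filterlim_ident]) auto
    then have "((\<lambda>v. - exp (- c * v) / c) \<longlongrightarrow> - 0 / c) at_top"
      by (intro tendsto_intros filterlim_compose[OF exp_at_bot]) (use assms in auto)
    then show "((\<lambda>v. - exp (- c * v) / c) \<longlongrightarrow> 0) at_top" by simp
  qed auto
  finally show ?thesis by simp
qed

text \<open>\<open>exp_decay\<close> is the quantitative form of positive drift: convolution with
  \<rho> strictly contracts exponentials of rate \<gamma>. For the tilted law it becomes E A^\<beta>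
  < 1.\<close>

locale drifted_law = real_distribution \<rho> for \<rho> +
  fixes \<gamma> :: real
  assumes gamma_pos: "\<gamma> > 0"
    and exp_decay: "(\<integral>\<^sup>+ x. ennreal (exp (- \<gamma> * x)) \<partial>\<rho>) < 1"
    and integrable_id: "integrable \<rho> (\<lambda>x. x)"
    and nonarithmetic: "d > 0 \<Longrightarrow> \<not> (AE x in \<rho>. \<exists>k::int. x = d * of_int k)"
begin

definition drift :: real where "drift = (\<integral>x. x \<partial>\<rho>)"

definition decay :: real where "decay = enn2real (\<integral>\<^sup>+ x. ennreal (exp (- \<gamma> * x)) \<partial>\<rho>)"

lemma decay_eq: "(\<integral>\<^sup>+ x. ennreal (exp (- \<gamma> * x)) \<partial>\<rho>) = ennreal decay"
  unfolding decay_def using order.strict_trans[OF exp_decay ennreal_one_less_top]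
  by (intro ennreal_enn2real[symmetric])

lemma decay_nonneg: "decay \<ge> 0" by (simp add: decay_def)

lemma decay_less_1: "decay < 1"
  using exp_decay unfolding decay_eq by (simp add: decay_nonneg)

text \<open>Integrating 1 - \<gamma> x \<le> exp(-\<gamma> x) gives 1 - \<gamma>
  \<open>drift\<close> \<le> \<open>decay\<close> < 1.\<close>

lemma drift_pos: "drift > 0"
proof -
  have i: "integrable \<rho> (\<lambda>x. exp (- \<gamma> * x))"
    using order.strict_trans[OF exp_decay ennreal_one_less_top] by (intro integrableI_nonneg) auto
  have "decay = (\<integral>x. exp (- \<gamma> * x) \<partial>\<rho>)"
    unfolding decay_def by (subst integral_eq_nn_integral) auto
  moreover have "(\<integral>x. 1 + (- \<gamma>) * x \<partial>\<rho>) \<le> (\<integral>x. exp (- \<gamma> * x) \<partial>\<rho>)"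
    by (intro integral_mono i exp_ge_add_one_self Bochner_Integration.integrable_add integrable_mult_right integrable_id) auto
  moreover have "(\<integral>x. 1 + (- \<gamma>) * x \<partial>\<rho>) = 1 - \<gamma> * drift"
    using integrable_id prob_space by (subst Bochner_Integration.integral_add) (auto simp: drift_def)
  ultimately have "\<gamma> * drift > 0" using decay_less_1 by linarith
  then show ?thesis using gamma_pos by (simp add: zero_less_mult_iff)
qed

section \<open>Convolution with the law and its bounded potential\<close>

definition trans_op :: "(real \<Rightarrow> ennreal) \<Rightarrow> real \<Rightarrow> ennreal" where
  "trans_op f s = (\<integral>\<^sup>+ x. f (s - x) \<partial>\<rho>)"

lemma measurable_trans_op [measurable]:
  assumes [measurable]: "f \<in> borel_measurable borel"
  shows "trans_op f \<in> borel_measurable borel"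
  unfolding trans_op_def by measurable

lemma trans_op_mono: "(\<And>s. f s \<le> g s) \<Longrightarrow> trans_op f s \<le> trans_op g s"
  unfolding trans_op_def by (intro nn_integral_mono) auto

lemma trans_op_add:
  assumes [measurable]: "f \<in> borel_measurable borel" "g \<in> borel_measurable borel"
  shows "trans_op (\<lambda>s. f s + g s) s = trans_op f s + trans_op g s"
  unfolding trans_op_def by (intro nn_integral_add) auto

text \<open>Exponentials are eigenfunctions of convolution; the eigenvalue \<open>decay\<close> < 1
  is the source of all geometric decay below.\<close>

lemma trans_op_exp: "c \<ge> 0 \<Longrightarrow> trans_op (\<lambda>s. ennreal (c * exp (\<gamma> * s))) s = ennreal (c * decay * exp (\<gamma> * s))"
proof -
  assume c: "c \<ge> 0"
  have "trans_op (\<lambda>s. ennreal (c * exp (\<gamma> * s))) s = (\<integral>\<^sup>+ x. ennreal (c * exp (\<gamma> * s)) * ennreal (exp (- \<gamma> * x)) \<partial>\<rho>)"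
    unfolding trans_op_def using c
    by (intro nn_integral_cong) (simp add: ennreal_mult[symmetric] exp_diff exp_minus field_simps)
  also have "\<dots> = ennreal (c * exp (\<gamma> * s)) * ennreal decay"
    by (subst nn_integral_cmult) (use decay_eq in auto)
  also have "\<dots> = ennreal (c * decay * exp (\<gamma> * s))"
    using c decay_nonneg by (simp add: ennreal_mult[symmetric] mult_ac)
  finally show ?thesis .
qed

abbreviation box :: "real \<Rightarrow> ennreal" where "box \<equiv> indicator {0..1}"

text \<open>Partial potential of the random walk with step law \<rho>: the expected number of k < n
  for which s - S_k lies in [0, 1], where S_k is the walk started at 0. The recursion conditions on
  the first step.\<close>

primrec box_potential :: "nat \<Rightarrow> real \<Rightarrow> ennreal" where
  "box_potential 0 = (\<lambda>s. 0)"
| "box_potential (Suc n) = (\<lambda>s. box s + trans_op (box_potential n) s)"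

lemma measurable_box_potential [measurable]: "box_potential n \<in> borel_measurable borel"
  by (induction n) auto

text \<open>The constant K = 1 / (1 - \<open>decay\<close>) solves K = 1 + \<open>decay\<close> K,
  and the box is dominated by exp(\<gamma> s) because it lies in s \<ge> 0.\<close>

lemma box_potential_le_exp: "box_potential n s \<le> ennreal (exp (\<gamma> * s) / (1 - decay))"
proof (induction n arbitrary: s)
  case (Suc n)
  have q: "1 - decay > 0" using decay_less_1 by simp
  have "box s \<le> ennreal (exp (\<gamma> * s))"
    using gamma_pos by (auto simp: indicator_def)
  moreover have "trans_op (box_potential n) s \<le> trans_op (\<lambda>s. ennreal (1 / (1 - decay) * exp (\<gamma> * s))) s"
    using Suc by (intro trans_op_mono) auto
  moreover have "\<dots> = ennreal (1 / (1 - decay) * decay * exp (\<gamma> * s))"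
    using q by (intro trans_op_exp) auto
  ultimately have "box_potential (Suc n) s \<le> ennreal (exp (\<gamma> * s)) + ennreal (1 / (1 - decay) * decay * exp (\<gamma> * s))"
    by (auto intro: add_mono)
  also have "\<dots> = ennreal (exp (\<gamma> * s) + 1 / (1 - decay) * decay * exp (\<gamma> * s))"
    using q decay_nonneg by (intro ennreal_plus[symmetric]) auto
  also have "exp (\<gamma> * s) + 1 / (1 - decay) * decay * exp (\<gamma> * s) = exp (\<gamma> * s) / (1 - decay)"
    using q by (simp add: field_simps)
  finally show ?case .
qed (use decay_less_1 in auto)

text \<open>The preceding exponential bound at s = 1, where it is largest on the box.\<close>

definition pot_bound :: real where "pot_bound = exp \<gamma> / (1 - decay)"

lemma pot_bound_pos: "pot_bound > 0" using decay_less_1 by (simp add: pot_bound_def)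

text \<open>Maximum principle: outside the box the potential is an average of earlier potentials.\<close>
lemma box_potential_le: "box_potential n s \<le> ennreal pot_bound"
proof (induction n arbitrary: s)
  case (Suc n)
  show ?case
  proof (cases "s \<in> {0..1}")
    case True
    have "box_potential (Suc n) s \<le> ennreal (exp (\<gamma> * s) / (1 - decay))" by (rule box_potential_le_exp)
    also have "\<dots> \<le> ennreal pot_bound"
      unfolding pot_bound_def using True gamma_pos decay_less_1
      by (intro ennreal_leI divide_right_mono) auto
    finally show ?thesis .
  next
    case False
    have "trans_op (box_potential n) s \<le> (\<integral>\<^sup>+ x. ennreal pot_bound \<partial>\<rho>)"
      unfolding trans_op_def by (intro nn_integral_mono Suc)
    also have "\<dots> = ennreal pot_bound"
      using emeasure_space_1 by (simp del: space_eq_univ)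
    finally show ?thesis using False by auto
  qed
qed auto

lemma trans_op_conv:
  assumes [measurable]: "f \<in> borel_measurable borel" "h \<in> borel_measurable borel"
  shows "trans_op (\<lambda>s. \<integral>\<^sup>+ v. f (s - v) * h v \<partial>lborel) s = (\<integral>\<^sup>+ v. trans_op f (s - v) * h v \<partial>lborel)"
proof -
  interpret P: pair_sigma_finite \<rho> lborel ..
  have "trans_op (\<lambda>s. \<integral>\<^sup>+ v. f (s - v) * h v \<partial>lborel) s
      = (\<integral>\<^sup>+ x. \<integral>\<^sup>+ v. f (s - x - v) * h v \<partial>lborel \<partial>\<rho>)"
    unfolding trans_op_def ..
  also have "\<dots> = (\<integral>\<^sup>+ v. \<integral>\<^sup>+ x. f (s - x - v) * h v \<partial>\<rho> \<partial>lborel)"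
    by (subst P.Fubini') auto
  also have "\<dots> = (\<integral>\<^sup>+ v. trans_op f (s - v) * h v \<partial>lborel)"
    unfolding trans_op_def
    by (subst nn_integral_multc[symmetric]) (auto simp: algebra_simps)
  finally show ?thesis .
qed

lemma trans_op_box:
  assumes [measurable]: "r \<in> borel_measurable borel"
  shows "trans_op (\<lambda>s. \<integral>\<^sup>+ u. box u * r (s - u) \<partial>lborel) s = (\<integral>\<^sup>+ u. box u * trans_op r (s - u) \<partial>lborel)"
proof -
  interpret P: pair_sigma_finite \<rho> lborel ..
  have "trans_op (\<lambda>s. \<integral>\<^sup>+ u. box u * r (s - u) \<partial>lborel) s
      = (\<integral>\<^sup>+ x. \<integral>\<^sup>+ u. box u * r (s - x - u) \<partial>lborel \<partial>\<rho>)"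
    unfolding trans_op_def ..
  also have "\<dots> = (\<integral>\<^sup>+ u. \<integral>\<^sup>+ x. box u * r (s - x - u) \<partial>\<rho> \<partial>lborel)"
    by (subst P.Fubini') auto
  also have "\<dots> = (\<integral>\<^sup>+ u. box u * trans_op r (s - u) \<partial>lborel)"
    unfolding trans_op_def
    by (subst nn_integral_cmult[symmetric]) (auto simp: algebra_simps)
  finally show ?thesis .
qed

lemma box_reflect:
  fixes h :: "real \<Rightarrow> ennreal"
  assumes [measurable]: "h \<in> borel_measurable borel"
  shows "(\<integral>\<^sup>+ u. box u * h (s - u) \<partial>lborel) = (\<integral>\<^sup>+ v. box (s - v) * h v \<partial>lborel)"
  by (subst nn_integral_real_affine[where c="-1" and t=s]) auto

text \<open>Averaging r over a unit interval turns the point masses of the renewal measure into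
  \<open>box_potential\<close>, which is bounded. The averaged function R inherits the renewal
  inequality, and \<open>reg\<close> undoes the averaging at the price of exp \<alpha>. The constant
  C of the growth bound only enters a vanishing remainder, so it is absent from the
  conclusion.\<close>

lemma renewal_upper_bound:
  fixes r :: "real \<Rightarrow> real" and h :: "real \<Rightarrow> ennreal"
  assumes r [measurable]: "r \<in> borel_measurable borel" and h [measurable]: "h \<in> borel_measurable borel"
    and r0: "\<And>s. r s \<ge> 0" and rC: "\<And>s. r s \<le> C * exp (\<gamma> * s)"
    and ineq: "\<And>s. ennreal (r s) \<le> trans_op (\<lambda>s. ennreal (r s)) s + h s"
    and reg: "\<And>s t. s \<le> t \<Longrightarrow> r t \<le> exp (\<alpha> * (t - s)) * r s" and al: "\<alpha> \<ge> 0"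
  shows "ennreal (r s) \<le> ennreal (exp \<alpha> * pot_bound) * (\<integral>\<^sup>+ v. h v \<partial>lborel)"
proof -
  define R where "R = (\<lambda>s. \<integral>\<^sup>+ u. box u * ennreal (r (s - u)) \<partial>lborel)"
  have [measurable]: "R \<in> borel_measurable borel" unfolding R_def by measurable
  have C0: "C \<ge> 0" using order_trans[OF r0[of 0] rC[of 0]] by simp
  have RC: "R s \<le> ennreal (C * exp (\<gamma> * s))" for s
  proof -
    have "R s \<le> (\<integral>\<^sup>+ u. box u * ennreal (C * exp (\<gamma> * s)) \<partial>lborel)"
      unfolding R_def
    proof (intro nn_integral_mono)
      fix u :: real
      have "r (s - u) \<le> C * exp (\<gamma> * s)" if "u \<ge> 0"
        using that gamma_pos C0 by (intro order_trans[OF rC] mult_left_mono) auto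
      then show "box u * ennreal (r (s - u)) \<le> box u * ennreal (C * exp (\<gamma> * s))"
        by (auto simp: indicator_def intro!: ennreal_leI)
    qed
    also have "\<dots> = ennreal (C * exp (\<gamma> * s))" by (subst nn_integral_multc) auto
    finally show ?thesis .
  qed
  have step: "R s \<le> trans_op R s + (\<integral>\<^sup>+ v. box (s - v) * h v \<partial>lborel)" for s
  proof -
    have "R s \<le> (\<integral>\<^sup>+ u. box u * (trans_op (\<lambda>s. ennreal (r s)) (s - u) + h (s - u)) \<partial>lborel)"
      unfolding R_def by (intro nn_integral_mono mult_left_mono ineq) auto
    also have "\<dots> = (\<integral>\<^sup>+ u. box u * trans_op (\<lambda>s. ennreal (r s)) (s - u) \<partial>lborel) + (\<integral>\<^sup>+ u. box u * h (s - u) \<partial>lborel)"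
      by (subst nn_integral_add[symmetric]) (auto simp: distrib_left)
    finally show ?thesis
      unfolding R_def by (subst trans_op_box) (auto simp: box_reflect)
  qed
  \<comment> \<open>n-fold iteration of \<open>step\<close>: the first term collects the forcing,
    the second is what remains of the growth bound after n contractions.\<close>
  have main: "R s \<le> (\<integral>\<^sup>+ v. box_potential n (s - v) * h v \<partial>lborel) + ennreal (C * decay ^ n * exp (\<gamma> * s))" for n s
  proof (induction n arbitrary: s)
    case 0
    show ?case using RC by simp
  next
    case (Suc n)
    have cn: "C * decay ^ n \<ge> 0" using C0 decay_nonneg by simp
    have "trans_op R s \<le> trans_op (\<lambda>s. (\<integral>\<^sup>+ v. box_potential n (s - v) * h v \<partial>lborel) + ennreal (C * decay ^ n * exp (\<gamma> * s))) s"
      by (intro trans_op_mono Suc)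
    also have "\<dots> = (\<integral>\<^sup>+ v. trans_op (box_potential n) (s - v) * h v \<partial>lborel) + ennreal (C * decay ^ n * decay * exp (\<gamma> * s))"
      by (subst trans_op_add, measurable) (simp add: trans_op_conv trans_op_exp[OF cn])
    finally have "trans_op R s \<le> \<dots>" .
    then have "R s \<le> ((\<integral>\<^sup>+ v. trans_op (box_potential n) (s - v) * h v \<partial>lborel) + ennreal (C * decay ^ n * decay * exp (\<gamma> * s)))
        + (\<integral>\<^sup>+ v. box (s - v) * h v \<partial>lborel)"
      by (intro order_trans[OF step] add_mono) auto
    also have "\<dots> = ((\<integral>\<^sup>+ v. box (s - v) * h v \<partial>lborel) + (\<integral>\<^sup>+ v. trans_op (box_potential n) (s - v) * h v \<partial>lborel)) + ennreal (C * decay ^ n * decay * exp (\<gamma> * s))"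
      by (simp add: ac_simps)
    also have "(\<integral>\<^sup>+ v. box (s - v) * h v \<partial>lborel) + (\<integral>\<^sup>+ v. trans_op (box_potential n) (s - v) * h v \<partial>lborel)
        = (\<integral>\<^sup>+ v. box_potential (Suc n) (s - v) * h v \<partial>lborel)"
      by (subst nn_integral_add[symmetric]) (auto simp: distrib_right)
    finally show ?case by (simp add: mult_ac)
  qed
  define I where "I = ennreal pot_bound * (\<integral>\<^sup>+ v. h v \<partial>lborel)"
  have bd: "R s \<le> I + ennreal (C * decay ^ n * exp (\<gamma> * s))" for n
  proof -
    have "(\<integral>\<^sup>+ v. box_potential n (s - v) * h v \<partial>lborel) \<le> (\<integral>\<^sup>+ v. ennreal pot_bound * h v \<partial>lborel)"
      by (intro nn_integral_mono mult_right_mono box_potential_le) auto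
    also have "\<dots> = I" unfolding I_def by (subst nn_integral_cmult) auto
    finally show ?thesis by (intro order_trans[OF main] add_mono) auto
  qed
  have "(\<lambda>n. C * decay ^ n * exp (\<gamma> * s)) \<longlonglongrightarrow> C * 0 * exp (\<gamma> * s)"
    using decay_nonneg decay_less_1 by (intro tendsto_intros LIMSEQ_power_zero) auto
  then have "(\<lambda>n. ennreal (C * decay ^ n * exp (\<gamma> * s))) \<longlonglongrightarrow> ennreal 0"
    by (intro tendsto_ennrealI) auto
  then have "(\<lambda>n. I + ennreal (C * decay ^ n * exp (\<gamma> * s))) \<longlonglongrightarrow> I + ennreal 0"
    by (intro tendsto_add) auto
  then have RI: "R s \<le> I"
    using bd by (intro LIMSEQ_le_const[where X="\<lambda>n. I + ennreal (C * decay ^ n * exp (\<gamma> * s))"]) auto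
  \<comment> \<open>Back from the average to the value: by \<open>reg\<close>, r(s - u) \<ge>
    exp(-\<alpha>) r(s) for all u in [0, 1].\<close>
  have "ennreal (exp (- \<alpha>) * r s) = (\<integral>\<^sup>+ u. box u * ennreal (exp (- \<alpha>) * r s) \<partial>lborel)"
    by (subst nn_integral_multc) auto
  also have "\<dots> \<le> R s"
    unfolding R_def
  proof (intro nn_integral_mono)
    fix u :: real
    have "exp (- \<alpha>) * r s \<le> r (s - u)" if "u \<ge> 0" "u \<le> 1"
    proof -
      have "r s \<le> exp (\<alpha> * u) * r (s - u)" using reg[of "s - u" s] that by simp
      also have "\<dots> \<le> exp \<alpha> * r (s - u)" using al that r0 by (intro mult_right_mono) (auto simp: mult_left_le)
      finally show ?thesis by (simp add: exp_minus field_simps)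
    qed
    then show "box u * ennreal (exp (- \<alpha>) * r s) \<le> box u * ennreal (r (s - u))"
      by (auto simp: indicator_def intro!: ennreal_leI)
  qed
  finally have "ennreal (exp (- \<alpha>) * r s) \<le> I" using RI by simp
  then have "ennreal (exp \<alpha>) * ennreal (exp (- \<alpha>) * r s) \<le> ennreal (exp \<alpha>) * I" by (intro mult_left_mono) auto
  also have "ennreal (exp \<alpha>) * ennreal (exp (- \<alpha>) * r s) = ennreal (r s)"
    using r0 by (subst ennreal_mult[symmetric]) (auto simp: exp_minus)
  also have "ennreal (exp \<alpha>) * I = ennreal (exp \<alpha> * pot_bound) * (\<integral>\<^sup>+ v. h v \<partial>lborel)"
    unfolding I_def using pot_bound_pos by (subst ennreal_mult) (auto simp: mult_ac)
  finally show ?thesis .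
qed

section \<open>The Choquet--Deny argument and slow variation\<close>

lemma integrable_bounded:
  fixes f :: "real \<Rightarrow> real"
  assumes "f \<in> borel_measurable borel" "\<And>x. \<bar>f x\<bar> \<le> K"
  shows "integrable \<rho> f"
  using assms by (intro integrable_const_bound[where B=K]) auto

text \<open>The gap \<sigma> - \<psi>(t n - x) has \<rho>-mean tending to 0 by asymptotic
  harmonicity, and its negative part vanishes because \<psi> is eventually at most \<sigma> + e. So
  the gap tends to 0 in L1, and the Lipschitz bound turns this into convergence at every point y
  around which \<rho> has mass.\<close>

lemma near_maximum_shift:
  fixes \<psi> :: "real \<Rightarrow> real"
  assumes bound: "\<And>s. \<bar>\<psi> s\<bar> \<le> K" and lip: "\<And>s t. \<bar>\<psi> s - \<psi> t\<bar> \<le> L * \<bar>s - t\<bar>"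
    and harm: "((\<lambda>s. \<psi> s - (\<integral>x. \<psi> (s - x) \<partial>\<rho>)) \<longlongrightarrow> 0) at_top"
    and y: "y \<in> measure_support \<rho>"
    and up: "\<And>e. e > 0 \<Longrightarrow> eventually (\<lambda>s. \<psi> s \<le> \<sigma> + e) at_top"
    and t: "filterlim t at_top sequentially" and tl: "(\<lambda>n. \<psi> (t n)) \<longlonglongrightarrow> \<sigma>"
  shows "(\<lambda>n. \<psi> (t n - y)) \<longlonglongrightarrow> \<sigma>"
proof -
  have [measurable]: "\<psi> \<in> borel_measurable borel" by (rule measurable_abs_lipschitz[OF lip])
  have L0: "L \<ge> 0" using order_trans[OF abs_ge_zero lip[of 1 0]] by simp
  define f where "f n x = \<sigma> - \<psi> (t n - x)" for n x
  have [measurable]: "f n \<in> borel_measurable borel" for n unfolding f_def by measurable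
  have fb: "\<bar>f n x\<bar> \<le> \<bar>\<sigma>\<bar> + K" for n x
    using bound[of "t n - x"] unfolding f_def by linarith
  have fi: "integrable \<rho> (f n)" for n by (rule integrable_bounded[OF _ fb]) auto
  have f0: "(\<lambda>n. \<integral>x. f n x \<partial>\<rho>) \<longlonglongrightarrow> 0"
  proof -
    have "(\<integral>x. f n x \<partial>\<rho>) = \<sigma> - \<psi> (t n) + (\<psi> (t n) - (\<integral>x. \<psi> (t n - x) \<partial>\<rho>))" for n
    proof -
      have "integrable \<rho> (\<lambda>x. \<psi> (t n - x))" by (rule integrable_bounded[where K=K]) (use bound in auto)
      then show ?thesis unfolding f_def using prob_space by (subst Bochner_Integration.integral_diff) auto
    qed
    moreover have "(\<lambda>n. \<sigma> - \<psi> (t n) + (\<psi> (t n) - (\<integral>x. \<psi> (t n - x) \<partial>\<rho>))) \<longlonglongrightarrow> \<sigma> - \<sigma> + 0"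
      by (intro tendsto_intros tl filterlim_compose[OF harm t])
    ultimately show ?thesis by simp
  qed
  have neg: "(\<lambda>n. \<integral>x. max 0 (- f n x) \<partial>\<rho>) \<longlonglongrightarrow> (\<integral>x. 0 \<partial>\<rho>)"
  proof (rule integral_dominated_convergence[where w="\<lambda>_. \<bar>\<sigma>\<bar> + K"])
    show "AE x in \<rho>. (\<lambda>n. max 0 (- f n x)) \<longlonglongrightarrow> 0"
    proof (rule AE_I2)
      fix x
      have tx: "filterlim (\<lambda>n. t n - x) at_top sequentially"
        by (rule filterlim_at_top_mono[OF filterlim_tendsto_add_at_top[OF tendsto_const t]]) (auto intro: always_eventually)
      show "(\<lambda>n. max 0 (- f n x)) \<longlonglongrightarrow> 0"
      proof (rule tendstoI)
        fix e :: real assume e: "e > 0"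
        have "eventually (\<lambda>n. \<psi> (t n - x) \<le> \<sigma> + e / 2) sequentially"
          using up[of "e / 2"] e tx by (auto simp: filterlim_iff)
        then show "eventually (\<lambda>n. dist (max 0 (- f n x)) 0 < e) sequentially"
          by eventually_elim (use e in \<open>auto simp: f_def\<close>)
      qed
    qed
    show "AE x in \<rho>. norm (max 0 (- f n x)) \<le> \<bar>\<sigma>\<bar> + K" for n
    proof (rule AE_I2)
      fix x show "norm (max 0 (- f n x)) \<le> \<bar>\<sigma>\<bar> + K" using fb[of n x] by (auto simp: max_def)
    qed
  qed auto
  have absl: "(\<lambda>n. \<integral>x. \<bar>f n x\<bar> \<partial>\<rho>) \<longlonglongrightarrow> 0"
  proof -
    have mi: "integrable \<rho> (\<lambda>x. max 0 (- f n x))" for n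
      by (rule Bochner_Integration.integrable_bound[OF fi[of n]]) auto
    have "(\<integral>x. \<bar>f n x\<bar> \<partial>\<rho>) = (\<integral>x. f n x \<partial>\<rho>) + 2 * (\<integral>x. max 0 (- f n x) \<partial>\<rho>)" for n
    proof -
      have "(\<integral>x. \<bar>f n x\<bar> \<partial>\<rho>) = (\<integral>x. f n x + 2 * max 0 (- f n x) \<partial>\<rho>)"
        by (intro Bochner_Integration.integral_cong) auto
      then show ?thesis using fi mi by simp
    qed
    moreover have "(\<lambda>n. (\<integral>x. f n x \<partial>\<rho>) + 2 * (\<integral>x. max 0 (- f n x) \<partial>\<rho>)) \<longlonglongrightarrow> 0 + 2 * (\<integral>x. 0 \<partial>\<rho>)"
      by (intro tendsto_intros f0 neg)
    ultimately show ?thesis by simp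
  qed
  have "(\<lambda>n. f n y) \<longlonglongrightarrow> 0"
  proof (rule tendstoI)
    fix e :: real assume e: "e > 0"
    \<comment> \<open>On the ball of radius d the gap differs from its value at y by at most e / 4.
      With an L1 norm below p e / 2 this leaves a value below 3 e / 4 at y.\<close>
    define d where "d = e / (4 * (L + 1))"
    have d: "d > 0" "L * d \<le> e / 4"
      using e L0 by (auto simp: d_def field_simps)
    define p where "p = measure \<rho> (ball y d)"
    have p: "p > 0" using y d(1) unfolding p_def measure_support_def
      by (simp add: emeasure_eq_measure)
    have "eventually (\<lambda>n. (\<integral>x. \<bar>f n x\<bar> \<partial>\<rho>) < p * e / 2) sequentially"
      using p e by (intro order_tendstoD(2)[OF absl]) auto
    then show "eventually (\<lambda>n. dist (f n y) 0 < e) sequentially"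
    proof eventually_elim
      case (elim n)
      have i1: "integrable \<rho> (\<lambda>x. indicator (ball y d) x * (\<bar>f n y\<bar> - L * d))"
        by (rule integrable_bounded[where K="\<bar>\<bar>f n y\<bar> - L * d\<bar>"]) (auto simp: indicator_def)
      have "p * (\<bar>f n y\<bar> - L * d) = (\<integral>x. indicator (ball y d) x * (\<bar>f n y\<bar> - L * d) \<partial>\<rho>)"
        by (simp add: p_def)
      also have "\<dots> \<le> (\<integral>x. \<bar>f n x\<bar> \<partial>\<rho>)"
      proof (intro integral_mono i1 integrable_abs fi)
        fix x
        show "indicator (ball y d) x * (\<bar>f n y\<bar> - L * d) \<le> \<bar>f n x\<bar>"
        proof (cases "x \<in> ball y d")
          case True
          have "\<bar>f n y - f n x\<bar> \<le> L * \<bar>y - x\<bar>"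
            using lip[of "t n - x" "t n - y"] by (simp add: f_def abs_minus_commute)
          also have "\<dots> \<le> L * d" using True L0 by (intro mult_left_mono) (auto simp: dist_real_def)
          finally show ?thesis using True by (simp add: abs_le_iff) linarith
        qed auto
      qed
      also note elim
      finally have "p * (\<bar>f n y\<bar> - L * d) < p * (e / 2)" by simp
      then have "\<bar>f n y\<bar> - L * d < e / 2" using p by (simp only: mult_less_cancel_left_pos)
      then show ?case using d(2) by (simp add: dist_real_def)
    qed
  qed
  then have "(\<lambda>n. \<sigma> - f n y) \<longlonglongrightarrow> \<sigma> - 0" by (intro tendsto_intros)
  then show ?thesis by (simp add: f_def)
qed

text \<open>Asymptotic form of the Choquet--Deny argument: a positive upper limit of the increment
  would be nearly attained along a whole arithmetic progression, contradicting boundedness.\<close>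
lemma increment_upper:
  fixes g :: "real \<Rightarrow> real"
  assumes bound: "\<And>s. \<bar>g s\<bar> \<le> M" and lip: "\<And>s t. \<bar>g s - g t\<bar> \<le> L * \<bar>s - t\<bar>"
    and harm: "((\<lambda>s. g s - (\<integral>x. g (s - x) \<partial>\<rho>)) \<longlongrightarrow> 0) at_top"
    and y: "y \<in> measure_support \<rho>" and eta: "\<eta> > 0"
  shows "eventually (\<lambda>s. g s - g (s - y) < \<eta>) at_top"
proof -
  have [measurable]: "g \<in> borel_measurable borel" by (rule measurable_abs_lipschitz[OF lip])
  define \<psi> where "\<psi> s = g s - g (s - y)" for s
  have \<psi>b: "\<bar>\<psi> s\<bar> \<le> 2 * M" for s using bound[of s] bound[of "s - y"] unfolding \<psi>_def by linarith
  have \<psi>l: "\<bar>\<psi> s - \<psi> t\<bar> \<le> 2 * L * \<bar>s - t\<bar>" for s t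
    using lip[of s t] lip[of "s - y" "t - y"] unfolding \<psi>_def by (simp add: algebra_simps abs_le_iff)
  have \<psi>h: "((\<lambda>s. \<psi> s - (\<integral>x. \<psi> (s - x) \<partial>\<rho>)) \<longlongrightarrow> 0) at_top"
  proof -
    have "\<psi> s - (\<integral>x. \<psi> (s - x) \<partial>\<rho>) = (g s - (\<integral>x. g (s - x) \<partial>\<rho>)) - (g (s - y) - (\<integral>x. g ((s - y) - x) \<partial>\<rho>))" for s
    proof -
      have i: "integrable \<rho> (\<lambda>x. g (s - x))" for s by (rule integrable_bounded[where K=M]) (use bound in auto)
      have "(\<integral>x. \<psi> (s - x) \<partial>\<rho>) = (\<integral>x. g (s - x) - g ((s - y) - x) \<partial>\<rho>)"
        unfolding \<psi>_def by (simp add: algebra_simps)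
      then show ?thesis using i[of s] i[of "s - y"] by (simp add: \<psi>_def)
    qed
    moreover have "((\<lambda>s. (g s - (\<integral>x. g (s - x) \<partial>\<rho>)) - (g (s - y) - (\<integral>x. g ((s - y) - x) \<partial>\<rho>))) \<longlongrightarrow> 0 - 0) at_top"
      by (intro tendsto_diff harm filterlim_compose[OF harm shift_at_top])
    ultimately show ?thesis by simp
  qed
  \<comment> \<open>The infimum \<sigma> of the eventual upper bounds is the limit superior of
    \<psi> at infinity; boundedness of \<psi> makes it a real number.\<close>
  define U where "U = {c. eventually (\<lambda>s. \<psi> s \<le> c) at_top}"
  define \<sigma> where "\<sigma> = Inf U"
  have "2 * M \<in> U" unfolding U_def using \<psi>b by (simp add: abs_le_iff)
  then have ne: "U \<noteq> {}" by auto
  have bdd: "bdd_below U"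
  proof (rule bdd_belowI[where m="- (2 * M)"])
    fix c assume "c \<in> U"
    then have "\<exists>s. \<psi> s \<le> c" unfolding U_def using eventually_happens'[OF trivial_limit_at_top_linorder] by blast
    then obtain s where "\<psi> s \<le> c" ..
    then show "- (2 * M) \<le> c" using \<psi>b[of s] by linarith
  qed
  have up: "eventually (\<lambda>s. \<psi> s \<le> \<sigma> + e) at_top" if "e > 0" for e
  proof -
    have "Inf U < \<sigma> + e" using that by (simp add: \<sigma>_def)
    then obtain c where "c \<in> U" "c < \<sigma> + e" using cInf_lessD[OF ne] by blast
    then show ?thesis unfolding U_def by (auto elim: eventually_mono)
  qed
  have "\<exists>t. t \<ge> real n \<and> \<psi> t > \<sigma> - 1 / real (Suc n)" for n
  proof (rule ccontr)
    assume "\<not> ?thesis"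
    then have "\<psi> t \<le> \<sigma> - 1 / real (Suc n)" if "t \<ge> real n" for t using that by force
    then have "\<sigma> - 1 / real (Suc n) \<in> U" unfolding U_def eventually_at_top_linorder by auto
    then have "Inf U \<le> \<sigma> - 1 / real (Suc n)" by (rule cInf_lower[OF _ bdd])
    then show False by (simp add: \<sigma>_def)
  qed
  then obtain t where t: "\<And>n. t n \<ge> real n" "\<And>n. \<psi> (t n) > \<sigma> - 1 / real (Suc n)" by metis
  have tt: "filterlim t at_top sequentially"
    by (rule filterlim_at_top_mono[OF filterlim_real_sequentially]) (use t in auto)
  have tl: "(\<lambda>n. \<psi> (t n)) \<longlonglongrightarrow> \<sigma>"
  proof (rule tendstoI)
    fix e :: real assume e: "e > 0"
    have "eventually (\<lambda>n. \<psi> (t n) \<le> \<sigma> + e / 2) sequentially"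
      using up[of "e / 2"] e tt by (auto simp: filterlim_iff)
    moreover have "eventually (\<lambda>n. 1 / real (Suc n) < e) sequentially"
      using order_tendstoD(2)[OF LIMSEQ_inverse_real_of_nat e] by (simp add: inverse_eq_divide)
    ultimately show "eventually (\<lambda>n. dist (\<psi> (t n)) \<sigma> < e) sequentially"
    proof eventually_elim
      case (elim n)
      then show ?case using t(2)[of n] e by (simp add: dist_real_def abs_less_iff)
    qed
  qed
  have tk: "filterlim (\<lambda>n. t n - real k * y) at_top sequentially" for k
    by (rule filterlim_compose[OF shift_at_top tt])
  have lim: "(\<lambda>n. \<psi> (t n - real k * y)) \<longlonglongrightarrow> \<sigma>" for k
  proof (induction k)
    case (Suc k)
    have "(\<lambda>n. \<psi> (t n - real k * y - y)) \<longlonglongrightarrow> \<sigma>"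
      by (rule near_maximum_shift[OF \<psi>b \<psi>l \<psi>h y up tk Suc])
    then show ?case by (simp add: algebra_simps)
  qed (use tl in simp)
  \<comment> \<open>The N increments along t n, t n - y, t n - 2y, ... telescope to a difference of
    two values of g, yet each of them tends to \<sigma>.\<close>
  have N: "real N * \<sigma> \<le> 2 * M" for N
  proof -
    have "(\<lambda>n. \<Sum>k<N. \<psi> (t n - real k * y)) \<longlonglongrightarrow> (\<Sum>k<N. \<sigma>)"
      by (intro tendsto_sum lim)
    moreover have "(\<Sum>k<N. \<psi> (t n - real k * y)) \<le> 2 * M" for n
    proof -
      have "(\<Sum>k<N. \<psi> (t n - real k * y)) = (\<Sum>k<N. g (t n - real k * y) - g (t n - real (Suc k) * y))"
        unfolding \<psi>_def by (simp add: algebra_simps)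
      also have "\<dots> = g (t n - real 0 * y) - g (t n - real N * y)"
        by (rule sum_lessThan_telescope')
      also have "\<dots> \<le> 2 * M" using bound[of "t n - real 0 * y"] bound[of "t n - real N * y"] by linarith
      finally show ?thesis .
    qed
    ultimately have "(\<Sum>k<N. \<sigma>) \<le> 2 * M" by (intro LIMSEQ_le_const2) auto
    then show ?thesis by simp
  qed
  have "\<sigma> \<le> 0"
  proof (rule ccontr)
    assume "\<not> \<sigma> \<le> 0"
    then obtain N :: nat where "real N * \<sigma> > 2 * M" using reals_Archimedean3[of \<sigma>] by auto
    with N[of N] show False by simp
  qed
  then show ?thesis
    using up[of "\<eta> / 2"] eta unfolding \<psi>_def by (auto elim!: eventually_mono)
qed

lemma slow_variation_support:
  fixes g :: "real \<Rightarrow> real"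
  assumes bound: "\<And>s. \<bar>g s\<bar> \<le> M" and lip: "\<And>s t. \<bar>g s - g t\<bar> \<le> L * \<bar>s - t\<bar>"
    and harm: "((\<lambda>s. g s - (\<integral>x. g (s - x) \<partial>\<rho>)) \<longlongrightarrow> 0) at_top"
    and y: "y \<in> measure_support \<rho>"
  shows "((\<lambda>s. g s - g (s - y)) \<longlongrightarrow> 0) at_top"
proof (rule tendstoI)
  fix e :: real assume e: "e > 0"
  have "eventually (\<lambda>s. g s - g (s - y) < e) at_top"
    by (rule increment_upper[OF bound lip harm y e])
  moreover have "eventually (\<lambda>s. (- g s) - (- g (s - y)) < e) at_top"
  proof (rule increment_upper[OF _ _ _ y e])
    show "\<bar>- g s\<bar> \<le> M" for s using bound by simp
    show "\<bar>- g s - - g t\<bar> \<le> L * \<bar>s - t\<bar>" for s t using lip[of t s] by (simp add: abs_minus_commute)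
    show "((\<lambda>s. - g s - (\<integral>x. - g (s - x) \<partial>\<rho>)) \<longlongrightarrow> 0) at_top"
      using tendsto_minus[OF harm] by simp
  qed
  ultimately show "eventually (\<lambda>s. dist (g s - g (s - y)) 0 < e) at_top"
    by eventually_elim (simp add: dist_real_def abs_less_iff)
qed

text \<open>The shifts that are asymptotically periods form a closed subgroup; a proper one would
  make the law arithmetic.\<close>
lemma slow_variation:
  fixes g :: "real \<Rightarrow> real"
  assumes bound: "\<And>s. \<bar>g s\<bar> \<le> M" and lip: "\<And>s t. \<bar>g s - g t\<bar> \<le> L * \<bar>s - t\<bar>"
    and harm: "((\<lambda>s. g s - (\<integral>x. g (s - x) \<partial>\<rho>)) \<longlongrightarrow> 0) at_top"
  shows "((\<lambda>s. g s - g (s - y)) \<longlongrightarrow> 0) at_top"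
proof -
  have L0: "L \<ge> 0" using order_trans[OF abs_ge_zero lip[of 1 0]] by simp
  define Z where "Z = {y. ((\<lambda>s. g s - g (s - y)) \<longlongrightarrow> 0) at_top}"
  have supp: "measure_support \<rho> \<subseteq> Z"
    unfolding Z_def using slow_variation_support[OF assms] by blast
  have zero: "0 \<in> Z" by (simp add: Z_def)
  have sh: "((\<lambda>s. g (s - c) - g (s - c - b)) \<longlongrightarrow> 0) at_top" if "b \<in> Z" for b c
    using that filterlim_compose[OF _ shift_at_top[of c]] unfolding Z_def by blast
  have add: "a + b \<in> Z" if "a \<in> Z" "b \<in> Z" for a b
  proof -
    have "((\<lambda>s. (g s - g (s - a)) + (g (s - a) - g (s - a - b))) \<longlongrightarrow> 0 + 0) at_top"
      using that(1) sh[OF that(2)] unfolding Z_def by (intro tendsto_add) auto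
    then show ?thesis unfolding Z_def by (simp add: algebra_simps)
  qed
  have minus: "- a \<in> Z" if "a \<in> Z" for a
  proof -
    have "((\<lambda>s. - (g (s - (-a)) - g (s - (-a) - a))) \<longlongrightarrow> - 0) at_top"
      by (intro tendsto_minus sh that)
    then show ?thesis unfolding Z_def by simp
  qed
  have diff: "a - b \<in> Z" if "a \<in> Z" "b \<in> Z" for a b using add[OF that(1) minus[OF that(2)]] by simp
  have nmult: "real n * a \<in> Z" if "a \<in> Z" for a n
    by (induction n) (use zero add that in \<open>auto simp: algebra_simps\<close>)
  have imult: "of_int k * a \<in> Z" if "a \<in> Z" for a k
    using nmult[OF that, of "nat k"] minus[OF nmult[OF that, of "nat (- k)"]]
    by (cases "k \<ge> 0") auto
  have closed: "z \<in> Z" if z: "\<And>e. e > 0 \<Longrightarrow> \<exists>a\<in>Z. \<bar>z - a\<bar> < e" for z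
    unfolding Z_def mem_Collect_eq
  proof (rule tendstoI)
    fix e :: real assume e: "e > 0"
    obtain a where a: "a \<in> Z" "\<bar>z - a\<bar> < e / (2 * (L + 1))" using z[of "e / (2 * (L + 1))"] e L0 by auto
    have "eventually (\<lambda>s. dist (g s - g (s - a)) 0 < e / 2) at_top"
      using a(1) e unfolding Z_def by (intro tendstoD) auto
    then show "eventually (\<lambda>s. dist (g s - g (s - z)) 0 < e) at_top"
    proof eventually_elim
      case (elim s)
      have "\<bar>g (s - a) - g (s - z)\<bar> \<le> L * \<bar>z - a\<bar>" using lip[of "s - a" "s - z"] by simp
      also have "\<dots> \<le> (L + 1) * \<bar>z - a\<bar>" by (intro mult_right_mono) auto
      also have "\<dots> < e / 2" using a(2) L0 by (simp add: field_simps)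
      finally have "\<bar>g (s - a) - g (s - z)\<bar> < e / 2" .
      moreover have "\<bar>g s - g (s - a)\<bar> < e / 2" using elim by (simp add: dist_real_def)
      ultimately have "\<bar>g s - g (s - z)\<bar> < e" by linarith
      then show ?case by (simp add: dist_real_def)
    qed
  qed
  have "y \<in> Z"
  \<comment> \<open>Either Z has arbitrarily small positive elements, hence is dense and, being
    closed, everything; or its positive elements keep a distance e from 0 and Z is a
    lattice.\<close>
  proof (cases "\<forall>e>0. \<exists>a\<in>Z. 0 < a \<and> a < e")
    case True
    show ?thesis
    proof (rule closed)
      fix e :: real assume "e > 0"
      then obtain a where a: "a \<in> Z" "0 < a" "a < e" using True by blast
      have "y - of_int \<lfloor>y / a\<rfloor> * a = a * frac (y / a)"
        using a(2) by (simp add: frac_def field_simps)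
      moreover have "0 \<le> a * frac (y / a)" "a * frac (y / a) < a"
        using a(2) frac_ge_0[of "y / a"] frac_lt_1[of "y / a"] by auto
      ultimately have "\<bar>y - of_int \<lfloor>y / a\<rfloor> * a\<bar> < a" by linarith
      then show "\<exists>b\<in>Z. \<bar>y - b\<bar> < e" using imult[OF a(1)] a(3) by (meson order.strict_trans)
    qed
  next
    case False
    then obtain e where e: "e > 0" "\<And>a. a \<in> Z \<Longrightarrow> 0 < a \<Longrightarrow> e \<le> a" by force
    have "\<exists>d>0. \<forall>a\<in>Z. \<exists>k::int. a = d * of_int k"
    proof (cases "\<exists>a\<in>Z. a > 0")
      case False
      have "a = 0" if "a \<in> Z" for a using False that minus[OF that] by (metis linorder_neqE_linordered_idom neg_0_less_iff_less)
      \<comment> \<open>The trivial subgroup lies in every lattice; spacing 1 is an arbitrary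
        choice.\<close>
      then have "a = 1 * of_int 0" if "a \<in> Z" for a :: real using that by simp
      then show ?thesis using zero_less_one by blast
    next
      case True
      define P where "P = {a \<in> Z. a > 0}"
      define d where "d = Inf P"
      have ne: "P \<noteq> {}" using True by (auto simp: P_def)
      have bd: "bdd_below P" by (rule bdd_belowI[where m=0]) (auto simp: P_def)
      have de: "d \<ge> e" unfolding d_def by (rule cInf_greatest[OF ne]) (use e in \<open>auto simp: P_def\<close>)
      have "\<exists>a\<in>P. a < d + e" using cInf_lessD[OF ne, of "d + e"] e(1) by (auto simp: d_def)
      then obtain a where a: "a \<in> P" "a < d + e" by blast
      have da: "d \<le> a" unfolding d_def by (rule cInf_lower[OF a(1) bd])
      \<comment> \<open>The infimum is attained: a smaller positive element b of Z would also lie in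
        [d, d + e), and a - b would be a positive element below the gap e.\<close>
      have "d = a"
      proof (rule ccontr)
        assume "d \<noteq> a"
        then have "d < a" using da by simp
        then obtain b where b: "b \<in> P" "b < a" using cInf_lessD[OF ne, of a] by (auto simp: d_def)
        have "d \<le> b" unfolding d_def by (rule cInf_lower[OF b(1) bd])
        then have "a - b < e" using a(2) by simp
        moreover have "a - b \<in> Z" using diff a(1) b(1) by (auto simp: P_def)
        ultimately show False using e(2)[of "a - b"] b(2) by simp
      qed
      then have dZ: "d \<in> Z" "d > 0" using a(1) by (auto simp: P_def)
      have "\<exists>k::int. c = d * of_int k" if "c \<in> Z" for c
      proof -
        define b where "b = c - of_int \<lfloor>c / d\<rfloor> * d"
        have bZ: "b \<in> Z" unfolding b_def by (intro diff that imult dZ)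
        have "b = d * frac (c / d)" using dZ(2) by (simp add: b_def frac_def field_simps)
        then have "0 \<le> b" "b < d" using dZ(2) frac_ge_0[of "c / d"] frac_lt_1[of "c / d"] by auto
        moreover have "\<not> b > 0" using bZ cInf_lower[OF _ bd, of b] \<open>b < d\<close> by (auto simp: P_def d_def)
        ultimately have "b = 0" by simp
        then show ?thesis by (intro exI[of _ "\<lfloor>c / d\<rfloor>"]) (simp add: b_def mult.commute)
      qed
      then show ?thesis using dZ(2) by blast
    qed
    then obtain d where d: "d > 0" "\<And>a. a \<in> Z \<Longrightarrow> \<exists>k::int. a = d * of_int k" by blast
    have "AE x in \<rho>. x \<in> measure_support \<rho>" by (rule AE_measure_support) simp
    then have "AE x in \<rho>. \<exists>k::int. x = d * of_int k"
      by eventually_elim (use supp d(2) in blast)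
    with nonarithmetic[OF d(1)] show ?thesis by blast
  qed
  then show ?thesis by (simp add: Z_def)
qed

section \<open>Increments of a Lipschitz primitive and the renewal limit\<close>

lemma integrable_lipschitz_increment:
  fixes G :: "real \<Rightarrow> real"
  assumes lip: "\<And>s t. \<bar>G s - G t\<bar> \<le> R * \<bar>s - t\<bar>"
  shows "integrable \<rho> (\<lambda>x. G s - G (s - x))"
proof (rule Bochner_Integration.integrable_bound)
  have [measurable]: "G \<in> borel_measurable borel" by (rule measurable_abs_lipschitz[OF lip])
  show "integrable \<rho> (\<lambda>x. R * \<bar>x\<bar>)" by (intro integrable_mult_right integrable_abs integrable_id)
  show "AE x in \<rho>. norm (G s - G (s - x)) \<le> norm (R * \<bar>x\<bar>)"
  proof (rule AE_I2)
    fix x show "norm (G s - G (s - x)) \<le> norm (R * \<bar>x\<bar>)"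
      using order_trans[OF lip[of s "s - x"] abs_ge_self] by simp
  qed
  show "(\<lambda>x. G s - G (s - x)) \<in> borel_measurable \<rho>" by measurable
qed

text \<open>For fixed x the increment G(s) - G(s - x) is bounded in s, and its defect from
  harmonicity is a difference of two quantities with the same limit H, so it varies slowly. Slow
  variation makes increments asymptotically additive in x, hence linear. Averaging the relation over
  x under \<rho> identifies the slope as H / \<open>drift\<close>.\<close>

lemma increment_limit:
  fixes G :: "real \<Rightarrow> real"
  assumes lip: "\<And>s t. \<bar>G s - G t\<bar> \<le> R * \<bar>s - t\<bar>"
    and lim: "((\<lambda>s. \<integral>x. G s - G (s - x) \<partial>\<rho>) \<longlongrightarrow> H) at_top"
  shows "((\<lambda>s. G s - G (s - d)) \<longlongrightarrow> d * (H / drift)) at_top"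
proof -
  have [measurable]: "G \<in> borel_measurable borel" by (rule measurable_abs_lipschitz[OF lip])
  have R0: "R \<ge> 0" using order_trans[OF abs_ge_zero lip[of 1 0]] by simp
  note gi = integrable_lipschitz_increment[OF lip]
  define e where "e s x = G s - G (s - x)" for s x
  have eb: "\<bar>e s x\<bar> \<le> R * \<bar>x\<bar>" for s x using lip[of s "s - x"] by (simp add: e_def)
  have sv: "((\<lambda>s. e s x - e (s - y) x) \<longlongrightarrow> 0) at_top" for x y
  proof (rule slow_variation[where M="R * \<bar>x\<bar>" and L="2 * R"])
    show "\<bar>e s x\<bar> \<le> R * \<bar>x\<bar>" for s by (rule eb)
    show "\<bar>e s x - e t x\<bar> \<le> 2 * R * \<bar>s - t\<bar>" for s t
      using lip[of s t] lip[of "s - x" "t - x"] unfolding e_def by (simp add: abs_le_iff)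
    have "e s x - (\<integral>u. e (s - u) x \<partial>\<rho>) = (\<integral>u. G s - G (s - u) \<partial>\<rho>) - (\<integral>u. G (s - x) - G ((s - x) - u) \<partial>\<rho>)" for s
    proof -
      have ei: "integrable \<rho> (\<lambda>u. e (s - u) x)"
        by (rule integrable_bounded[where K="R * \<bar>x\<bar>"]) (auto simp: eb, simp add: e_def)
      have "e s x - (\<integral>u. e (s - u) x \<partial>\<rho>) = (\<integral>u. e s x - e (s - u) x \<partial>\<rho>)"
        using ei prob_space by (subst Bochner_Integration.integral_diff) auto
      also have "\<dots> = (\<integral>u. (G s - G (s - u)) - (G (s - x) - G ((s - x) - u)) \<partial>\<rho>)"
        by (intro Bochner_Integration.integral_cong) (auto simp: e_def algebra_simps)
      also have "\<dots> = (\<integral>u. G s - G (s - u) \<partial>\<rho>) - (\<integral>u. G (s - x) - G ((s - x) - u) \<partial>\<rho>)"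
        by (intro Bochner_Integration.integral_diff gi)
      finally show ?thesis .
    qed
    moreover have "((\<lambda>s. (\<integral>u. G s - G (s - u) \<partial>\<rho>) - (\<integral>u. G (s - x) - G ((s - x) - u) \<partial>\<rho>)) \<longlongrightarrow> H - H) at_top"
      by (intro tendsto_diff lim filterlim_compose[OF lim shift_at_top])
    ultimately show "((\<lambda>s. e s x - (\<integral>u. e (s - u) x \<partial>\<rho>)) \<longlongrightarrow> 0) at_top" by simp
  qed
  have mult: "((\<lambda>s. e s (real k * x) - real k * e s x) \<longlongrightarrow> 0) at_top" for k x
  proof (induction k)
    case (Suc k)
    have "((\<lambda>s. (e s (real k * x) - real k * e s x) - (e s x - e (s - real k * x) x)) \<longlongrightarrow> 0 - 0) at_top"
      by (intro tendsto_diff Suc sv)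
    then show ?case by (simp add: e_def algebra_simps)
  qed (simp add: e_def)
  have lin_pos: "((\<lambda>s. e s x - x * e s 1) \<longlongrightarrow> 0) at_top" if x: "x \<ge> 0" for x
  proof (rule tendstoI)
    fix \<epsilon> :: real assume eps: "\<epsilon> > 0"
    \<comment> \<open>The total error after multiplying by k is 2R + 2: 1 from each of the two uses
      of \<open>mult\<close>, R from rounding k x to the integer j inside the increment, and R from
      the same rounding in the coefficient of \<open>e s 1\<close>.\<close>
    obtain k :: nat where k: "real k * \<epsilon> > 2 * R + 2" using reals_Archimedean3[OF eps] by auto
    have k0: "real k > 0" using k R0 eps by (cases k) auto
    define j where "j = nat \<lfloor>real k * x\<rfloor>"
    have j: "\<bar>real k * x - real j\<bar> \<le> 1"
      unfolding j_def using x floor_correct[of "real k * x"] by (auto simp: abs_le_iff) linarith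
    have "eventually (\<lambda>s. dist (e s (real j * 1) - real j * e s 1) 0 < 1) at_top"
      by (intro tendstoD mult) auto
    moreover have "eventually (\<lambda>s. dist (e s (real k * x) - real k * e s x) 0 < 1) at_top"
      by (intro tendstoD mult) auto
    ultimately show "eventually (\<lambda>s. dist (e s x - x * e s 1) 0 < \<epsilon>) at_top"
    proof eventually_elim
      case (elim s)
      have a: "\<bar>e s (real k * x) - e s (real j)\<bar> \<le> R"
      proof -
        have "\<bar>e s (real k * x) - e s (real j)\<bar> \<le> R * \<bar>real k * x - real j\<bar>"
          using lip[of "s - real j" "s - real k * x"] by (simp add: e_def)
        also have "\<dots> \<le> R * 1" using j R0 by (intro mult_left_mono)
        finally show ?thesis by simp
      qed
      have b: "\<bar>(real k * x - real j) * e s 1\<bar> \<le> R"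
        using mult_mono[OF j eb[of s 1]] R0 by (simp add: abs_mult)
      have "real k * (e s x - x * e s 1) = (e s (real j * 1) - real j * e s 1) - (e s (real k * x) - real k * e s x)
         + (e s (real k * x) - e s (real j)) - (real k * x - real j) * e s 1"
        by (simp add: algebra_simps)
      then have "\<bar>real k * (e s x - x * e s 1)\<bar> < 2 * R + 2"
        using elim a b by (simp only: dist_real_def)
      then have "real k * \<bar>e s x - x * e s 1\<bar> < real k * \<epsilon>" using k by (simp add: abs_mult)
      then show ?case using k0 by (simp add: dist_real_def)
    qed
  qed
  have lin: "((\<lambda>s. e s x - x * e s 1) \<longlongrightarrow> 0) at_top" for x
  proof (cases "x \<ge> 0")
    case False
    \<comment> \<open>A backward increment is minus a forward one at a shifted base point, e s x = -
      e (s - x) (- x), and the shift is harmless by slow variation.\<close>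
    have "((\<lambda>s. (e s (- x) - e (s - x) (- x)) - (e s (- x) - (- x) * e s 1)) \<longlongrightarrow> 0 - 0) at_top"
      using False by (intro tendsto_diff sv lin_pos) auto
    then show ?thesis by (simp add: e_def algebra_simps)
  qed (rule lin_pos)
  have "((\<lambda>s. \<integral>x. e s x - x * e s 1 \<partial>\<rho>) \<longlongrightarrow> (\<integral>x. 0 \<partial>\<rho>)) at_top"
  proof (rule integral_dominated_convergence_at_top[where w="\<lambda>x. 2 * R * \<bar>x\<bar>"])
    show "integrable \<rho> (\<lambda>x. 2 * R * \<bar>x\<bar>)" by (intro integrable_mult_right integrable_abs integrable_id)
    show "\<forall>\<^sub>F s in at_top. AE x in \<rho>. norm (e s x - x * e s 1) \<le> 2 * R * \<bar>x\<bar>"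
    proof (intro always_eventually allI AE_I2)
      fix s x
      have "\<bar>x * e s 1\<bar> \<le> \<bar>x\<bar> * (R * \<bar>1\<bar>)" unfolding abs_mult by (intro mult_left_mono eb) auto
      then have "\<bar>e s x - x * e s 1\<bar> \<le> R * \<bar>x\<bar> + R * \<bar>x\<bar>" using eb[of s x] by (simp add: mult.commute)
      then show "norm (e s x - x * e s 1) \<le> 2 * R * \<bar>x\<bar>" by simp
    qed
    show "AE x in \<rho>. ((\<lambda>s. e s x - x * e s 1) \<longlongrightarrow> 0) at_top" using lin by simp
  qed (auto simp: e_def)
  moreover have "(\<integral>x. e s x - x * e s 1 \<partial>\<rho>) = (\<integral>x. G s - G (s - x) \<partial>\<rho>) - drift * e s 1" for s
    unfolding drift_def using gi integrable_id by (simp add: e_def)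
  ultimately have "((\<lambda>s. (\<integral>x. G s - G (s - x) \<partial>\<rho>) - drift * e s 1) \<longlongrightarrow> 0) at_top" by simp
  from tendsto_diff[OF lim this] have "((\<lambda>s. drift * e s 1) \<longlongrightarrow> H) at_top" by simp
  then have "((\<lambda>s. drift * e s 1 / drift) \<longlongrightarrow> H / drift) at_top"
    using drift_pos by (intro tendsto_intros) auto
  then have "((\<lambda>s. e s 1) \<longlongrightarrow> H / drift) at_top" using drift_pos by simp
  then have "((\<lambda>s. (e s d - d * e s 1) + d * e s 1) \<longlongrightarrow> 0 + d * (H / drift)) at_top"
    by (intro tendsto_intros lin)
  then show ?thesis by (simp add: e_def)
qed

text \<open>\<open>reg\<close> plays the part of continuity. It restricts upward growth only, and
  this suffices: r(s) is at most exp(\<alpha> d) times its mean over (s - d, s], and at least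
  exp(-\<alpha> d) times its mean over (s, s + d]. Both means are increments of G divided by d,
  whose limits are known, and d is arbitrary.\<close>

lemma renewal_limit:
  fixes r h :: "real \<Rightarrow> real"
  assumes r [measurable]: "r \<in> borel_measurable borel" and h: "integrable lborel h"
    and r0: "\<And>s. r s \<ge> 0" and rC: "\<And>s. r s \<le> C * exp (\<gamma> * s)"
    and eq: "\<And>s. r s = (\<integral>x. r (s - x) \<partial>\<rho>) + h s"
    and reg: "\<And>s t. s \<le> t \<Longrightarrow> r t \<le> exp (\<alpha> * (t - s)) * r s" and al: "\<alpha> \<ge> 0"
  shows "(r \<longlongrightarrow> (\<integral>s. h s \<partial>lborel) / drift) at_top"
proof -
  have hm [measurable]: "h \<in> borel_measurable borel" using h by auto
  have C0: "C \<ge> 0" using order_trans[OF r0[of 0] rC[of 0]] by simp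
  have exp_int: "integrable \<rho> (\<lambda>x. exp (- \<gamma> * x))"
    using order.strict_trans[OF exp_decay ennreal_one_less_top] by (intro integrableI_nonneg) auto
  \<comment> \<open>Growth of order exp(\<gamma> s) is exactly what exp(-\<gamma> x) under \<rho>
    can integrate. The fact is used for r and again for its primitive G.\<close>
  have shift_int: "integrable \<rho> (\<lambda>x. f (s - x))"
    if [measurable]: "f \<in> borel_measurable borel" and f: "\<And>s. 0 \<le> f s" "\<And>s. f s \<le> D * exp (\<gamma> * s)"
    for f :: "real \<Rightarrow> real" and D s
  proof (rule Bochner_Integration.integrable_bound)
    show "integrable \<rho> (\<lambda>x. D * exp (\<gamma> * s) * exp (- \<gamma> * x))" using exp_int by (rule integrable_mult_right)
    have "f (s - x) \<le> D * exp (\<gamma> * s) * exp (- \<gamma> * x)" for x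
      using f(2)[of "s - x"] by (simp add: exp_diff exp_minus field_simps)
    then have "norm (f (s - x)) \<le> norm (D * exp (\<gamma> * s) * exp (- \<gamma> * x))" for x
      using f(1)[of "s - x"] order_trans[OF _ abs_ge_self] by auto
    then show "AE x in \<rho>. norm (f (s - x)) \<le> norm (D * exp (\<gamma> * s) * exp (- \<gamma> * x))" by simp
  qed auto
  define u where "u s = (\<integral>x. r (s - x) \<partial>\<rho>)" for s
  have u0: "u s \<ge> 0" for s unfolding u_def by (intro integral_nonneg_AE) (use r0 in auto)
  have um [measurable]: "u \<in> borel_measurable borel" unfolding u_def by measurable
  have uT: "trans_op (\<lambda>s. ennreal (r s)) s = ennreal (u s)" for s
    unfolding trans_op_def u_def by (intro nn_integral_eq_integral shift_int[OF r r0 rC]) (use r0 in auto)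
  have habs: "(\<integral>\<^sup>+ v. ennreal \<bar>h v\<bar> \<partial>lborel) < \<infinity>" using h by (simp add: integrable_iff_bounded)
  define R where "R = enn2real (ennreal (exp \<alpha> * pot_bound) * (\<integral>\<^sup>+ v. ennreal \<bar>h v\<bar> \<partial>lborel))"
  have rR: "r s \<le> R" for s
  proof -
    have "ennreal (r s) \<le> ennreal (exp \<alpha> * pot_bound) * (\<integral>\<^sup>+ v. ennreal \<bar>h v\<bar> \<partial>lborel)"
    proof (rule renewal_upper_bound[OF r _ r0 rC _ reg al])
      fix s
      have "ennreal (r s) \<le> ennreal (u s + \<bar>h s\<bar>)" unfolding eq[of s] u_def by (intro ennreal_leI) auto
      then show "ennreal (r s) \<le> trans_op (\<lambda>s. ennreal (r s)) s + ennreal \<bar>h s\<bar>"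
        using u0 by (simp add: uT)
    qed auto
    then have "enn2real (ennreal (r s)) \<le> R"
      unfolding R_def using habs by (intro enn2real_mono) (auto simp: ennreal_mult_less_top)
    then show ?thesis using r0 by simp
  qed
  have R0: "R \<ge> 0" by (simp add: R_def)
  have rint: "integrable lborel (\<lambda>v. indicator {..s} v * r v)" for s
  proof (rule integrableI_nonneg)
    have "(\<integral>\<^sup>+ v. ennreal (indicator {..s} v * r v) \<partial>lborel) \<le> (\<integral>\<^sup>+ v. ennreal C * (ennreal (exp (\<gamma> * v)) * indicator {..s} v) \<partial>lborel)"
      using rC C0 by (intro nn_integral_mono) (auto simp: indicator_def ennreal_mult[symmetric] intro!: ennreal_leI)
    also have "\<dots> < \<infinity>"
      by (subst nn_integral_cmult) (auto simp: nn_integral_exp_atMost gamma_pos ennreal_mult_less_top)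
    finally show "(\<integral>\<^sup>+ v. ennreal (indicator {..s} v * r v) \<partial>lborel) < \<infinity>" .
  qed (use r0 in auto)
  have hint: "integrable lborel (\<lambda>v. indicator A v * h v)" if [measurable]: "A \<in> sets borel" for A
    using h by (rule Bochner_Integration.integrable_bound) (auto simp: indicator_def)
  define G where "G s = (\<integral>v. indicator {..s} v * r v \<partial>lborel)" for s
  have G0: "G s \<ge> 0" for s unfolding G_def using r0 by (intro integral_nonneg_AE) auto
  have Gn: "ennreal (G s) = (\<integral>\<^sup>+ v. ennreal (indicator {..s} v * r v) \<partial>lborel)" for s
    unfolding G_def using r0 by (intro nn_integral_eq_integral[symmetric] rint) auto
  have Gdiff: "G t - G s = (\<integral>v. indicator {s<..t} v * r v \<partial>lborel)" if "s \<le> t" for s t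
    unfolding G_def using that
    by (subst Bochner_Integration.integral_diff[symmetric, OF rint rint])
       (auto intro!: Bochner_Integration.integral_cong simp: indicator_def)
  have Gdiff_int: "integrable lborel (\<lambda>v. indicator {s<..t} v * r v)" for s t
    using rint[of t] by (rule Bochner_Integration.integrable_bound) (auto simp: indicator_def)
  have cint: "integrable lborel (\<lambda>v. indicator {s<..t} v * (c::real))"
    "(\<integral>v. indicator {s<..t} v * (c::real) \<partial>lborel) = (t - s) * c" if "s \<le> t" for s t c
    using that by (auto intro!: integrable_mult_left simp: integrable_indicator_iff)
  have Gupper: "G t - G s \<le> (t - s) * c" if "s \<le> t" "\<And>v. s < v \<Longrightarrow> v \<le> t \<Longrightarrow> r v \<le> c" for s t c
    unfolding Gdiff[OF that(1)] cint(2)[OF that(1), symmetric]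
    by (intro integral_mono Gdiff_int cint that(1)) (auto simp: indicator_def that(2))
  have Glower: "G t - G s \<ge> (t - s) * c" if "s \<le> t" "\<And>v. s < v \<Longrightarrow> v \<le> t \<Longrightarrow> r v \<ge> c" for s t c
    unfolding Gdiff[OF that(1)] cint(2)[OF that(1), symmetric]
    by (intro integral_mono Gdiff_int cint that(1)) (auto simp: indicator_def that(2))
  have lip': "\<bar>G t - G s\<bar> \<le> R * \<bar>t - s\<bar>" if "s \<le> t" for s t
    using Gupper[OF that, of R] Glower[OF that, of 0] rR r0 that by (auto simp: mult.commute)
  have lip: "\<bar>G s - G t\<bar> \<le> R * \<bar>s - t\<bar>" for s t
    using lip'[of s t] lip'[of t s] by (cases "s \<le> t") (auto simp: abs_minus_commute)
  have [measurable]: "G \<in> borel_measurable borel" by (rule measurable_abs_lipschitz[OF lip])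
  have Gexp: "G s \<le> C / \<gamma> * exp (\<gamma> * s)" for s
  proof -
    have "ennreal (G s) \<le> (\<integral>\<^sup>+ v. ennreal C * (ennreal (exp (\<gamma> * v)) * indicator {..s} v) \<partial>lborel)"
      unfolding Gn using rC C0 by (intro nn_integral_mono) (auto simp: indicator_def ennreal_mult[symmetric] intro!: ennreal_leI)
    also have "\<dots> = ennreal (C / \<gamma> * exp (\<gamma> * s))"
      using C0 gamma_pos by (subst nn_integral_cmult) (auto simp: nn_integral_exp_atMost ennreal_mult[symmetric])
    finally show ?thesis using C0 gamma_pos by (subst (asm) ennreal_le_iff) auto
  qed
  have Gs: "integrable \<rho> (\<lambda>x. G (s - x))" for s by (rule shift_int[OF _ G0 Gexp]) auto
  define Hs where "Hs s = (\<integral>v. indicator {..s} v * h v \<partial>lborel)" for s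
  \<comment> \<open>The renewal equation integrated over (-\<infinity>, s]. Since r is nonnegative,
    the exchange of integrals is made in \<open>ennreal\<close>, and the signed function h is added
    only afterwards.\<close>
  have GH: "(\<integral>x. G s - G (s - x) \<partial>\<rho>) = Hs s" for s
  proof -
    interpret P: pair_sigma_finite \<rho> lborel ..
    have "indicator {..s} v * u v = indicator {..s} v * r v - indicator {..s} v * h v" for v
      unfolding eq[of v] u_def by (simp add: algebra_simps)
    then have ui: "integrable lborel (\<lambda>v. indicator {..s} v * u v)"
      using Bochner_Integration.integrable_diff[OF rint hint, of "{..s}" s] by simp
    have inner: "(\<integral>\<^sup>+ v. indicator {..s} v * ennreal (r (v - x)) \<partial>lborel) = ennreal (G (s - x))" for x
      unfolding Gn by (subst nn_integral_real_affine[where c=1 and t=x])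
         (auto intro!: nn_integral_cong simp: indicator_def)
    have "ennreal (\<integral>v. indicator {..s} v * u v \<partial>lborel) = (\<integral>\<^sup>+ v. indicator {..s} v * ennreal (u v) \<partial>lborel)"
      using u0 by (subst nn_integral_eq_integral[OF ui, symmetric]) (auto intro!: nn_integral_cong simp: indicator_def)
    also have "\<dots> = (\<integral>\<^sup>+ v. \<integral>\<^sup>+ x. indicator {..s} v * ennreal (r (v - x)) \<partial>\<rho> \<partial>lborel)"
      unfolding uT[symmetric] trans_op_def by (subst nn_integral_cmult[symmetric]) auto
    also have "\<dots> = (\<integral>\<^sup>+ x. \<integral>\<^sup>+ v. indicator {..s} v * ennreal (r (v - x)) \<partial>lborel \<partial>\<rho>)"
      by (subst P.Fubini') auto
    also have "\<dots> = (\<integral>\<^sup>+ x. ennreal (G (s - x)) \<partial>\<rho>)"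
      by (simp only: inner)
    also have "\<dots> = ennreal (\<integral>x. G (s - x) \<partial>\<rho>)"
      by (intro nn_integral_eq_integral Gs) (use G0 in auto)
    finally have "(\<integral>v. indicator {..s} v * u v \<partial>lborel) = (\<integral>x. G (s - x) \<partial>\<rho>)"
      using u0 G0 by (subst (asm) ennreal_inj) (auto intro!: integral_nonneg_AE)
    moreover have "G s = (\<integral>v. indicator {..s} v * u v \<partial>lborel) + Hs s"
      unfolding G_def Hs_def by (subst Bochner_Integration.integral_add[OF ui hint, symmetric])
        (auto intro!: Bochner_Integration.integral_cong simp: u_def eq[symmetric] distrib_left[symmetric])
    ultimately show ?thesis using Gs[of s] prob_space by (subst Bochner_Integration.integral_diff) auto
  qed
  have "(Hs \<longlongrightarrow> (\<integral>s. h s \<partial>lborel)) at_top"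
    unfolding Hs_def
  proof (rule integral_dominated_convergence_at_top[where w="\<lambda>v. \<bar>h v\<bar>"])
    show "\<forall>\<^sub>F s in at_top. AE v in lborel. norm (indicator {..s} v * h v) \<le> \<bar>h v\<bar>"
      by (intro always_eventually allI AE_I2) (auto simp: indicator_def)
    show "AE v in lborel. ((\<lambda>s. indicator {..s} v * h v) \<longlongrightarrow> h v) at_top"
    proof (rule AE_I2)
      fix v :: real
      have "eventually (\<lambda>s. h v = indicator {..s} v * h v) at_top"
        using eventually_ge_at_top[of v] by eventually_elim auto
      then show "((\<lambda>s. indicator {..s} v * h v) \<longlongrightarrow> h v) at_top"
        by (rule Lim_transform_eventually[OF tendsto_const])
    qed
  qed (use h in auto)
  then have inc: "((\<lambda>s. G s - G (s - d)) \<longlongrightarrow> d * ((\<integral>s. h s \<partial>lborel) / drift)) at_top" for d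
    by (intro increment_limit[OF lip]) (simp add: GH)
  define c where "c = (\<integral>s. h s \<partial>lborel) / drift"
  have up: "r s \<le> exp (\<alpha> * d) / d * (G s - G (s - d))" if d: "d > 0" for d s
  proof -
    have "r v \<ge> exp (- (\<alpha> * d)) * r s" if v: "s - d < v" "v \<le> s" for v
    proof -
      have "r s \<le> exp (\<alpha> * (s - v)) * r v" by (rule reg) (use v in auto)
      also have "\<dots> \<le> exp (\<alpha> * d) * r v" using v al r0 by (intro mult_right_mono) (auto intro!: mult_left_mono)
      finally show ?thesis by (simp add: exp_minus field_simps)
    qed
    from Glower[of "s - d" s, OF _ this] d have "d * (exp (- (\<alpha> * d)) * r s) \<le> G s - G (s - d)" by simp
    then show ?thesis using d by (simp add: exp_minus field_simps)
  qed
  have low: "r s \<ge> exp (- (\<alpha> * d)) / d * (G (s + d) - G s)" if d: "d > 0" for d s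
  proof -
    have "r v \<le> exp (\<alpha> * d) * r s" if v: "s < v" "v \<le> s + d" for v
    proof -
      have "r v \<le> exp (\<alpha> * (v - s)) * r s" by (rule reg) (use v in auto)
      also have "\<dots> \<le> exp (\<alpha> * d) * r s" using v al r0 by (intro mult_right_mono) (auto intro!: mult_left_mono)
      finally show ?thesis .
    qed
    from Gupper[of s "s + d", OF _ this] d have "G (s + d) - G s \<le> d * (exp (\<alpha> * d) * r s)" by simp
    then show ?thesis using d by (simp add: exp_minus field_simps)
  qed
  have "(r \<longlongrightarrow> c) at_top"
  proof (rule order_tendstoI)
    fix a assume a: "c < a"
    \<comment> \<open>The interval length d is fixed before s grows, so small that the distortion
      exp(\<alpha> d) does not lift c to a.\<close>
    have "((\<lambda>d. exp (\<alpha> * d) * c) \<longlongrightarrow> exp (\<alpha> * 0) * c) (at_right 0)"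
      by (intro tendsto_intros)
    from order_tendstoD(2)[OF this, of a] a have "eventually (\<lambda>d. exp (\<alpha> * d) * c < a) (at_right 0)" by simp
    then have "eventually (\<lambda>d. exp (\<alpha> * d) * c < a \<and> 0 < d) (at_right 0)"
      by (rule eventually_conj) (rule eventually_at_right_less)
    then obtain d where d: "exp (\<alpha> * d) * c < a" "d > 0" using eventually_happens'[OF trivial_limit_at_right_real] by blast
    have "((\<lambda>s. exp (\<alpha> * d) / d * (G s - G (s - d))) \<longlongrightarrow> exp (\<alpha> * d) / d * (d * c)) at_top"
      unfolding c_def by (intro tendsto_intros inc)
    then have "eventually (\<lambda>s. exp (\<alpha> * d) / d * (G s - G (s - d)) < a) at_top"
      using d by (intro order_tendstoD(2)) auto
    then show "eventually (\<lambda>s. r s < a) at_top"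
      by eventually_elim (use up[OF d(2)] in \<open>auto intro: order.strict_trans1\<close>)
  next
    fix a assume a: "a < c"
    have "((\<lambda>d. exp (- (\<alpha> * d)) * c) \<longlongrightarrow> exp (- (\<alpha> * 0)) * c) (at_right 0)"
      by (intro tendsto_intros)
    from order_tendstoD(1)[OF this, of a] a have "eventually (\<lambda>d. a < exp (- (\<alpha> * d)) * c) (at_right 0)" by simp
    then have "eventually (\<lambda>d. a < exp (- (\<alpha> * d)) * c \<and> 0 < d) (at_right 0)"
      by (rule eventually_conj) (rule eventually_at_right_less)
    then obtain d where d: "a < exp (- (\<alpha> * d)) * c" "d > 0" using eventually_happens'[OF trivial_limit_at_right_real] by blast
    have "((\<lambda>s. exp (- (\<alpha> * d)) / d * (G (s + d) - G ((s + d) - d))) \<longlongrightarrow> exp (- (\<alpha> * d)) / d * (d * c)) at_top"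
      unfolding c_def using shift_at_top[of "-d"] by (intro tendsto_intros filterlim_compose[OF inc]) simp
    then have "eventually (\<lambda>s. a < exp (- (\<alpha> * d)) / d * (G (s + d) - G s)) at_top"
      using d by (intro order_tendstoD(1)) auto
    then show "eventually (\<lambda>s. a < r s) at_top"
      by eventually_elim (use low[OF d(2)] in \<open>auto intro: order.strict_trans2\<close>)
  qed
  then show ?thesis by (simp add: c_def)
qed

end

section \<open>Implicit renewal theory\<close>

lemma powr_less_tangent:
  fixes x \<theta> :: real
  assumes x: "0 < x" "x \<noteq> 1" and \<theta>: "0 < \<theta>" "\<theta> < 1"
  shows "x powr \<theta> < 1 + \<theta> * (x - 1)"
proof -
  define w where "w = 1 + \<theta> * (x - 1)"
  have "w > 0" unfolding w_def right_diff_distrib using \<theta> mult_pos_pos[OF \<theta>(1) x(1)] by linarith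
  moreover have "w \<noteq> 1" using x \<theta> by (simp add: w_def)
  ultimately have w: "w > 0" "w \<noteq> 1" .
  \<comment> \<open>Strict weighted AM-GM for x and 1, whose weighted mean is w: apply ln u \<le> u
    - 1 at x / w and at 1 / w, with strictness at the second point because w differs from 1.\<close>
  have "ln (1 / w) < 1 / w - 1"
    using ln_le_minus_one[of "1 / w"] ln_eq_minus_one[of "1 / w"] w by fastforce
  moreover have "ln (x / w) \<le> x / w - 1" using x w by (intro ln_le_minus_one) auto
  ultimately have "\<theta> * ln (x / w) + (1 - \<theta>) * ln (1 / w) < \<theta> * (x / w - 1) + (1 - \<theta>) * (1 / w - 1)"
    using \<theta> by (intro add_le_less_mono mult_left_mono mult_strict_left_mono) auto
  also have "\<dots> = (1 + \<theta> * (x - 1)) / w - 1" using w by (simp add: field_simps)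
  also have "\<dots> = 0" using w by (simp add: w_def)
  also have "\<theta> * ln (x / w) + (1 - \<theta>) * ln (1 / w) = \<theta> * ln x - ln w"
    using x w by (simp add: ln_div algebra_simps)
  finally have "exp (\<theta> * ln x) < exp (ln w)" by (subst exp_less_cancel_iff) simp
  then show ?thesis using x w by (simp add: powr_def w_def[symmetric])
qed

lemma powr_subadd:
  fixes x y :: real
  assumes "0 \<le> x" "0 \<le> y" "0 < \<alpha>" "\<alpha> \<le> 1"
  shows "(x + y) powr \<alpha> \<le> x powr \<alpha> + y powr \<alpha>"
proof (cases "x + y = 0")
  case False
  then have s: "x + y > 0" using assms by simp
  have u: "u / (x + y) \<le> (u / (x + y)) powr \<alpha>" if "0 \<le> u" "u \<le> x + y" for u
    using powr_mono'[of \<alpha> 1 "u / (x + y)"] assms that s by simp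
  have "1 = x / (x + y) + y / (x + y)" using s by (simp add: add_divide_distrib[symmetric])
  also have "\<dots> \<le> (x / (x + y)) powr \<alpha> + (y / (x + y)) powr \<alpha>"
    using assms by (intro add_mono u) auto
  finally have "(x + y) powr \<alpha> * 1 \<le> (x + y) powr \<alpha> * ((x / (x + y)) powr \<alpha> + (y / (x + y)) powr \<alpha>)"
    by (intro mult_left_mono) auto
  also have "\<dots> = x powr \<alpha> + y powr \<alpha>"
    using s by (simp add: distrib_left powr_mult[symmetric])
  finally show ?thesis by simp
qed auto

lemma powr_diff_mvt:
  fixes x y :: real
  assumes "0 \<le> x" "x \<le> y" "1 < \<alpha>"
  shows "y powr \<alpha> - x powr \<alpha> \<le> \<alpha> * (y - x) * y powr (\<alpha> - 1)"
proof (cases "x = 0 \<or> x = y")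
  case True
  then show ?thesis
    using assms powr_mult_base[of y "\<alpha> - 1"] mult_right_mono[of 1 \<alpha> "y powr \<alpha>"] by (auto simp: mult.assoc)
next
  case False
  then have xy: "0 < x" "x < y" using assms by auto
  obtain z where z: "x < z" "z < y" "y powr \<alpha> - x powr \<alpha> = (y - x) * (\<alpha> * z powr (\<alpha> - 1))"
    using MVT2[OF xy(2), of "\<lambda>t. t powr \<alpha>" "\<lambda>t. \<alpha> * t powr (\<alpha> - 1)"] xy
    by (force intro!: has_real_derivative_powr)
  have "z powr (\<alpha> - 1) \<le> y powr (\<alpha> - 1)" using z xy assms by (intro powr_mono2) auto
  then have "(y - x) * (\<alpha> * z powr (\<alpha> - 1)) \<le> (y - x) * (\<alpha> * y powr (\<alpha> - 1))"
    using xy assms by (intro mult_left_mono) auto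
  then show ?thesis using z(3) by (simp add: mult_ac)
qed

text \<open>For \<alpha> \<le> 1 subadditivity leaves no power of x at all. For \<alpha> > 1 the
  mean value theorem leaves the power \<alpha> - 1 \<le> \<beta> of 1 + x. In both cases w carries
  the full order \<alpha>.\<close>

lemma abs_powr_diff_le:
  fixes a w x p \<psi> \<alpha> \<beta> :: real
  assumes p: "0 \<le> p" "p \<le> a * x" and \<psi>: "0 \<le> \<psi>" "\<bar>\<psi> - p\<bar> \<le> d" and d: "d + a \<le> w" "0 \<le> a" "0 \<le> x"
    and ab: "0 < \<alpha>" "0 \<le> \<beta>" "\<alpha> - 1 \<le> \<beta>"
  shows "\<bar>\<psi> powr \<alpha> - p powr \<alpha>\<bar> \<le> (1 + \<alpha>) * (w powr \<alpha> * (1 + x) powr \<beta>)"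
proof -
  define lo where "lo = min p \<psi>"
  define hi where "hi = max p \<psi>"
  have lh: "0 \<le> lo" "lo \<le> hi" "hi - lo \<le> d" "hi \<le> a * x + d"
    using p \<psi> by (auto simp: lo_def hi_def)
  have d0: "0 \<le> d" using \<psi> by linarith
  then have w0: "0 \<le> w" "d \<le> w" using d by auto
  have "hi powr \<alpha> - lo powr \<alpha> \<ge> 0" using lh ab by (simp add: powr_mono2)
  then have e: "\<bar>\<psi> powr \<alpha> - p powr \<alpha>\<bar> = hi powr \<alpha> - lo powr \<alpha>"
    unfolding lo_def hi_def by (cases "p \<le> \<psi>") auto
  have one: "1 \<le> (1 + x) powr \<beta>" using d ab by (intro ge_one_powr_ge_zero) auto
  have nn: "0 \<le> w powr \<alpha> * (1 + x) powr \<beta>" by simp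
  show ?thesis
  proof (cases "\<alpha> \<le> 1")
    case True
    have "hi powr \<alpha> - lo powr \<alpha> \<le> (hi - lo) powr \<alpha>"
      using powr_subadd[of lo "hi - lo" \<alpha>] lh ab True by simp
    also have "\<dots> \<le> w powr \<alpha>" using lh ab w0 by (intro powr_mono2) auto
    also have "\<dots> \<le> w powr \<alpha> * (1 + x) powr \<beta>" using mult_left_mono[OF one, of "w powr \<alpha>"] by simp
    also have "\<dots> \<le> (1 + \<alpha>) * (w powr \<alpha> * (1 + x) powr \<beta>)"
      using mult_right_mono[OF _ nn, of 1 "1 + \<alpha>"] ab by simp
    finally show ?thesis using e by simp
  next
    case False
    have "hi powr \<alpha> - lo powr \<alpha> \<le> \<alpha> * (hi - lo) * hi powr (\<alpha> - 1)"
      using lh False by (intro powr_diff_mvt) auto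
    also have "\<dots> \<le> \<alpha> * w * (w * (1 + x)) powr (\<alpha> - 1)"
    proof (intro mult_mono powr_mono2)
      have "a * x + d \<le> w * x + w" using d w0 d0 by (intro add_mono mult_right_mono) auto
      then show "hi \<le> w * (1 + x)" using lh(4) by (simp add: algebra_simps)
    qed (use lh w0 ab False in auto)
    also have "\<dots> = \<alpha> * (w powr \<alpha> * (1 + x) powr (\<alpha> - 1))"
      using w0 powr_mult_base[of w "\<alpha> - 1"] by (simp add: powr_mult)
    also have "\<dots> \<le> (1 + \<alpha>) * (w powr \<alpha> * (1 + x) powr \<beta>)"
      using ab d by (intro mult_mono mult_left_mono powr_mono) auto
    finally show ?thesis using e by simp
  qed
qed

text \<open>The leading factor must be arbitrarily close to 1, since it will multiply E A^\<beta> <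
  1 and the product has to stay below 1. With (1 + \<eta>)^\<beta> = 1 + \<epsilon>, either d \<le>
  \<eta> x and the first term suffices, or x < d / \<eta> and the second does.\<close>

lemma powr_add_le_eps:
  fixes \<beta> \<epsilon> :: real
  assumes "\<beta> > 0" "\<epsilon> > 0"
  obtains C where "C \<ge> 0" "\<And>x d. 0 \<le> x \<Longrightarrow> 0 \<le> d \<Longrightarrow> (x + d) powr \<beta> \<le> (1 + \<epsilon>) * x powr \<beta> + C * d powr \<beta>"
proof
  define \<eta> where "\<eta> = (1 + \<epsilon>) powr (1 / \<beta>) - 1"
  have "1 powr (1 / \<beta>) < (1 + \<epsilon>) powr (1 / \<beta>)" using assms by (intro powr_less_mono2) auto
  then have \<eta>: "\<eta> > 0" by (simp add: \<eta>_def)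
  have \<eta>p: "(1 + \<eta>) powr \<beta> = 1 + \<epsilon>" using assms by (simp add: \<eta>_def powr_powr)
  show "(1 / \<eta> + 1) powr \<beta> \<ge> 0" by simp
  fix x d :: real assume xd: "0 \<le> x" "0 \<le> d"
  show "(x + d) powr \<beta> \<le> (1 + \<epsilon>) * x powr \<beta> + (1 / \<eta> + 1) powr \<beta> * d powr \<beta>"
  proof (cases "d \<le> \<eta> * x")
    case True
    have "(x + d) powr \<beta> \<le> ((1 + \<eta>) * x) powr \<beta>"
      using True xd assms by (intro powr_mono2) (auto simp: algebra_simps)
    also have "\<dots> = (1 + \<epsilon>) * x powr \<beta>" by (simp add: powr_mult \<eta>p)
    finally show ?thesis by (simp add: add_increasing2)
  next
    case False
    then have "x \<le> d / \<eta>" using \<eta> by (simp add: field_simps)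
    then have "(x + d) powr \<beta> \<le> ((1 / \<eta> + 1) * d) powr \<beta>"
      using xd assms by (intro powr_mono2) (auto simp: algebra_simps)
    also have "\<dots> = (1 / \<eta> + 1) powr \<beta> * d powr \<beta>" by (simp add: powr_mult)
    finally show ?thesis using assms by (simp add: add_increasing)
  qed
qed

text \<open>The layer-cake formula for the \<alpha>-th power of the positive part, in the variable s
  = ln t.\<close>

lemma nn_integral_exp_below:
  fixes \<alpha> u :: real
  assumes "\<alpha> > 0"
  shows "(\<integral>\<^sup>+ s. ennreal (exp (\<alpha> * s) * (if exp s < u then 1 else 0)) \<partial>lborel) = ennreal (max 0 u powr \<alpha> / \<alpha>)"
proof (cases "u > 0")
  case True
  have "(\<integral>\<^sup>+ s. ennreal (exp (\<alpha> * s) * (if exp s < u then 1 else 0)) \<partial>lborel)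
      = (\<integral>\<^sup>+ s. ennreal (exp (\<alpha> * s)) * indicator {..ln u} s \<partial>lborel)"
  proof (intro nn_integral_cong_AE)
    show "AE s in lborel. ennreal (exp (\<alpha> * s) * (if exp s < u then 1 else 0)) = ennreal (exp (\<alpha> * s)) * indicator {..ln u} s"
      using AE_lborel_singleton[of "ln u"]
    proof eventually_elim
      case (elim s)
      have "exp s < u \<longleftrightarrow> s < ln u" using True by (metis exp_less_cancel_iff exp_ln)
      then show ?case using elim by (auto simp: indicator_def)
    qed
  qed
  also have "\<dots> = ennreal (exp (\<alpha> * ln u) / \<alpha>)" by (rule nn_integral_exp_atMost[OF assms])
  finally show ?thesis using True by (simp add: powr_def)
next
  case False
  then have "\<not> exp s < u" for s by (meson exp_gt_zero order.strict_trans)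
  then show ?thesis using False by simp
qed

lemma nn_integral_exp_between:
  fixes \<alpha> y z :: real
  assumes \<alpha>: "\<alpha> > 0"
  shows "(\<integral>\<^sup>+ s. ennreal (exp (\<alpha> * s) * \<bar>(if exp s < y then 1 else 0) - (if exp s < z then 1 else 0)\<bar>) \<partial>lborel)
     = ennreal (\<bar>max 0 y powr \<alpha> - max 0 z powr \<alpha>\<bar> / \<alpha>)"
proof -
  have *: "(\<integral>\<^sup>+ s. ennreal (exp (\<alpha> * s) * \<bar>(if exp s < y then 1 else 0) - (if exp s < z then 1 else 0)\<bar>) \<partial>lborel)
     = ennreal (\<bar>max 0 y powr \<alpha> - max 0 z powr \<alpha>\<bar> / \<alpha>)" if zy: "z \<le> y" for y z :: real
  proof -
    have le: "max 0 z powr \<alpha> \<le> max 0 y powr \<alpha>" using zy \<alpha> by (intro powr_mono2) auto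
    have "(\<integral>\<^sup>+ s. ennreal (exp (\<alpha> * s) * \<bar>(if exp s < y then 1 else 0) - (if exp s < z then 1 else 0)\<bar>) \<partial>lborel)
      = (\<integral>\<^sup>+ s. ennreal (exp (\<alpha> * s) * (if exp s < y then 1 else 0)) - ennreal (exp (\<alpha> * s) * (if exp s < z then 1 else 0)) \<partial>lborel)"
      using zy by (intro nn_integral_cong) auto
    also have "\<dots> = ennreal (max 0 y powr \<alpha> / \<alpha>) - ennreal (max 0 z powr \<alpha> / \<alpha>)"
      by (subst nn_integral_diff) (use zy in \<open>auto simp: nn_integral_exp_below[OF \<alpha>]\<close>)
    also have "\<dots> = ennreal (\<bar>max 0 y powr \<alpha> - max 0 z powr \<alpha>\<bar> / \<alpha>)"
      using le \<alpha> by (simp add: ennreal_minus diff_divide_distrib)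
    finally show ?thesis .
  qed
  show ?thesis
  proof (cases "z \<le> y")
    case False
    then show ?thesis using *[of y z] by (simp only: abs_minus_commute[of "if exp _ < y then 1 else 0"] abs_minus_commute[of "max 0 y powr \<alpha>"])
  qed (rule *)
qed

text \<open>Layer cake and Tonelli for two variables on one probability space. The coupling matters:
  the right-hand side can be finite although both \<alpha>-moments are infinite.\<close>

lemma (in prob_space) nn_integral_tail_diff_le:
  fixes Y Z :: "'a \<Rightarrow> real"
  assumes [measurable]: "Y \<in> borel_measurable M" "Z \<in> borel_measurable M" and \<alpha>: "\<alpha> > 0"
  shows "(\<integral>\<^sup>+ s. ennreal (exp (\<alpha> * s) * \<bar>prob {\<omega>\<in>space M. exp s < Y \<omega>} - prob {\<omega>\<in>space M. exp s < Z \<omega>}\<bar>) \<partial>lborel)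
    \<le> (\<integral>\<^sup>+ \<omega>. ennreal (\<bar>max 0 (Y \<omega>) powr \<alpha> - max 0 (Z \<omega>) powr \<alpha>\<bar> / \<alpha>) \<partial>M)"
proof -
  interpret P: pair_sigma_finite M lborel ..
  define D where "D s \<omega> = (if exp s < Y \<omega> then 1 else 0) - (if exp s < Z \<omega> then 1 else (0::real))" for s \<omega>
  have pr: "prob {\<omega>\<in>space M. u < X \<omega>} = (\<integral>\<omega>. (if u < X \<omega> then 1 else 0) \<partial>M)"
    and pi: "integrable M (\<lambda>\<omega>. (if u < X \<omega> then 1 else (0::real)))"
    if [measurable]: "X \<in> borel_measurable M" for X :: "'a \<Rightarrow> real" and u
  proof -
    show "integrable M (\<lambda>\<omega>. (if u < X \<omega> then 1 else (0::real)))" by (rule integrable_const_bound[where B=1]) auto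
    have "(\<integral>\<omega>. (if u < X \<omega> then 1 else (0::real)) \<partial>M) = (\<integral>\<omega>. indicator {\<omega>\<in>space M. u < X \<omega>} \<omega> \<partial>M)"
      by (intro Bochner_Integration.integral_cong) (auto simp: indicator_def)
    then show "prob {\<omega>\<in>space M. u < X \<omega>} = (\<integral>\<omega>. (if u < X \<omega> then 1 else 0) \<partial>M)" by simp
  qed
  have "(\<integral>\<^sup>+ s. ennreal (exp (\<alpha> * s) * \<bar>prob {\<omega>\<in>space M. exp s < Y \<omega>} - prob {\<omega>\<in>space M. exp s < Z \<omega>}\<bar>) \<partial>lborel)
     \<le> (\<integral>\<^sup>+ s. \<integral>\<^sup>+ \<omega>. ennreal (exp (\<alpha> * s) * \<bar>D s \<omega>\<bar>) \<partial>M \<partial>lborel)"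
  proof (intro nn_integral_mono)
    fix s :: real
    have i: "integrable M (D s)" unfolding D_def by (intro Bochner_Integration.integrable_diff pi) auto
    have "\<bar>prob {\<omega>\<in>space M. exp s < Y \<omega>} - prob {\<omega>\<in>space M. exp s < Z \<omega>}\<bar> = \<bar>\<integral>\<omega>. D s \<omega> \<partial>M\<bar>"
      unfolding D_def by (simp add: pr pi)
    also have "\<dots> \<le> (\<integral>\<omega>. \<bar>D s \<omega>\<bar> \<partial>M)" by (rule integral_abs_bound)
    finally have "ennreal (exp (\<alpha> * s) * \<bar>prob {\<omega>\<in>space M. exp s < Y \<omega>} - prob {\<omega>\<in>space M. exp s < Z \<omega>}\<bar>)
       \<le> ennreal (\<integral>\<omega>. exp (\<alpha> * s) * \<bar>D s \<omega>\<bar> \<partial>M)"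
      by (intro ennreal_leI) simp
    also have "\<dots> = (\<integral>\<^sup>+ \<omega>. ennreal (exp (\<alpha> * s) * \<bar>D s \<omega>\<bar>) \<partial>M)"
      using i by (intro nn_integral_eq_integral[symmetric]) auto
    finally show "ennreal (exp (\<alpha> * s) * \<bar>prob {\<omega>\<in>space M. exp s < Y \<omega>} - prob {\<omega>\<in>space M. exp s < Z \<omega>}\<bar>)
       \<le> (\<integral>\<^sup>+ \<omega>. ennreal (exp (\<alpha> * s) * \<bar>D s \<omega>\<bar>) \<partial>M)" .
  qed
  also have "\<dots> = (\<integral>\<^sup>+ \<omega>. \<integral>\<^sup>+ s. ennreal (exp (\<alpha> * s) * \<bar>D s \<omega>\<bar>) \<partial>lborel \<partial>M)"
    unfolding D_def by (subst P.Fubini') auto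
  also have "\<dots> = (\<integral>\<^sup>+ \<omega>. ennreal (\<bar>max 0 (Y \<omega>) powr \<alpha> - max 0 (Z \<omega>) powr \<alpha>\<bar> / \<alpha>) \<partial>M)"
    unfolding D_def by (simp only: nn_integral_exp_between[OF \<alpha>])
  finally show ?thesis .
qed

lemma nn_integral_le_of_truncations:
  fixes f :: "'a \<Rightarrow> real"
  assumes [measurable]: "f \<in> borel_measurable M"
    and bound: "\<And>K. K \<ge> 0 \<Longrightarrow> (\<integral>\<^sup>+ x. ennreal (min (f x) K) \<partial>M) \<le> c"
  shows "(\<integral>\<^sup>+ x. ennreal (f x) \<partial>M) \<le> c"
proof -
  have "(\<lambda>n. \<integral>\<^sup>+ x. ennreal (min (f x) (real n)) \<partial>M) \<longlonglongrightarrow> (\<integral>\<^sup>+ x. ennreal (f x) \<partial>M)"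
  proof (rule nn_integral_LIMSEQ)
    show "incseq (\<lambda>n x. ennreal (min (f x) (real n)))"
      by (auto simp: incseq_def le_fun_def intro!: ennreal_leI)
    fix x
    obtain m :: nat where m: "f x \<le> real m" using real_arch_simple by blast
    have "eventually (\<lambda>n. ennreal (f x) = ennreal (min (f x) (real n))) sequentially"
      using eventually_ge_at_top[of m] by eventually_elim (use m in \<open>simp add: min_def\<close>)
    then show "(\<lambda>n. ennreal (min (f x) (real n))) \<longlonglongrightarrow> ennreal (f x)"
      by (rule Lim_transform_eventually[OF tendsto_const])
  qed auto
  then show ?thesis by (rule LIMSEQ_le_const2) (use bound in auto)
qed

lemma borel_measurable_antimono:
  fixes F :: "real \<Rightarrow> real"
  assumes "antimono F"
  shows "F \<in> borel_measurable borel"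
proof -
  have "(\<lambda>x. - F x) \<in> borel_measurable borel"
    using assms by (intro borel_measurable_mono) (auto simp: monotone_def)
  then show ?thesis by simp
qed

lemma antimono_tail:
  fixes \<nu> :: "real measure"
  assumes "finite_measure \<nu>" "sets \<nu> = sets borel"
  shows "antimono (\<lambda>t. measure \<nu> {t<..})"
  using assms by (intro antimonoI finite_measure.finite_measure_mono) auto

lemma tail_le_moment:
  fixes \<nu> :: "real measure"
  assumes \<nu>: "prob_space \<nu>" "sets \<nu> = sets borel" and b: "b > 0" and C: "C \<ge> 0"
    and moment: "(\<integral>\<^sup>+ x. ennreal ((1 + \<bar>x\<bar>) powr b) \<partial>\<nu>) \<le> ennreal C" and t: "t > 0"
  shows "measure \<nu> {t<..} \<le> C * t powr (- b)"
proof -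
  interpret N: prob_space \<nu> by fact
  note \<nu>(2)[measurable_cong]
  have "emeasure \<nu> {t<..} = (\<integral>\<^sup>+ x. indicator {t<..} x \<partial>\<nu>)" by (simp add: \<nu>)
  also have "\<dots> \<le> (\<integral>\<^sup>+ x. ennreal (t powr (- b)) * ennreal ((1 + \<bar>x\<bar>) powr b) \<partial>\<nu>)"
  proof (intro nn_integral_mono)
    fix x
    have "1 \<le> t powr (- b) * (1 + \<bar>x\<bar>) powr b" if "x > t"
    proof -
      have "t powr b \<le> (1 + \<bar>x\<bar>) powr b" using that t b by (intro powr_mono2) auto
      then have "t powr (- b) * t powr b \<le> t powr (- b) * (1 + \<bar>x\<bar>) powr b" by (intro mult_left_mono) auto
      then show ?thesis using t by (simp add: powr_minus)
    qed
    then show "indicator {t<..} x \<le> ennreal (t powr (- b)) * ennreal ((1 + \<bar>x\<bar>) powr b)"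
      by (auto simp: indicator_def ennreal_mult[symmetric] simp flip: ennreal_1 intro!: ennreal_leI)
  qed
  also have "\<dots> = ennreal (t powr (- b)) * (\<integral>\<^sup>+ x. ennreal ((1 + \<bar>x\<bar>) powr b) \<partial>\<nu>)"
    by (rule nn_integral_cmult) measurable
  also have "\<dots> \<le> ennreal (t powr (- b)) * ennreal C" by (intro mult_left_mono moment) auto
  finally have "ennreal (measure \<nu> {t<..}) \<le> ennreal (C * t powr (- b))"
    using C by (simp add: N.emeasure_eq_measure ennreal_mult mult.commute)
  then show ?thesis using C by (subst (asm) ennreal_le_iff) auto
qed

section \<open>The multiplicative factor, its tilted law and tails of recursions\<close>

text \<open>\<open>W\<close> is a common majorant for the coefficients of a recursion with
  multiplicative part \<open>A\<close>; only its \<alpha>-th moment enters. Leaving the recursion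
  itself open allows different recursions to share the law of \<open>A\<close>.\<close>

locale cramer_factor = prob_space M for M :: "'a measure" +
  fixes A W :: "'a \<Rightarrow> real" and \<alpha> :: real
  assumes A_meas [measurable]: "A \<in> borel_measurable M" and W_meas [measurable]: "W \<in> borel_measurable M"
    and A_pos: "AE p in M. A p > 0" and W_ge_1: "\<And>p. W p \<ge> 1"
    and alpha_pos: "\<alpha> > 0"
    and cramer: "(\<integral>\<^sup>+ p. ennreal (A p powr \<alpha>) \<partial>M) = 1"
    and log_moment: "(\<integral>\<^sup>+ p. ennreal (A p powr \<alpha> * max 0 (ln (A p))) \<partial>M) < \<infinity>"
    and W_moment: "(\<integral>\<^sup>+ p. ennreal (W p powr \<alpha>) \<partial>M) < \<infinity>"
    and nonarithmetic: "d > 0 \<Longrightarrow> \<not> (AE p in M. \<exists>k::int. ln (A p) = d * of_int k)"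
begin

text \<open>An exponent below \<open>\<alpha>\<close>, so that moments of order \<open>\<beta>\<close> are finite, but at least \<open>\<alpha> - 1\<close>, so that
  they control the inhomogeneity of the renewal equation.\<close>
definition \<beta> :: real where "\<beta> = max (\<alpha> - 1 / 2) (\<alpha> / 2)"

lemma beta: "0 < \<beta>" "\<beta> < \<alpha>" "\<alpha> - 1 \<le> \<beta>"
  using alpha_pos by (auto simp: \<beta>_def)

definition qb :: real where "qb = enn2real (\<integral>\<^sup>+ p. ennreal (A p powr \<beta>) \<partial>M)"

text \<open>Strict concavity of the power \<theta> = \<beta> / \<alpha>, applied to A^\<alpha> of
  mean 1. Equality would force A = 1 almost surely, so that ln A is 0, which lies in every lattice
  and contradicts \<open>nonarithmetic\<close>.\<close>

lemma A_beta: "(\<integral>\<^sup>+ p. ennreal (A p powr \<beta>) \<partial>M) = ennreal qb" "0 \<le> qb" "qb < 1"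
proof -
  define \<theta> where "\<theta> = \<beta> / \<alpha>"
  have \<theta>: "0 < \<theta>" "\<theta> < 1" using beta alpha_pos by (auto simp: \<theta>_def)
  have pw: "A p powr \<beta> = (A p powr \<alpha>) powr \<theta>" for p
    using alpha_pos by (simp add: powr_powr \<theta>_def)
  have ia: "integrable M (\<lambda>p. A p powr \<alpha>)" by (intro integrableI_nonneg) (auto simp: cramer)
  have Ea: "(\<integral>p. A p powr \<alpha> \<partial>M) = 1" by (subst integral_eq_nn_integral) (auto simp: cramer)
  have le: "AE p in M. A p powr \<beta> \<le> 1 + \<theta> * (A p powr \<alpha> - 1)"
    using A_pos
  proof eventually_elim
    case (elim p)
    then show ?case using powr_less_tangent[of "A p powr \<alpha>" \<theta>] \<theta> by (cases "A p powr \<alpha> = 1") (auto simp: pw)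
  qed
  have it: "integrable M (\<lambda>p. 1 + \<theta> * (A p powr \<alpha> - 1))" using ia by auto
  have ib: "integrable M (\<lambda>p. A p powr \<beta>)"
    by (rule Bochner_Integration.integrable_bound[OF it]) (use le in \<open>auto elim!: eventually_mono\<close>)
  have q: "(\<integral>p. A p powr \<beta> \<partial>M) = qb" unfolding qb_def by (subst integral_eq_nn_integral) auto
  show "(\<integral>\<^sup>+ p. ennreal (A p powr \<beta>) \<partial>M) = ennreal qb"
    unfolding q[symmetric] by (intro nn_integral_eq_integral ib) auto
  show "0 \<le> qb" by (simp add: qb_def)
  define g where "g p = 1 + \<theta> * (A p powr \<alpha> - 1) - A p powr \<beta>" for p
  have ig: "integrable M g" unfolding g_def using it ib by auto
  have g0: "AE p in M. 0 \<le> g p" using le by eventually_elim (auto simp: g_def)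
  have Eg: "(\<integral>p. g p \<partial>M) = 1 - qb"
    unfolding g_def using ia ib prob_space by (simp add: Ea q)
  have "(\<integral>p. g p \<partial>M) \<noteq> 0"
  proof
    assume "(\<integral>p. g p \<partial>M) = 0"
    then have "AE p in M. g p = 0" using integral_nonneg_eq_0_iff_AE[OF ig g0] by simp
    with A_pos have "AE p in M. \<exists>k::int. ln (A p) = 1 * of_int k"
    proof eventually_elim
      case (elim p)
      have "A p powr \<alpha> = 1"
        using powr_less_tangent[of "A p powr \<alpha>" \<theta>] \<theta> elim by (force simp: g_def pw)
      then have "\<alpha> * ln (A p) = ln 1" using elim by (metis ln_powr less_numeral_extra(3))
      then have "ln (A p) = 0" using alpha_pos by simp
      then show ?case by (intro exI[of _ 0]) simp
    qed
    then show False using nonarithmetic[of 1] by simp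
  qed
  moreover have "(\<integral>p. g p \<partial>M) \<ge> 0" by (rule integral_nonneg_AE[OF g0])
  ultimately show "qb < 1" using Eg by simp
qed

definition tilt :: "real measure" where
  "tilt = distr (density M (\<lambda>p. ennreal (A p powr \<alpha>))) borel (\<lambda>p. ln (A p))"

lemma nn_integral_tilt:
  assumes [measurable]: "f \<in> borel_measurable borel"
  shows "(\<integral>\<^sup>+ x. f x \<partial>tilt) = (\<integral>\<^sup>+ p. ennreal (A p powr \<alpha>) * f (ln (A p)) \<partial>M)"
  unfolding tilt_def by (subst nn_integral_distr) (auto simp: nn_integral_density)

lemma integral_tilt:
  fixes f :: "real \<Rightarrow> real"
  assumes [measurable]: "f \<in> borel_measurable borel"
  shows "(\<integral>x. f x \<partial>tilt) = (\<integral>p. A p powr \<alpha> * f (ln (A p)) \<partial>M)"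
  unfolding tilt_def by (subst integral_distr) (auto simp: integral_density)

sublocale tilt: drifted_law tilt "\<alpha> - \<beta>"
proof -
  have p: "prob_space tilt"
  proof
    have "emeasure tilt (space tilt) = (\<integral>\<^sup>+ x. 1 \<partial>tilt)" by simp
    also have "\<dots> = 1" by (subst nn_integral_tilt) (auto simp: cramer)
    finally show "emeasure tilt (space tilt) = 1" .
  qed
  have s: "sets tilt = sets borel" "space tilt = UNIV" by (auto simp: tilt_def)
  interpret T: real_distribution tilt
    using p s by (simp add: real_distribution_def real_distribution_axioms_def)
  show "drifted_law tilt (\<alpha> - \<beta>)"
  proof unfold_locales
    show "0 < \<alpha> - \<beta>" using beta by simp
    have "(\<integral>\<^sup>+ x. ennreal (exp (- (\<alpha> - \<beta>) * x)) \<partial>tilt)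
        = (\<integral>\<^sup>+ p. ennreal (A p powr \<alpha>) * ennreal (exp (- (\<alpha> - \<beta>) * ln (A p))) \<partial>M)"
      by (rule nn_integral_tilt) measurable
    also have "\<dots> = (\<integral>\<^sup>+ p. ennreal (A p powr \<beta>) \<partial>M)"
    proof (intro nn_integral_cong_AE, use A_pos in eventually_elim)
      case (elim p)
      have "A p powr \<alpha> * exp (- (\<alpha> - \<beta>) * ln (A p)) = A p powr \<beta>"
        using elim by (simp add: powr_def exp_add[symmetric] algebra_simps)
      then show ?case by (simp add: ennreal_mult[symmetric])
    qed
    finally show "(\<integral>\<^sup>+ x. ennreal (exp (- (\<alpha> - \<beta>) * x)) \<partial>tilt) < 1"
      using A_beta by simp
    show "integrable tilt (\<lambda>x. x)"
    proof (rule integrableI_bounded)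
      have "(\<integral>\<^sup>+ x. ennreal (norm x) \<partial>tilt) = (\<integral>\<^sup>+ p. ennreal (A p powr \<alpha>) * ennreal \<bar>ln (A p)\<bar> \<partial>M)"
        by (subst nn_integral_tilt) auto
      also have "\<dots> \<le> (\<integral>\<^sup>+ p. ennreal (A p powr \<alpha> * max 0 (ln (A p))) + ennreal (1 / \<alpha>) \<partial>M)"
      proof (intro nn_integral_mono_AE, use A_pos in eventually_elim)
        case (elim p)
        \<comment> \<open>The negative part of ln A costs only a constant: ln u \<le> u - 1 at u =
          A^(-\<alpha>) bounds A^\<alpha> times it by 1 / \<alpha>.\<close>
        have "A p powr \<alpha> * \<bar>ln (A p)\<bar> \<le> A p powr \<alpha> * max 0 (ln (A p)) + 1 / \<alpha>"
        proof (cases "ln (A p) \<ge> 0")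
          case False
          have "ln (A p powr (- \<alpha>)) \<le> A p powr (- \<alpha>) - 1" using elim by (intro ln_le_minus_one) auto
          then have "\<alpha> * \<bar>ln (A p)\<bar> \<le> A p powr (- \<alpha>)" using False elim by (simp add: ln_powr)
          then have "A p powr \<alpha> * (\<alpha> * \<bar>ln (A p)\<bar>) \<le> A p powr \<alpha> * A p powr (- \<alpha>)"
            by (intro mult_left_mono) auto
          also have "\<dots> = 1" using elim by (simp add: powr_add[symmetric])
          finally have "A p powr \<alpha> * \<bar>ln (A p)\<bar> \<le> 1 / \<alpha>" using alpha_pos by (simp add: field_simps)
          then show ?thesis using False by simp
        qed (use alpha_pos in auto)
        then show ?case using alpha_pos by (simp add: ennreal_mult[symmetric] ennreal_plus[symmetric] del: ennreal_plus)
      qed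
      also have "\<dots> < \<infinity>" using log_moment
        by (subst nn_integral_add) (auto simp: emeasure_space_1)
      finally show "(\<integral>\<^sup>+ x. ennreal (norm x) \<partial>tilt) < \<infinity>" .
    qed auto
    fix d :: real assume d: "d > 0"
    show "\<not> (AE x in tilt. \<exists>k::int. x = d * of_int k)"
    proof
      assume "AE x in tilt. \<exists>k::int. x = d * of_int k"
      then have "AE p in density M (\<lambda>p. ennreal (A p powr \<alpha>)). \<exists>k::int. ln (A p) = d * of_int k"
        unfolding tilt_def by (subst (asm) AE_distr_iff) auto
      then have "AE p in M. 0 < ennreal (A p powr \<alpha>) \<longrightarrow> (\<exists>k::int. ln (A p) = d * of_int k)"
        by (subst (asm) AE_density) auto
      then have "AE p in M. \<exists>k::int. ln (A p) = d * of_int k"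
        using A_pos by eventually_elim (auto simp: ennreal_less_zero_iff)
      with nonarithmetic[OF d] show False by simp
    qed
  qed
qed

text \<open>In logarithmic scale division by A is a shift by ln A, and the tilting weight A^\<alpha>
  exactly absorbs the change of the factor exp(\<alpha> s). This is where the renewal equation comes
  from.\<close>

lemma tail_rescale:
  assumes Fm [measurable]: "F \<in> borel_measurable borel"
  shows "(\<integral>x. exp (\<alpha> * (s - x)) * F (exp (s - x)) \<partial>tilt) = exp (\<alpha> * s) * (\<integral>p. F (exp s / A p) \<partial>M)"
proof -
  have "(\<integral>x. exp (\<alpha> * (s - x)) * F (exp (s - x)) \<partial>tilt)
      = (\<integral>p. A p powr \<alpha> * (exp (\<alpha> * (s - ln (A p))) * F (exp (s - ln (A p)))) \<partial>M)"
    by (subst integral_tilt) auto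
  also have "\<dots> = (\<integral>p. exp (\<alpha> * s) * F (exp s / A p) \<partial>M)"
  proof (intro integral_cong_AE, measurable, use A_pos in eventually_elim)
    case (elim p)
    have "A p powr \<alpha> * exp (\<alpha> * (s - ln (A p))) = exp (\<alpha> * s)"
      using elim by (simp add: powr_def exp_add[symmetric] algebra_simps)
    then show ?case using elim by (simp add: exp_diff mult.assoc[symmetric])
  qed
  finally show ?thesis by simp
qed

text \<open>Monotonicity of F supplies the regularity hypothesis of \<open>renewal_limit\<close>,
  and the bound of order \<beta> its growth bound with rate \<alpha> - \<beta>. F is an abstract
  function because the result is applied both to the tail of a stationary law and to a hitting
  probability.\<close>

lemma tail_asymptotics:
  fixes F h :: "real \<Rightarrow> real"
  assumes F [measurable]: "F \<in> borel_measurable borel" and F0: "\<And>t. F t \<ge> 0"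
    and mono: "\<And>s t. 0 < s \<Longrightarrow> s \<le> t \<Longrightarrow> F t \<le> F s"
    and FC: "\<And>t. t > 0 \<Longrightarrow> F t \<le> C * t powr (- \<beta>)"
    and h: "integrable lborel h"
    and eq: "\<And>s. h s = exp (\<alpha> * s) * (F (exp s) - (\<integral>p. F (exp s / A p) \<partial>M))"
  shows "((\<lambda>t. t powr \<alpha> * F t) \<longlongrightarrow> (\<integral>s. h s \<partial>lborel) / tilt.drift) at_top"
proof -
  define r where "r s = exp (\<alpha> * s) * F (exp s)" for s
  have "(r \<longlongrightarrow> (\<integral>s. h s \<partial>lborel) / tilt.drift) at_top"
  proof (rule tilt.renewal_limit[OF _ h])
    show "r \<in> borel_measurable borel" unfolding r_def by measurable
    show "0 \<le> r s" for s using F0 by (simp add: r_def)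
    show "r s \<le> C * exp ((\<alpha> - \<beta>) * s)" for s
      using mult_left_mono[OF FC[of "exp s"], of "exp (\<alpha> * s)"]
      by (simp add: r_def powr_def exp_add[symmetric] algebra_simps)
    show "r s = (\<integral>x. r (s - x) \<partial>tilt) + h s" for s
      unfolding r_def tail_rescale[OF F] eq by (simp add: algebra_simps)
    show "r t \<le> exp (\<alpha> * (t - s)) * r s" if "s \<le> t" for s t
    proof -
      have "exp (\<alpha> * (t - s)) * exp (\<alpha> * s) = exp (\<alpha> * t)"
        by (simp add: exp_add[symmetric] algebra_simps)
      then have "exp (\<alpha> * (t - s)) * r s = exp (\<alpha> * t) * F (exp s)"
        by (simp add: r_def mult.assoc[symmetric])
      then show ?thesis using mono[of "exp s" "exp t"] that by (simp only: r_def) simp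
    qed
  qed (use alpha_pos in auto)
  then have "((\<lambda>t. r (ln t)) \<longlongrightarrow> (\<integral>s. h s \<partial>lborel) / tilt.drift) at_top"
    by (rule filterlim_compose[OF _ ln_at_top])
  moreover have "eventually (\<lambda>t. r (ln t) = t powr \<alpha> * F t) at_top"
    using eventually_gt_at_top[of 0] by eventually_elim (simp add: r_def powr_def)
  ultimately show ?thesis by (rule Lim_transform_eventually)
qed

text \<open>The one-sided companion, for functions that satisfy only a renewal inequality. The
  resulting bound is independent of C and of F, and can therefore be uniform along a sequence of
  laws.\<close>

lemma tail_upper_bound:
  fixes F :: "real \<Rightarrow> real" and h :: "real \<Rightarrow> ennreal"
  assumes F [measurable]: "F \<in> borel_measurable borel" and F0: "\<And>t. F t \<ge> 0" and F1: "\<And>t. F t \<le> 1"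
    and mono: "\<And>s t. 0 < s \<Longrightarrow> s \<le> t \<Longrightarrow> F t \<le> F s"
    and FC: "\<And>t. t > 0 \<Longrightarrow> F t \<le> C * t powr (- \<beta>)"
    and h [measurable]: "h \<in> borel_measurable borel"
    and ineq: "\<And>s. ennreal (exp (\<alpha> * s) * F (exp s)) \<le> ennreal (exp (\<alpha> * s) * (\<integral>p. F (exp s / A p) \<partial>M)) + h s"
    and t: "t > 0"
  shows "ennreal (t powr \<alpha> * F t) \<le> ennreal (exp \<alpha> * tilt.pot_bound) * (\<integral>\<^sup>+ s. h s \<partial>lborel)"
proof -
  define r where "r s = exp (\<alpha> * s) * F (exp s)" for s
  have rm [measurable]: "r \<in> borel_measurable borel" unfolding r_def by measurable
  have r0: "0 \<le> r s" for s using F0 by (simp add: r_def)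
  have "ennreal (r (ln t)) \<le> ennreal (exp \<alpha> * tilt.pot_bound) * (\<integral>\<^sup>+ s. h s \<partial>lborel)"
  proof (rule tilt.renewal_upper_bound[OF rm h r0])
    show "r s \<le> C * exp ((\<alpha> - \<beta>) * s)" for s
      using mult_left_mono[OF FC[of "exp s"], of "exp (\<alpha> * s)"]
      by (simp add: r_def powr_def exp_add[symmetric] algebra_simps)
    have "ennreal (exp (\<alpha> * s) * (\<integral>p. F (exp s / A p) \<partial>M)) = tilt.trans_op (\<lambda>s. ennreal (r s)) s" for s
    proof -
      have "integrable M (\<lambda>p. F (exp s / A p))"
        by (rule integrable_const_bound[where B=1]) (use F0 F1 in auto)
      then have "ennreal (exp (\<alpha> * s) * (\<integral>p. F (exp s / A p) \<partial>M)) = (\<integral>\<^sup>+ p. ennreal (exp (\<alpha> * s) * F (exp s / A p)) \<partial>M)"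
        by (subst nn_integral_eq_integral) (use F0 in auto)
      also have "\<dots> = (\<integral>\<^sup>+ p. ennreal (A p powr \<alpha>) * ennreal (r (s - ln (A p))) \<partial>M)"
      proof (intro nn_integral_cong_AE, use A_pos in eventually_elim)
        case (elim p)
        have "A p powr \<alpha> * exp (\<alpha> * (s - ln (A p))) = exp (\<alpha> * s)"
          using elim by (simp add: powr_def exp_add[symmetric] algebra_simps)
        then show ?case using elim r0[of "s - ln (A p)"]
          by (simp add: ennreal_mult[symmetric] r_def exp_diff mult.assoc[symmetric])
      qed
      also have "\<dots> = tilt.trans_op (\<lambda>s. ennreal (r s)) s"
        unfolding tilt.trans_op_def by (subst nn_integral_tilt) auto
      finally show ?thesis .
    qed
    then show "ennreal (r s) \<le> tilt.trans_op (\<lambda>s. ennreal (r s)) s + h s" for s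
      using ineq[of s] by (simp add: r_def)
    show "r t \<le> exp (\<alpha> * (t - s)) * r s" if "s \<le> t" for s t
    proof -
      have "exp (\<alpha> * (t - s)) * exp (\<alpha> * s) = exp (\<alpha> * t)"
        by (simp add: exp_add[symmetric] algebra_simps)
      then have "exp (\<alpha> * (t - s)) * r s = exp (\<alpha> * t) * F (exp s)"
        by (simp add: r_def mult.assoc[symmetric])
      then show ?thesis using mono[of "exp s" "exp t"] that by (simp only: r_def) simp
    qed
  qed (use alpha_pos in auto)
  then show ?thesis using t by (simp add: r_def powr_def)
qed

text \<open>The map acts like multiplication by A up to an error W, uniformly in x. The first
  inequality serves moments, the second right tails. The positive parts are essential in the second:
  as x tends to -\<infinity> the Letac map stays bounded below while A x does not. The summand
  \<open>A p\<close> lets \<open>W\<close> also dominate the factor in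
  \<open>abs_powr_diff_le\<close>.\<close>

definition driven :: "('a \<times> real \<Rightarrow> real) \<Rightarrow> bool" where
  "driven \<Psi> \<longleftrightarrow> \<Psi> \<in> borel_measurable (M \<Otimes>\<^sub>M borel) \<and>
     (\<forall>p x. A p > 0 \<longrightarrow> 1 + \<bar>\<Psi> (p, x)\<bar> \<le> A p * (1 + \<bar>x\<bar>) + W p \<and>
        \<bar>max 0 (\<Psi> (p, x)) - max 0 (A p * x)\<bar> + A p \<le> W p)"

lemma tail_pair:
  fixes \<nu> :: "real measure" and \<Psi> :: "'a \<times> real \<Rightarrow> real"
  assumes \<nu>: "prob_space \<nu>" "sets \<nu> = sets borel" and [measurable]: "\<Psi> \<in> borel_measurable (M \<Otimes>\<^sub>M borel)"
  shows "measure (M \<Otimes>\<^sub>M \<nu>) {z \<in> space (M \<Otimes>\<^sub>M \<nu>). t < \<Psi> z} = (\<integral>p. measure \<nu> {x. t < \<Psi> (p, x)} \<partial>M)"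
    and "integrable M (\<lambda>p. measure \<nu> {x. t < \<Psi> (p, x)})"
proof -
  interpret N: prob_space \<nu> by fact
  interpret P: pair_prob_space M \<nu> ..
  note \<nu>(2)[measurable_cong]
  have sp: "space \<nu> = UNIV" using \<nu>(2) by (metis sets_eq_imp_space_eq space_borel)
  have e: "emeasure \<nu> {x. t < \<Psi> (p, x)} = ennreal (measure \<nu> {x. t < \<Psi> (p, x)})" for p
    by (rule N.emeasure_eq_measure)
  have Q: "{z \<in> space (M \<Otimes>\<^sub>M \<nu>). t < \<Psi> z} \<in> sets (M \<Otimes>\<^sub>M \<nu>)" by measurable
  have sec: "Pair p -` {z \<in> space (M \<Otimes>\<^sub>M \<nu>). t < \<Psi> z} = {x. t < \<Psi> (p, x)}" if "p \<in> space M" for p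
    using that by (auto simp: space_pair_measure sp)
  have "(\<lambda>p. emeasure \<nu> (Pair p -` {z \<in> space (M \<Otimes>\<^sub>M \<nu>). t < \<Psi> z})) \<in> borel_measurable M"
    by (rule N.measurable_emeasure_Pair[OF Q])
  then have [measurable]: "(\<lambda>p. emeasure \<nu> {x. t < \<Psi> (p, x)}) \<in> borel_measurable M"
    by (subst (asm) measurable_cong[where g="\<lambda>p. emeasure \<nu> {x. t < \<Psi> (p, x)}"]) (simp_all only: sec)
  have "(\<lambda>p. enn2real (emeasure \<nu> {x. t < \<Psi> (p, x)})) \<in> borel_measurable M" by measurable
  then have m: "(\<lambda>p. measure \<nu> {x. t < \<Psi> (p, x)}) \<in> borel_measurable M" by (simp add: measure_def)
  show i: "integrable M (\<lambda>p. measure \<nu> {x. t < \<Psi> (p, x)})"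
    by (rule integrable_const_bound[where B=1]) (auto simp: m)
  have "ennreal (measure (M \<Otimes>\<^sub>M \<nu>) {z \<in> space (M \<Otimes>\<^sub>M \<nu>). t < \<Psi> z}) = emeasure (M \<Otimes>\<^sub>M \<nu>) {z \<in> space (M \<Otimes>\<^sub>M \<nu>). t < \<Psi> z}"
    by (rule P.P.emeasure_eq_measure[symmetric])
  also have "\<dots> = (\<integral>\<^sup>+ p. emeasure \<nu> (Pair p -` {z \<in> space (M \<Otimes>\<^sub>M \<nu>). t < \<Psi> z}) \<partial>M)"
    by (rule N.emeasure_pair_measure_alt[OF Q])
  also have "\<dots> = (\<integral>\<^sup>+ p. ennreal (measure \<nu> {x. t < \<Psi> (p, x)}) \<partial>M)"
    by (intro nn_integral_cong) (simp only: sec e)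
  also have "\<dots> = ennreal (\<integral>p. measure \<nu> {x. t < \<Psi> (p, x)} \<partial>M)"
    by (intro nn_integral_eq_integral i) auto
  finally show "measure (M \<Otimes>\<^sub>M \<nu>) {z \<in> space (M \<Otimes>\<^sub>M \<nu>). t < \<Psi> z} = (\<integral>p. measure \<nu> {x. t < \<Psi> (p, x)} \<partial>M)"
    by (subst (asm) ennreal_inj) auto
qed

lemma tail_distr:
  fixes \<nu> :: "real measure" and \<Psi> :: "'a \<times> real \<Rightarrow> real"
  assumes \<nu>: "prob_space \<nu>" "sets \<nu> = sets borel" and [measurable]: "\<Psi> \<in> borel_measurable (M \<Otimes>\<^sub>M borel)"
  shows "measure (distr (M \<Otimes>\<^sub>M \<nu>) borel \<Psi>) {t<..} = (\<integral>p. measure \<nu> {x. t < \<Psi> (p, x)} \<partial>M)"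
proof -
  note \<nu>(2)[measurable_cong]
  have "measure (distr (M \<Otimes>\<^sub>M \<nu>) borel \<Psi>) {t<..} = measure (M \<Otimes>\<^sub>M \<nu>) {z \<in> space (M \<Otimes>\<^sub>M \<nu>). t < \<Psi> z}"
    by (subst measure_distr) (auto intro!: arg_cong[where f="measure _"])
  also note tail_pair(1)[OF assms]
  finally show ?thesis .
qed

lemma tail_scale:
  fixes \<nu> :: "real measure"
  assumes \<nu>: "prob_space \<nu>" "sets \<nu> = sets borel"
  shows "measure (M \<Otimes>\<^sub>M \<nu>) {z \<in> space (M \<Otimes>\<^sub>M \<nu>). t < A (fst z) * snd z} = (\<integral>p. measure \<nu> {t / A p<..} \<partial>M)"
proof -
  have "measure (M \<Otimes>\<^sub>M \<nu>) {z \<in> space (M \<Otimes>\<^sub>M \<nu>). t < A (fst z) * snd z} = (\<integral>p. measure \<nu> {x. t < A p * x} \<partial>M)"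
    by (subst tail_pair(1)[OF \<nu>]) auto
  also have "\<dots> = (\<integral>p. measure \<nu> {t / A p<..} \<partial>M)"
  proof (rule integral_cong_AE)
    have mono: "F \<in> borel_measurable borel" if "antimono F" for F :: "real \<Rightarrow> real"
    proof -
      have "(\<lambda>x. - F x) \<in> borel_measurable borel" using that by (intro borel_measurable_mono) (auto simp: monotone_def)
      then show ?thesis by simp
    qed
    interpret N: prob_space \<nu> by fact
    have [measurable]: "(\<lambda>t. measure \<nu> {t<..}) \<in> borel_measurable borel"
      by (intro mono antimonoI N.finite_measure_mono) (auto simp: \<nu>)
    show "(\<lambda>p. measure \<nu> {t / A p<..}) \<in> borel_measurable M" by measurable
    show "(\<lambda>p. measure \<nu> {x. t < A p * x}) \<in> borel_measurable M"
      using tail_pair(2)[OF \<nu>, of "\<lambda>z. A (fst z) * snd z" t] by auto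
    show "AE p in M. measure \<nu> {x. t < A p * x} = measure \<nu> {t / A p<..}"
      using A_pos
    proof eventually_elim
      case (elim p)
      then have "{x. t < A p * x} = {t / A p<..}" by (auto simp: field_simps)
      then show ?case by simp
    qed
  qed
  finally show ?thesis .
qed

text \<open>This makes the forcing term of the renewal equation integrable. Couple \<Psi>(p, x) with
  A p * x under the product law; the difference of \<alpha>-th powers is at most a multiple of
  W^\<alpha> (1 + |x|)^\<beta>, and independence factorises its integral.\<close>

lemma perturbation_bound:
  assumes \<nu>: "prob_space \<nu>" "sets \<nu> = sets borel" and \<Psi>: "driven \<Psi>"
  shows "(\<integral>\<^sup>+ s. ennreal (exp (\<alpha> * s) * \<bar>measure (distr (M \<Otimes>\<^sub>M \<nu>) borel \<Psi>) {exp s<..} - (\<integral>p. measure \<nu> {exp s / A p<..} \<partial>M)\<bar>) \<partial>lborel)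
    \<le> ennreal ((1 + \<alpha>) / \<alpha>) * (\<integral>\<^sup>+ p. ennreal (W p powr \<alpha>) \<partial>M) * (\<integral>\<^sup>+ x. ennreal ((1 + \<bar>x\<bar>) powr \<beta>) \<partial>\<nu>)"
proof -
  interpret N: prob_space \<nu> by fact
  interpret P: pair_prob_space M \<nu> ..
  note \<nu>(2)[measurable_cong]
  have \<Psi>m [measurable]: "\<Psi> \<in> borel_measurable (M \<Otimes>\<^sub>M borel)" using \<Psi> by (simp add: driven_def)
  have "(\<integral>\<^sup>+ s. ennreal (exp (\<alpha> * s) * \<bar>measure (distr (M \<Otimes>\<^sub>M \<nu>) borel \<Psi>) {exp s<..} - (\<integral>p. measure \<nu> {exp s / A p<..} \<partial>M)\<bar>) \<partial>lborel)
    \<le> (\<integral>\<^sup>+ z. ennreal (\<bar>max 0 (\<Psi> z) powr \<alpha> - max 0 (A (fst z) * snd z) powr \<alpha>\<bar> / \<alpha>) \<partial>(M \<Otimes>\<^sub>M \<nu>))"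
    unfolding tail_distr[OF \<nu> \<Psi>m] tail_scale[OF \<nu>, symmetric] tail_pair(1)[OF \<nu> \<Psi>m, symmetric]
    by (intro P.P.nn_integral_tail_diff_le alpha_pos) auto
  also have "\<dots> \<le> (\<integral>\<^sup>+ z. ennreal ((1 + \<alpha>) / \<alpha>) * (ennreal (W (fst z) powr \<alpha>) * ennreal ((1 + \<bar>snd z\<bar>) powr \<beta>)) \<partial>(M \<Otimes>\<^sub>M \<nu>))"
  proof (rule nn_integral_mono_AE)
    have "AE z in M \<Otimes>\<^sub>M \<nu>. A (fst z) > 0"
      by (rule P.AE_pair_measure) (use A_pos in auto)
    then show "AE z in M \<Otimes>\<^sub>M \<nu>. ennreal (\<bar>max 0 (\<Psi> z) powr \<alpha> - max 0 (A (fst z) * snd z) powr \<alpha>\<bar> / \<alpha>)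
       \<le> ennreal ((1 + \<alpha>) / \<alpha>) * (ennreal (W (fst z) powr \<alpha>) * ennreal ((1 + \<bar>snd z\<bar>) powr \<beta>))"
    proof eventually_elim
      case (elim z)
      obtain p x where z: "z = (p, x)" by (cases z)
      have "\<bar>max 0 (\<Psi> (p, x)) powr \<alpha> - max 0 (A p * x) powr \<alpha>\<bar> \<le> (1 + \<alpha>) * (W p powr \<alpha> * (1 + \<bar>x\<bar>) powr \<beta>)"
      proof (rule abs_powr_diff_le)
        show "max 0 (A p * x) \<le> A p * \<bar>x\<bar>" using elim z by (auto intro!: mult_left_mono)
        show "\<bar>max 0 (\<Psi> (p, x)) - max 0 (A p * x)\<bar> \<le> \<bar>max 0 (\<Psi> (p, x)) - max 0 (A p * x)\<bar>" ..
        show "\<bar>max 0 (\<Psi> (p, x)) - max 0 (A p * x)\<bar> + A p \<le> W p" using \<Psi> elim z by (auto simp: driven_def)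
      qed (use elim z beta alpha_pos in auto)
      then have "\<bar>max 0 (\<Psi> (p, x)) powr \<alpha> - max 0 (A p * x) powr \<alpha>\<bar> / \<alpha> \<le> (1 + \<alpha>) / \<alpha> * (W p powr \<alpha> * (1 + \<bar>x\<bar>) powr \<beta>)"
        using alpha_pos by (simp add: divide_right_mono)
      then show ?case using alpha_pos z by (simp add: ennreal_mult[symmetric])
    qed
  qed
  also have "\<dots> = (\<integral>\<^sup>+ p. \<integral>\<^sup>+ x. ennreal ((1 + \<alpha>) / \<alpha>) * (ennreal (W p powr \<alpha>) * ennreal ((1 + \<bar>x\<bar>) powr \<beta>)) \<partial>\<nu> \<partial>M)"
    by (subst N.nn_integral_fst[symmetric]) auto
  also have "\<dots> = ennreal ((1 + \<alpha>) / \<alpha>) * (\<integral>\<^sup>+ p. ennreal (W p powr \<alpha>) \<partial>M) * (\<integral>\<^sup>+ x. ennreal ((1 + \<bar>x\<bar>) powr \<beta>) \<partial>\<nu>)"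
    by (simp add: nn_integral_cmult nn_integral_multc mult_ac)
  finally show ?thesis .
qed

text \<open>The truncation at K keeps every integral finite, so no moment of \<nu> has to be
  assumed. The coefficient c sits inside the minimum, where one step shrinks it to c q.\<close>

lemma moment_step:
  obtains q C where "0 < q" "q < 1" "0 \<le> C"
    "\<And>\<Psi> \<nu> c K. driven \<Psi> \<Longrightarrow> prob_space \<nu> \<Longrightarrow> sets \<nu> = sets borel \<Longrightarrow> 0 \<le> c \<Longrightarrow> 0 \<le> K \<Longrightarrow>
      (\<integral>\<^sup>+ x. ennreal (min (c * (1 + \<bar>x\<bar>) powr \<beta>) K) \<partial>distr (M \<Otimes>\<^sub>M \<nu>) borel \<Psi>)
      \<le> (\<integral>\<^sup>+ x. ennreal (min (c * q * (1 + \<bar>x\<bar>) powr \<beta>) K) \<partial>\<nu>) + ennreal (c * C)"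
proof -
  \<comment> \<open>With q the midpoint of qb and 1, and \<epsilon> the distance from qb to q, (1 +
    \<epsilon>) qb \<le> qb + \<epsilon> = q.\<close>
  define \<epsilon> where "\<epsilon> = (1 - qb) / 2"
  define q where "q = (1 + qb) / 2"
  have eps: "\<epsilon> > 0" and q: "0 < q" "q < 1" using A_beta by (auto simp: \<epsilon>_def q_def)
  have epsq: "(1 + \<epsilon>) * qb \<le> q"
  proof -
    have "\<epsilon> * qb \<le> \<epsilon> * 1" using A_beta eps by (intro mult_left_mono) auto
    then show ?thesis by (simp add: \<epsilon>_def q_def field_simps)
  qed
  obtain C0 where C0: "C0 \<ge> 0" "\<And>x d. 0 \<le> x \<Longrightarrow> 0 \<le> d \<Longrightarrow> (x + d) powr \<beta> \<le> (1 + \<epsilon>) * x powr \<beta> + C0 * d powr \<beta>"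
    using powr_add_le_eps[OF beta(1) eps] by blast
  define w where "w = enn2real (\<integral>\<^sup>+ p. ennreal (W p powr \<alpha>) \<partial>M)"
  have w: "(\<integral>\<^sup>+ p. ennreal (W p powr \<alpha>) \<partial>M) = ennreal w" "0 \<le> w"
    using W_moment by (auto simp: w_def)
  show thesis
  proof (rule that[OF q, of "C0 * w"])
    show "0 \<le> C0 * w" using C0 w by simp
    fix \<Psi> and \<nu> :: "real measure" and c K :: real
    assume \<Psi>: "driven \<Psi>" and \<nu>: "prob_space \<nu>" "sets \<nu> = sets borel" and cK: "0 \<le> c" "0 \<le> K"
    interpret N: prob_space \<nu> by fact
    interpret P: pair_prob_space M \<nu> ..
    note \<nu>(2)[measurable_cong]
    have \<Psi>m [measurable]: "\<Psi> \<in> borel_measurable (M \<Otimes>\<^sub>M borel)" using \<Psi> by (simp add: driven_def)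
    have "(\<integral>\<^sup>+ x. ennreal (min (c * (1 + \<bar>x\<bar>) powr \<beta>) K) \<partial>distr (M \<Otimes>\<^sub>M \<nu>) borel \<Psi>)
        = (\<integral>\<^sup>+ z. ennreal (min (c * (1 + \<bar>\<Psi> z\<bar>) powr \<beta>) K) \<partial>(M \<Otimes>\<^sub>M \<nu>))"
      by (subst nn_integral_distr) auto
    also have "\<dots> \<le> (\<integral>\<^sup>+ z. ennreal (min (c * (1 + \<epsilon>) * (A (fst z) powr \<beta>) * (1 + \<bar>snd z\<bar>) powr \<beta>) K)
         + ennreal (c * C0) * ennreal (W (fst z) powr \<alpha>) \<partial>(M \<Otimes>\<^sub>M \<nu>))"
    proof (rule nn_integral_mono_AE)
      have "AE z in M \<Otimes>\<^sub>M \<nu>. A (fst z) > 0" by (rule P.AE_pair_measure) (use A_pos in auto)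
      then show "AE z in M \<Otimes>\<^sub>M \<nu>. ennreal (min (c * (1 + \<bar>\<Psi> z\<bar>) powr \<beta>) K)
        \<le> ennreal (min (c * (1 + \<epsilon>) * (A (fst z) powr \<beta>) * (1 + \<bar>snd z\<bar>) powr \<beta>) K) + ennreal (c * C0) * ennreal (W (fst z) powr \<alpha>)"
      proof eventually_elim
        case (elim z)
        obtain p x where z: "z = (p, x)" by (cases z)
        have a: "A p > 0" using elim z by simp
        have nn: "0 \<le> c * C0 * W p powr \<alpha>" using cK C0(1) by simp
        have "(1 + \<bar>\<Psi> (p, x)\<bar>) powr \<beta> \<le> (A p * (1 + \<bar>x\<bar>) + W p) powr \<beta>"
          using \<Psi> a beta by (intro powr_mono2) (auto simp: driven_def)
        also have "\<dots> \<le> (1 + \<epsilon>) * (A p * (1 + \<bar>x\<bar>)) powr \<beta> + C0 * W p powr \<beta>"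
          using a W_ge_1[of p] by (intro C0(2)) auto
        also have "\<dots> \<le> (1 + \<epsilon>) * (A p * (1 + \<bar>x\<bar>)) powr \<beta> + C0 * W p powr \<alpha>"
          using W_ge_1[of p] beta C0 by (intro add_left_mono mult_left_mono powr_mono) auto
        finally have "c * (1 + \<bar>\<Psi> (p, x)\<bar>) powr \<beta> \<le> c * ((1 + \<epsilon>) * (A p powr \<beta> * (1 + \<bar>x\<bar>) powr \<beta>) + C0 * W p powr \<alpha>)"
          using cK by (intro mult_left_mono) (auto simp: powr_mult)
        also have "\<dots> = c * (1 + \<epsilon>) * (A p powr \<beta>) * (1 + \<bar>x\<bar>) powr \<beta> + c * C0 * W p powr \<alpha>"
          by (simp add: algebra_simps)
        finally have "min (c * (1 + \<bar>\<Psi> (p, x)\<bar>) powr \<beta>) K \<le> min (c * (1 + \<epsilon>) * (A p powr \<beta>) * (1 + \<bar>x\<bar>) powr \<beta>) K + c * C0 * W p powr \<alpha>"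
          using nn by linarith
        then show ?case
          using z cK C0(1) eps by (simp add: ennreal_mult[symmetric] ennreal_plus[symmetric] del: ennreal_plus)
      qed
    qed
    also have "\<dots> = (\<integral>\<^sup>+ z. ennreal (min (c * (1 + \<epsilon>) * (A (fst z) powr \<beta>) * (1 + \<bar>snd z\<bar>) powr \<beta>) K) \<partial>(M \<Otimes>\<^sub>M \<nu>))
         + (\<integral>\<^sup>+ z. ennreal (c * C0) * ennreal (W (fst z) powr \<alpha>) \<partial>(M \<Otimes>\<^sub>M \<nu>))"
      by (rule nn_integral_add) auto
    also have "(\<integral>\<^sup>+ z. ennreal (c * C0) * ennreal (W (fst z) powr \<alpha>) \<partial>(M \<Otimes>\<^sub>M \<nu>)) = ennreal (c * (C0 * w))"
    proof -
      have "(\<integral>\<^sup>+ z. ennreal (c * C0) * ennreal (W (fst z) powr \<alpha>) \<partial>(M \<Otimes>\<^sub>M \<nu>)) = (\<integral>\<^sup>+ p. ennreal (c * C0) * ennreal (W p powr \<alpha>) \<partial>M)"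
        by (subst N.nn_integral_fst[symmetric]) (auto simp: N.emeasure_space_1)
      also have "\<dots> = ennreal (c * C0) * ennreal w" by (subst nn_integral_cmult) (auto simp: w(1))
      finally show ?thesis using cK C0(1) w(2) by (simp add: ennreal_mult[symmetric] mult.assoc)
    qed
    also have "(\<integral>\<^sup>+ z. ennreal (min (c * (1 + \<epsilon>) * (A (fst z) powr \<beta>) * (1 + \<bar>snd z\<bar>) powr \<beta>) K) \<partial>(M \<Otimes>\<^sub>M \<nu>))
        = (\<integral>\<^sup>+ x. \<integral>\<^sup>+ p. ennreal (min (c * (1 + \<epsilon>) * (A p powr \<beta>) * (1 + \<bar>x\<bar>) powr \<beta>) K) \<partial>M \<partial>\<nu>)"
      by (subst P.nn_integral_snd[symmetric]) (auto simp: split_def)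
    also have "\<dots> \<le> (\<integral>\<^sup>+ x. ennreal (min (c * q * (1 + \<bar>x\<bar>) powr \<beta>) K) \<partial>\<nu>)"
    proof (rule nn_integral_mono)
      fix x
      define y where "y = c * (1 + \<epsilon>) * (1 + \<bar>x\<bar>) powr \<beta>"
      have y: "y \<ge> 0" using cK eps by (simp add: y_def)
      \<comment> \<open>Jensen's inequality for the concave truncation, by hand: the integral over p
        is at most K, and at most the integral of the untruncated term.\<close>
      have 1: "(\<integral>\<^sup>+ p. ennreal (min (c * (1 + \<epsilon>) * (A p powr \<beta>) * (1 + \<bar>x\<bar>) powr \<beta>) K) \<partial>M) \<le> ennreal K"
      proof -
        have "(\<integral>\<^sup>+ p. ennreal (min (c * (1 + \<epsilon>) * (A p powr \<beta>) * (1 + \<bar>x\<bar>) powr \<beta>) K) \<partial>M) \<le> (\<integral>\<^sup>+ p. ennreal K \<partial>M)"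
          by (intro nn_integral_mono ennreal_leI) auto
        then show ?thesis by (simp add: emeasure_space_1)
      qed
      have "(\<integral>\<^sup>+ p. ennreal (min (c * (1 + \<epsilon>) * (A p powr \<beta>) * (1 + \<bar>x\<bar>) powr \<beta>) K) \<partial>M)
        \<le> (\<integral>\<^sup>+ p. ennreal y * ennreal (A p powr \<beta>) \<partial>M)"
        using y by (intro nn_integral_mono) (auto simp: y_def ennreal_mult[symmetric] mult_ac intro!: ennreal_leI)
      also have "\<dots> = ennreal (y * qb)" using y A_beta by (simp add: nn_integral_cmult ennreal_mult)
      also have "\<dots> \<le> ennreal (c * q * (1 + \<bar>x\<bar>) powr \<beta>)"
      proof (rule ennreal_leI)
        have "y * qb = c * (1 + \<bar>x\<bar>) powr \<beta> * ((1 + \<epsilon>) * qb)" by (simp add: y_def mult_ac)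
        also have "\<dots> \<le> c * (1 + \<bar>x\<bar>) powr \<beta> * q" using epsq cK by (intro mult_left_mono) auto
        finally show "y * qb \<le> c * q * (1 + \<bar>x\<bar>) powr \<beta>" by (simp add: mult_ac)
      qed
      finally show "(\<integral>\<^sup>+ p. ennreal (min (c * (1 + \<epsilon>) * (A p powr \<beta>) * (1 + \<bar>x\<bar>) powr \<beta>) K) \<partial>M)
         \<le> ennreal (min (c * q * (1 + \<bar>x\<bar>) powr \<beta>) K)"
        using 1 by (auto simp: min_def)
    qed
    finally show "(\<integral>\<^sup>+ x. ennreal (min (c * (1 + \<bar>x\<bar>) powr \<beta>) K) \<partial>distr (M \<Otimes>\<^sub>M \<nu>) borel \<Psi>)
      \<le> (\<integral>\<^sup>+ x. ennreal (min (c * q * (1 + \<bar>x\<bar>) powr \<beta>) K) \<partial>\<nu>) + ennreal (c * (C0 * w))"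
      by (auto simp: add_right_mono)
  qed
qed

text \<open>The additive errors form a geometric series with sum C / (1 - q). The induction runs
  over all coefficients c, since its hypothesis is used at c q.\<close>

lemma moment_chain:
  assumes \<Psi>: "driven \<Psi>" and N: "\<And>n. prob_space (N n)" "\<And>n. sets (N n) = sets borel"
    and chain: "\<And>n. N (Suc n) = distr (M \<Otimes>\<^sub>M N n) borel \<Psi>"
  obtains q C where "0 < q" "q < 1" "0 \<le> C"
    "\<And>n K. 0 \<le> K \<Longrightarrow> (\<integral>\<^sup>+ x. ennreal (min ((1 + \<bar>x\<bar>) powr \<beta>) K) \<partial>N n)
      \<le> (\<integral>\<^sup>+ x. ennreal (min (q ^ n * (1 + \<bar>x\<bar>) powr \<beta>) K) \<partial>N 0) + ennreal C"
proof -
  obtain q C where q: "0 < q" "q < 1" "0 \<le> C" and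
    step: "\<And>\<Psi> \<nu> c K. driven \<Psi> \<Longrightarrow> prob_space \<nu> \<Longrightarrow> sets \<nu> = sets borel \<Longrightarrow> 0 \<le> c \<Longrightarrow> 0 \<le> K \<Longrightarrow>
      (\<integral>\<^sup>+ x. ennreal (min (c * (1 + \<bar>x\<bar>) powr \<beta>) K) \<partial>distr (M \<Otimes>\<^sub>M \<nu>) borel \<Psi>)
      \<le> (\<integral>\<^sup>+ x. ennreal (min (c * q * (1 + \<bar>x\<bar>) powr \<beta>) K) \<partial>\<nu>) + ennreal (c * C)"
    by (rule moment_step) blast
  have main: "(\<integral>\<^sup>+ x. ennreal (min (c * (1 + \<bar>x\<bar>) powr \<beta>) K) \<partial>N n)
      \<le> (\<integral>\<^sup>+ x. ennreal (min (c * q ^ n * (1 + \<bar>x\<bar>) powr \<beta>) K) \<partial>N 0) + ennreal (c * (C / (1 - q)))"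
    if "0 \<le> c" "0 \<le> K" for c K n
    using that
  proof (induction n arbitrary: c)
    case 0
    then show ?case by simp
  next
    case (Suc n)
    have "(\<integral>\<^sup>+ x. ennreal (min (c * (1 + \<bar>x\<bar>) powr \<beta>) K) \<partial>N (Suc n))
       \<le> (\<integral>\<^sup>+ x. ennreal (min (c * q * (1 + \<bar>x\<bar>) powr \<beta>) K) \<partial>N n) + ennreal (c * C)"
      unfolding chain by (intro step \<Psi> N Suc.prems)
    also have "\<dots> \<le> ((\<integral>\<^sup>+ x. ennreal (min (c * q * q ^ n * (1 + \<bar>x\<bar>) powr \<beta>) K) \<partial>N 0) + ennreal (c * q * (C / (1 - q)))) + ennreal (c * C)"
      using Suc.prems q by (intro add_right_mono Suc.IH) auto
    also have "\<dots> = (\<integral>\<^sup>+ x. ennreal (min (c * q ^ Suc n * (1 + \<bar>x\<bar>) powr \<beta>) K) \<partial>N 0) + ennreal (c * (C / (1 - q)))"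
    proof -
      have "ennreal (c * q * (C / (1 - q))) + ennreal (c * C) = ennreal (c * q * (C / (1 - q)) + c * C)"
        using q Suc.prems by (intro ennreal_plus[symmetric]) auto
      also have "c * q * (C / (1 - q)) + c * C = c * (C / (1 - q))" using q by (simp add: field_simps)
      finally show ?thesis by (simp add: add.assoc mult_ac)
    qed
    finally show ?case .
  qed
  show thesis
    by (rule that[OF q(1,2), of "C / (1 - q)"]) (use q main[of 1] in auto)
qed

text \<open>From the point mass at 0 the transported initial term is at most q^n \<le> 1, which
  gives a bound independent of n.\<close>

lemma moment_iterates:
  assumes \<Psi>: "driven \<Psi>" and N: "\<And>n. prob_space (N n)" "\<And>n. sets (N n) = sets borel"
    and chain: "\<And>n. N (Suc n) = distr (M \<Otimes>\<^sub>M N n) borel \<Psi>" and N0: "N 0 = return borel 0"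
  obtains C where "C \<ge> 0" "\<And>n. (\<integral>\<^sup>+ x. ennreal ((1 + \<bar>x\<bar>) powr \<beta>) \<partial>N n) \<le> ennreal C"
proof -
  obtain q C where q: "0 < q" "q < 1" "0 \<le> C" and
    b: "\<And>n K. 0 \<le> K \<Longrightarrow> (\<integral>\<^sup>+ x. ennreal (min ((1 + \<bar>x\<bar>) powr \<beta>) K) \<partial>N n)
      \<le> (\<integral>\<^sup>+ x. ennreal (min (q ^ n * (1 + \<bar>x\<bar>) powr \<beta>) K) \<partial>N 0) + ennreal C"
    by (rule moment_chain[of \<Psi> N, OF \<Psi> N chain]) blast
  show thesis
  proof (rule that[of "1 + C"])
    fix n
    note N(2)[measurable_cong]
    show "(\<integral>\<^sup>+ x. ennreal ((1 + \<bar>x\<bar>) powr \<beta>) \<partial>N n) \<le> ennreal (1 + C)"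
    proof (rule nn_integral_le_of_truncations)
      fix K :: real assume K: "K \<ge> 0"
      have "(\<integral>\<^sup>+ x. ennreal (min (q ^ n * (1 + \<bar>x\<bar>) powr \<beta>) K) \<partial>N 0) = ennreal (min (q ^ n) K)"
        unfolding N0 by (subst nn_integral_return) auto
      also have "\<dots> \<le> ennreal 1" using q power_le_one[of q n] by (intro ennreal_leI) auto
      finally have "(\<integral>\<^sup>+ x. ennreal (min (q ^ n * (1 + \<bar>x\<bar>) powr \<beta>) K) \<partial>N 0) + ennreal C \<le> ennreal 1 + ennreal C"
        by (intro add_right_mono)
      then show "(\<integral>\<^sup>+ x. ennreal (min ((1 + \<bar>x\<bar>) powr \<beta>) K) \<partial>N n) \<le> ennreal (1 + C)"
        using q b[OF K, of n] by (auto intro: order_trans)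
    qed measurable
  qed (use q in auto)
qed

text \<open>For the constant chain the coefficient q^n tends to 0 inside the truncated integral
  while the left-hand side does not change. So the initial term disappears by dominated convergence,
  and only then is the truncation removed.\<close>

lemma moment_stationary:
  assumes \<Psi>: "driven \<Psi>" and \<nu>: "prob_space \<nu>" "sets \<nu> = sets borel" "\<nu> = distr (M \<Otimes>\<^sub>M \<nu>) borel \<Psi>"
  shows "(\<integral>\<^sup>+ x. ennreal ((1 + \<bar>x\<bar>) powr \<beta>) \<partial>\<nu>) < \<infinity>"
proof -
  interpret N: prob_space \<nu> by fact
  obtain q C where q: "0 < q" "q < 1" "0 \<le> C" and
    b: "\<And>n K. 0 \<le> K \<Longrightarrow> (\<integral>\<^sup>+ x. ennreal (min ((1 + \<bar>x\<bar>) powr \<beta>) K) \<partial>\<nu>)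
      \<le> (\<integral>\<^sup>+ x. ennreal (min (q ^ n * (1 + \<bar>x\<bar>) powr \<beta>) K) \<partial>\<nu>) + ennreal C"
    by (rule moment_chain[of \<Psi> "\<lambda>_. \<nu>", OF \<Psi> \<nu>]) blast
  note \<nu>(2)[measurable_cong]
  have "(\<integral>\<^sup>+ x. ennreal ((1 + \<bar>x\<bar>) powr \<beta>) \<partial>\<nu>) \<le> ennreal C"
  proof (rule nn_integral_le_of_truncations)
    fix K :: real assume K: "K \<ge> 0"
    have "(\<lambda>n. \<integral>\<^sup>+ x. ennreal (min (q ^ n * (1 + \<bar>x\<bar>) powr \<beta>) K) \<partial>\<nu>) \<longlonglongrightarrow> (\<integral>\<^sup>+ x. 0 \<partial>\<nu>)"
    proof (rule nn_integral_dominated_convergence[where w="\<lambda>_. ennreal K"])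
      show "AE x in \<nu>. (\<lambda>n. ennreal (min (q ^ n * (1 + \<bar>x\<bar>) powr \<beta>) K)) \<longlonglongrightarrow> 0"
      proof (rule AE_I2)
        fix x
        have "(\<lambda>n. min (q ^ n * (1 + \<bar>x\<bar>) powr \<beta>) K) \<longlonglongrightarrow> min (0 * (1 + \<bar>x\<bar>) powr \<beta>) K"
          using q by (intro tendsto_intros LIMSEQ_power_zero) auto
        then show "(\<lambda>n. ennreal (min (q ^ n * (1 + \<bar>x\<bar>) powr \<beta>) K)) \<longlonglongrightarrow> 0"
          using K tendsto_ennrealI by fastforce
      qed
    qed (auto intro!: ennreal_leI simp: N.emeasure_space_1)
    then have "(\<lambda>n. (\<integral>\<^sup>+ x. ennreal (min (q ^ n * (1 + \<bar>x\<bar>) powr \<beta>) K) \<partial>\<nu>) + ennreal C) \<longlonglongrightarrow> 0 + ennreal C"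
      by (intro tendsto_add) auto
    then show "(\<integral>\<^sup>+ x. ennreal (min ((1 + \<bar>x\<bar>) powr \<beta>) K) \<partial>\<nu>) \<le> ennreal C"
      using b[OF K] by (intro LIMSEQ_le_const[where X="\<lambda>n. (\<integral>\<^sup>+ x. ennreal (min (q ^ n * (1 + \<bar>x\<bar>) powr \<beta>) K) \<partial>\<nu>) + ennreal C"]) auto
  qed measurable
  then show ?thesis by (rule order.strict_trans1) simp
qed

text \<open>By stationarity the tail of \<nu> is the tail after one step, so its defect h is exactly
  the quantity estimated in \<open>perturbation_bound\<close>.\<close>

lemma stationary_tail:
  assumes \<Psi>: "driven \<Psi>" and \<nu>: "prob_space \<nu>" "sets \<nu> = sets borel" "\<nu> = distr (M \<Otimes>\<^sub>M \<nu>) borel \<Psi>"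
  obtains CL where "CL \<ge> 0" "((\<lambda>t. t powr \<alpha> * measure \<nu> {t<..}) \<longlongrightarrow> CL) at_top"
proof -
  interpret N: prob_space \<nu> by fact
  define F where "F t = measure \<nu> {t<..}" for t
  have anti: "antimono F" unfolding F_def using N.finite_measure_axioms \<nu>(2) by (rule antimono_tail)
  have Fm [measurable]: "F \<in> borel_measurable borel" by (rule borel_measurable_antimono[OF anti])
  define C where "C = enn2real (\<integral>\<^sup>+ x. ennreal ((1 + \<bar>x\<bar>) powr \<beta>) \<partial>\<nu>)"
  have C: "(\<integral>\<^sup>+ x. ennreal ((1 + \<bar>x\<bar>) powr \<beta>) \<partial>\<nu>) = ennreal C" "C \<ge> 0"
    using moment_stationary[OF \<Psi> \<nu>] by (auto simp: C_def)
  define h where "h s = exp (\<alpha> * s) * (F (exp s) - (\<integral>p. F (exp s / A p) \<partial>M))" for s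
  have h: "integrable lborel h"
  proof (rule integrableI_bounded)
    show "h \<in> borel_measurable lborel" unfolding h_def by measurable
    have "(\<integral>\<^sup>+ s. ennreal (norm (h s)) \<partial>lborel)
       = (\<integral>\<^sup>+ s. ennreal (exp (\<alpha> * s) * \<bar>measure (distr (M \<Otimes>\<^sub>M \<nu>) borel \<Psi>) {exp s<..} - (\<integral>p. measure \<nu> {exp s / A p<..} \<partial>M)\<bar>) \<partial>lborel)"
      unfolding \<nu>(3)[symmetric] by (simp add: h_def F_def abs_mult)
    also have "\<dots> \<le> ennreal ((1 + \<alpha>) / \<alpha>) * (\<integral>\<^sup>+ p. ennreal (W p powr \<alpha>) \<partial>M) * (\<integral>\<^sup>+ x. ennreal ((1 + \<bar>x\<bar>) powr \<beta>) \<partial>\<nu>)"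
      by (rule perturbation_bound[OF \<nu>(1,2) \<Psi>])
    also have "\<dots> < \<infinity>" using W_moment by (simp add: C ennreal_mult_less_top)
    finally show "(\<integral>\<^sup>+ s. ennreal (norm (h s)) \<partial>lborel) < \<infinity>" .
  qed
  have lim: "((\<lambda>t. t powr \<alpha> * F t) \<longlongrightarrow> (\<integral>s. h s \<partial>lborel) / tilt.drift) at_top"
  proof (rule tail_asymptotics[OF Fm _ _ _ h h_def])
    show "F t \<le> F s" if "s \<le> t" for s t using antimonoD[OF anti that] .
    show "F t \<le> C * t powr (- \<beta>)" if "t > 0" for t
      unfolding F_def by (rule tail_le_moment[OF \<nu>(1,2) beta(1) C(2) _ that]) (simp add: C(1))
  qed (simp add: F_def)
  have "0 \<le> (\<integral>s. h s \<partial>lborel) / tilt.drift"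
    by (rule tendsto_lowerbound[OF lim]) (auto simp: F_def intro!: always_eventually)
  with lim show thesis using that unfolding F_def by blast
qed

text \<open>\<open>incr\<close> replaces the tail after n steps by the larger one after n + 1 steps
  and thereby turns the recursion into a renewal inequality for a single law. The \<beta>-moments
  are bounded uniformly in n, hence so is the constant.\<close>

lemma iterates_tail_bound:
  assumes \<Psi>: "driven \<Psi>" and N: "\<And>n. prob_space (N n)" "\<And>n. sets (N n) = sets borel"
    and chain: "\<And>n. N (Suc n) = distr (M \<Otimes>\<^sub>M N n) borel \<Psi>" and N0: "N 0 = return borel 0"
    and incr: "\<And>n t. measure (N n) {t<..} \<le> measure (N (Suc n)) {t<..}"
  obtains C where "C \<ge> 0" "\<And>n t. t > 0 \<Longrightarrow> measure (N n) {t<..} \<le> C * t powr (- \<alpha>)"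
proof -
  obtain C where C: "C \<ge> 0" "\<And>n. (\<integral>\<^sup>+ x. ennreal ((1 + \<bar>x\<bar>) powr \<beta>) \<partial>N n) \<le> ennreal C"
    using moment_iterates[of \<Psi> N, OF \<Psi> N chain N0] by blast
  define I where "I = ennreal ((1 + \<alpha>) / \<alpha>) * (\<integral>\<^sup>+ p. ennreal (W p powr \<alpha>) \<partial>M) * ennreal C"
  define K where "K = ennreal (exp \<alpha> * tilt.pot_bound) * I"
  have "K < \<infinity>" using W_moment by (simp add: K_def I_def ennreal_mult_less_top)
  then have K: "K = ennreal (enn2real K)" by simp
  show thesis
  proof (rule that[of "enn2real K"])
    fix n and t :: real assume t: "t > 0"
    interpret N: prob_space "N n" by (rule N)
    define F where "F t = measure (N n) {t<..}" for t
    have anti: "antimono F" unfolding F_def using N.finite_measure_axioms N(2) by (rule antimono_tail)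
    have Fm [measurable]: "F \<in> borel_measurable borel" by (rule borel_measurable_antimono[OF anti])
    interpret N': prob_space "N (Suc n)" by (rule N)
    have [measurable]: "(\<lambda>t. measure (N (Suc n)) {t<..}) \<in> borel_measurable borel"
      using N'.finite_measure_axioms N(2) by (intro borel_measurable_antimono antimono_tail)
    define h where "h s = ennreal (exp (\<alpha> * s) * \<bar>measure (N (Suc n)) {exp s<..} - (\<integral>p. F (exp s / A p) \<partial>M)\<bar>)" for s
    have "ennreal (t powr \<alpha> * F t) \<le> ennreal (exp \<alpha> * tilt.pot_bound) * (\<integral>\<^sup>+ s. h s \<partial>lborel)"
    proof (rule tail_upper_bound[OF Fm])
      show "F t \<le> F s" if "s \<le> t" for s t using antimonoD[OF anti that] .
      show "F t \<le> C * t powr (- \<beta>)" if "t > 0" for t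
        unfolding F_def by (rule tail_le_moment[OF N beta(1) C that])
      show "h \<in> borel_measurable borel" unfolding h_def by measurable
      show "ennreal (exp (\<alpha> * s) * F (exp s)) \<le> ennreal (exp (\<alpha> * s) * (\<integral>p. F (exp s / A p) \<partial>M)) + h s" for s
      proof -
        have 0: "0 \<le> (\<integral>p. F (exp s / A p) \<partial>M)" by (intro integral_nonneg_AE) (auto simp: F_def)
        have "F (exp s) \<le> (\<integral>p. F (exp s / A p) \<partial>M) + \<bar>measure (N (Suc n)) {exp s<..} - (\<integral>p. F (exp s / A p) \<partial>M)\<bar>"
          using incr[of n "exp s"] unfolding F_def by linarith
        then have "exp (\<alpha> * s) * F (exp s) \<le> exp (\<alpha> * s) * (\<integral>p. F (exp s / A p) \<partial>M)
            + exp (\<alpha> * s) * \<bar>measure (N (Suc n)) {exp s<..} - (\<integral>p. F (exp s / A p) \<partial>M)\<bar>"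
          by (simp add: distrib_left[symmetric])
        from ennreal_leI[OF this] show ?thesis
          using 0 unfolding h_def by (simp only: ennreal_plus mult_nonneg_nonneg exp_ge_zero abs_ge_zero)
      qed
    qed (use t in \<open>auto simp: F_def\<close>)
    also have "(\<integral>\<^sup>+ s. h s \<partial>lborel) \<le> I"
    proof -
      have "(\<integral>\<^sup>+ s. h s \<partial>lborel) \<le> ennreal ((1 + \<alpha>) / \<alpha>) * (\<integral>\<^sup>+ p. ennreal (W p powr \<alpha>) \<partial>M) * (\<integral>\<^sup>+ x. ennreal ((1 + \<bar>x\<bar>) powr \<beta>) \<partial>N n)"
        unfolding h_def F_def chain by (rule perturbation_bound[OF N \<Psi>])
      also have "\<dots> \<le> I" unfolding I_def by (intro mult_left_mono C) auto
      finally show ?thesis .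
    qed
    finally have "ennreal (t powr \<alpha> * F t) \<le> K" by (simp add: K_def mult_left_mono)
    then have "enn2real (ennreal (t powr \<alpha> * F t)) \<le> enn2real K" using \<open>K < \<infinity>\<close> by (intro enn2real_mono) auto
    then have "t powr \<alpha> * F t \<le> enn2real K" by (simp add: F_def)
    then have "t powr (- \<alpha>) * (t powr \<alpha> * F t) \<le> t powr (- \<alpha>) * enn2real K" by (intro mult_left_mono) auto
    then show "measure (N n) {t<..} \<le> enn2real K * t powr (- \<alpha>)"
      using t by (simp add: F_def powr_minus field_simps)
  qed simp
qed

text \<open>\<open>hit n t\<close> is the probability that one of the partial products
  \<open>1, A\<^sub>1, A\<^sub>1 A\<^sub>2, \<dots>\<close> with at most \<open>n\<close> factors exceeds \<open>t\<close>.\<close>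
primrec hit :: "nat \<Rightarrow> real \<Rightarrow> real" where
  "hit 0 t = (if t < 1 then 1 else 0)"
| "hit (Suc n) t = (if t < 1 then 1 else (\<integral>p. hit n (t / A p) \<partial>M))"

lemma hit_props: "antimono (hit n)" "\<And>t. 0 \<le> hit n t" "\<And>t. hit n t \<le> 1"
proof (induction n)
  case (Suc n)
  note [measurable] = borel_measurable_antimono[OF Suc(1)]
  have i: "integrable M (\<lambda>p. hit n (t / A p))" for t
    by (rule integrable_const_bound[where B=1]) (use Suc in auto)
  have ge0: "0 \<le> (\<integral>p. hit n (t / A p) \<partial>M)" for t using Suc by (intro integral_nonneg_AE) auto
  have le1: "(\<integral>p. hit n (t / A p) \<partial>M) \<le> 1" for t
    using integral_mono[OF i[of t], of "\<lambda>_. 1"] Suc prob_space by simp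
  have m: "(\<integral>p. hit n (t / A p) \<partial>M) \<le> (\<integral>p. hit n (s / A p) \<partial>M)" if "s \<le> t" for s t
    by (rule integral_mono_AE[OF i i], use A_pos in eventually_elim)
       (use that in \<open>auto intro!: antimonoD[OF Suc(1)] divide_right_mono\<close>)
  {
    case 1
    show ?case using m le1 by (auto intro!: antimonoI)
  next
    case 2
    show ?case using ge0 by simp
  next
    case 3
    show ?case using le1 by simp
  }
qed (auto simp: monotone_def)

lemma measurable_hit [measurable]: "hit n \<in> borel_measurable borel"
  by (rule borel_measurable_antimono[OF hit_props(1)])

lemma hit_integrable: "integrable M (\<lambda>p. hit n (t / A p))"
  by (rule integrable_const_bound[where B=1]) (use hit_props in auto)

lemma hit_Suc_ge: "hit n t \<le> hit (Suc n) t"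
proof (induction n arbitrary: t)
  case 0
  have "0 \<le> (\<integral>p. hit 0 (t / A p) \<partial>M)" by (intro integral_nonneg_AE AE_I2 hit_props)
  then show ?case by (simp del: hit.simps(1)) simp
next
  case (Suc n)
  have "(\<integral>p. hit n (t / A p) \<partial>M) \<le> (\<integral>p. hit (Suc n) (t / A p) \<partial>M)"
    by (intro integral_mono hit_integrable Suc)
  then show ?case by (subst hit.simps(2), subst (2) hit.simps(2)) simp
qed

lemma integral_scaled_power: "(\<integral>p. (t / A p) powr (- \<beta>) \<partial>M) = qb * t powr (- \<beta>)"
  "integrable M (\<lambda>p. (t / A p) powr (- \<beta>))" if "t > 0"
proof -
  have eq: "AE p in M. (t / A p) powr (- \<beta>) = t powr (- \<beta>) * A p powr \<beta>"
    using A_pos by eventually_elim (use that in \<open>simp add: powr_divide powr_minus field_simps\<close>)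
  have i: "integrable M (\<lambda>p. A p powr \<beta>)" by (intro integrableI_nonneg) (auto simp: A_beta)
  have "(\<integral>p. A p powr \<beta> \<partial>M) = qb" by (subst integral_eq_nn_integral) (auto simp: A_beta)
  then show "(\<integral>p. (t / A p) powr (- \<beta>) \<partial>M) = qb * t powr (- \<beta>)"
    by (subst integral_cong_AE[OF _ _ eq]) auto
  show "integrable M (\<lambda>p. (t / A p) powr (- \<beta>))"
    by (subst integrable_cong_AE[OF _ _ eq]) (use i in auto)
qed

text \<open>t^(-\<beta>) is at least 1 on 0 < t < 1 and is superharmonic for the recursion, since
  replacing t by t / A multiplies its mean by qb < 1.\<close>

lemma hit_le_power: "t > 0 \<Longrightarrow> hit n t \<le> t powr (- \<beta>)"
proof (induction n arbitrary: t)
  case 0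
  then show ?case using powr_mono2'[of "- \<beta>" t 1] beta by auto
next
  case (Suc n)
  show ?case
  proof (cases "t < 1")
    case True
    then show ?thesis using powr_mono2'[of "- \<beta>" t 1] beta Suc by auto
  next
    case False
    have "(\<integral>p. hit n (t / A p) \<partial>M) \<le> (\<integral>p. (t / A p) powr (- \<beta>) \<partial>M)"
      by (rule integral_mono_AE[OF hit_integrable integral_scaled_power(2)[OF Suc.prems]], use A_pos in eventually_elim)
         (use Suc in auto)
    also have "\<dots> \<le> 1 * t powr (- \<beta>)"
      unfolding integral_scaled_power(1)[OF Suc.prems] using A_beta by (intro mult_right_mono) auto
    finally show ?thesis using False by simp
  qed
qed

text \<open>v(t) is the probability that the supremum of the partial products, including the empty
  product 1, exceeds t. It equals the mean of v(t / A) for t \<ge> 1, so the defect h lives on s < 0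
  and is nonnegative; it is strictly positive just left of 0, which makes the limit
  positive.\<close>

lemma hit_limit:
  obtains v c where "c > 0" "\<And>t. (\<lambda>n. hit n t) \<longlonglongrightarrow> v t" "((\<lambda>t. t powr \<alpha> * v t) \<longlongrightarrow> c) at_top"
proof -
  define v where "v t = lim (\<lambda>n. hit n t)" for t
  have vl: "(\<lambda>n. hit n t) \<longlonglongrightarrow> v t" for t
  proof -
    have "incseq (\<lambda>n. hit n t)" by (intro incseq_SucI hit_Suc_ge)
    then obtain L where "(\<lambda>n. hit n t) \<longlonglongrightarrow> L"
      by (rule incseq_convergent[where B=1]) (use hit_props in auto)
    then show ?thesis unfolding v_def by (simp add: limI)
  qed
  have v0: "0 \<le> v t" for t by (rule LIMSEQ_le_const[OF vl]) (use hit_props in auto)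
  have v1: "v t \<le> 1" for t by (rule LIMSEQ_le_const2[OF vl]) (use hit_props in auto)
  have anti: "antimono v"
    by (intro antimonoI LIMSEQ_le[OF vl vl]) (use antimonoD[OF hit_props(1)] in auto)
  note [measurable] = borel_measurable_antimono[OF anti]
  have vb: "v t \<le> t powr (- \<beta>)" if "t > 0" for t
    by (rule LIMSEQ_le_const2[OF vl]) (use hit_le_power[OF that] in auto)
  have vlow: "v t = 1" if "t < 1" for t
  proof -
    have "hit n t = 1" for n using that by (cases n) auto
    then show ?thesis using LIMSEQ_unique[OF vl[of t]] by simp
  qed
  have veq: "v t = (\<integral>p. v (t / A p) \<partial>M)" if "t \<ge> 1" for t
  proof -
    have "(\<lambda>n. \<integral>p. hit n (t / A p) \<partial>M) \<longlonglongrightarrow> (\<integral>p. v (t / A p) \<partial>M)"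
      by (rule integral_dominated_convergence[where w="\<lambda>_. 1"]) (use vl hit_props in auto)
    moreover have "(\<integral>p. hit n (t / A p) \<partial>M) = hit (Suc n) t" for n using that by simp
    ultimately have "(\<lambda>n. hit (Suc n) t) \<longlonglongrightarrow> (\<integral>p. v (t / A p) \<partial>M)" by simp
    then show ?thesis using LIMSEQ_Suc[OF vl[of t]] LIMSEQ_unique by blast
  qed
  have vi: "integrable M (\<lambda>p. v (t / A p))" for t
    by (rule integrable_const_bound[where B=1]) (use v0 v1 in auto)
  have I0: "0 \<le> (\<integral>p. v (t / A p) \<partial>M)" for t using v0 by (intro integral_nonneg_AE) auto
  have I1: "(\<integral>p. v (t / A p) \<partial>M) \<le> 1" for t
    using integral_mono[OF vi[of t], of "\<lambda>_. 1"] v1 prob_space by simp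
  define h where "h s = exp (\<alpha> * s) * (v (exp s) - (\<integral>p. v (exp s / A p) \<partial>M))" for s
  have h0: "0 \<le> h s" for s
    using veq[of "exp s"] vlow[of "exp s"] I1 by (cases "exp s < 1") (auto simp: h_def)
  have hm [measurable]: "h \<in> borel_measurable borel" unfolding h_def by measurable
  have h: "integrable lborel h"
  proof (rule integrableI_nonneg)
    have "(\<integral>\<^sup>+ s. ennreal (h s) \<partial>lborel) \<le> (\<integral>\<^sup>+ s. ennreal (exp (\<alpha> * s)) * indicator {..0} s \<partial>lborel)"
    proof (rule nn_integral_mono)
      fix s :: real
      have "h s \<le> exp (\<alpha> * s) * 1" unfolding h_def
        using v1[of "exp s"] I0[of "exp s"] by (intro mult_left_mono) auto
      moreover have "h s = 0" if "s > 0" using that veq[of "exp s"] by (simp add: h_def)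
      ultimately show "ennreal (h s) \<le> ennreal (exp (\<alpha> * s)) * indicator {..0} s"
        by (cases "s > 0") (auto intro!: ennreal_leI)
    qed
    also have "\<dots> < \<infinity>" by (simp add: nn_integral_exp_atMost alpha_pos)
    finally show "(\<integral>\<^sup>+ s. ennreal (h s) \<partial>lborel) < \<infinity>" .
  qed (use h0 in auto)
  have lim: "((\<lambda>t. t powr \<alpha> * v t) \<longlongrightarrow> (\<integral>s. h s \<partial>lborel) / tilt.drift) at_top"
    by (rule tail_asymptotics[where C=1, OF _ v0 _ _ h h_def]) (use vb antimonoD[OF anti] in auto)
  have "(\<integral>s. h s \<partial>lborel) \<noteq> 0"
  proof
    assume "(\<integral>s. h s \<partial>lborel) = 0"
    then have ae: "AE s in lborel. h s = 0" using integral_nonneg_eq_0_iff_AE[OF h] h0 by simp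
    \<comment> \<open>On (-e, 0) the exponent -\<beta> s stays below (1 - qb) / 2, while ln qb \<le>
      qb - 1. So qb exp(-\<beta> s), which bounds the mean of v(exp s / A), is below 1 = v(exp
      s).\<close>
    define e where "e = (1 - qb) / (2 * \<beta>)"
    have e: "e > 0" using A_beta beta by (simp add: e_def)
    have pos: "h s > 0" if s: "- e < s" "s < 0" for s
    proof -
      have "(\<integral>p. v (exp s / A p) \<partial>M) \<le> (\<integral>p. (exp s / A p) powr (- \<beta>) \<partial>M)"
        by (rule integral_mono_AE[OF vi integral_scaled_power(2)], simp, use A_pos in eventually_elim)
           (use vb in auto)
      also have "\<dots> = qb * exp (- (\<beta> * s))" by (subst integral_scaled_power(1)) (auto simp: powr_def)
      also have "\<dots> < 1"
      proof (cases "qb = 0")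
        case False
        have "- (\<beta> * s) < (1 - qb) / 2" using s(1) beta(1) by (simp add: e_def field_simps)
        moreover have "ln qb \<le> qb - 1" using False A_beta by (intro ln_le_minus_one) auto
        ultimately have "ln qb + - (\<beta> * s) < 0" using A_beta(3) by argo
        then have "exp (ln qb + - (\<beta> * s)) < 1" by simp
        then show ?thesis using False A_beta by (subst (asm) exp_add) simp
      qed simp
      finally show ?thesis using vlow[of "exp s"] s by (simp add: h_def)
    qed
    have "AE s in lborel. s \<notin> {- e<..<0}" using ae by eventually_elim (use pos in force)
    then have "emeasure lborel {- e<..<0} = 0"
      by (subst (asm) AE_iff_measurable[of "{- e<..<0}"]) auto
    then show False using e by simp
  qed
  moreover have "(\<integral>s. h s \<partial>lborel) \<ge> 0" using h0 by (intro integral_nonneg_AE) auto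
  ultimately have "(\<integral>s. h s \<partial>lborel) / tilt.drift > 0" using tilt.drift_pos by simp
  then show thesis using that[OF _ vl lim] by blast
qed

text \<open>Unfolding \<open>n\<close> steps of the recursion, the value exceeds \<open>a - b\<close> as soon as it starts above \<open>y\<close>,
  some partial product exceeds \<open>a / y\<close>, and the accumulated \<open>\<bar>B\<bar>\<close>-part stays below \<open>b\<close>; the
  separate levels \<open>a\<close> and \<open>b\<close> make this induction close.\<close>
lemma tail_comparison:
  fixes F :: "real \<Rightarrow> real" and z :: "nat \<Rightarrow> real \<Rightarrow> real"
  assumes [measurable]: "B \<in> borel_measurable M"
    and F: "antimono F" "\<And>t. 0 \<le> F t" "\<And>t. F t \<le> 1"
    and Fge: "\<And>t. (\<integral>p. F ((t - B p) / A p) \<partial>M) \<le> F t"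
    and z: "\<And>n. antimono (z n)" "\<And>n t. 0 \<le> z n t" "\<And>n t. z n t \<le> 1"
    and z0: "\<And>n t. t < 0 \<Longrightarrow> z n t = 1"
    and zS: "\<And>n t. z (Suc n) t = (\<integral>p. z n ((t - \<bar>B p\<bar>) / A p) \<partial>M)"
    and y: "y > 0"
  shows "F y * (hit n (a / y) - z n b) \<le> F (a - b)"
proof (induction n arbitrary: a b)
  case 0
  show ?case
  proof (cases "b < 0 \<or> \<not> a < y")
    case True
    then have "hit 0 (a / y) - z 0 b \<le> 0" using z0[of b 0] z(2)[of 0 b] y by (auto simp: field_simps)
    then show ?thesis using F(2) by (meson mult_nonneg_nonpos order_trans)
  next
    case False
    then have "F y * (hit 0 (a / y) - z 0 b) \<le> F y * 1" using F(2) z(2)[of 0 b] by (intro mult_left_mono) auto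
    also have "\<dots> \<le> F (a - b)" using antimonoD[OF F(1), of "a - b" y] False by simp
    finally show ?thesis .
  qed
next
  case (Suc n)
  note [measurable] = borel_measurable_antimono[OF F(1)] borel_measurable_antimono[OF z(1)]
  \<comment> \<open>Two cases need no recursion: for b < 0 the z-term is 1 and the left side is at
    most 0; for b \<ge> 0 and a < y the level a - b is below y, so that F(a - b) \<ge> F(y).\<close>
  consider "b < 0" | "b \<ge> 0" "a < y" | "b \<ge> 0" "a \<ge> y" by linarith
  then show ?case
  proof cases
    case 1
    then have "hit (Suc n) (a / y) - z (Suc n) b \<le> 0" using z0[of b "Suc n"] hit_props(3)[of "Suc n" "a / y"] by simp
    then show ?thesis using F(2) by (meson mult_nonneg_nonpos order_trans)
  next
    case 2
    have "F y * (hit (Suc n) (a / y) - z (Suc n) b) \<le> F y * 1"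
      using F(2) z(2)[of "Suc n" b] hit_props(3)[of "Suc n" "a / y"] by (intro mult_left_mono) linarith+
    also have "\<dots> \<le> F (a - b)" using antimonoD[OF F(1), of "a - b" y] 2 by simp
    finally show ?thesis .
  next
    case 3
    have zi: "integrable M (\<lambda>p. z n ((b - \<bar>B p\<bar>) / A p))"
      by (rule integrable_const_bound[where B=1]) (use z in auto)
    have Fi: "integrable M (\<lambda>p. F ((t - B p) / A p))" for t
      by (rule integrable_const_bound[where B=1]) (use F in auto)
    have "\<not> a / y < 1" using 3 y by (simp add: field_simps)
    then have "F y * (hit (Suc n) (a / y) - z (Suc n) b)
       = F y * ((\<integral>p. hit n (a / y / A p) \<partial>M) - (\<integral>p. z n ((b - \<bar>B p\<bar>) / A p) \<partial>M))" by (simp add: zS)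
    also have "\<dots> = (\<integral>p. F y * (hit n (a / y / A p) - z n ((b - \<bar>B p\<bar>) / A p)) \<partial>M)"
      by (simp only: integral_mult_right_zero Bochner_Integration.integral_diff[OF hit_integrable zi])
    also have "\<dots> \<le> (\<integral>p. F ((a - b - B p) / A p) \<partial>M)"
    proof (rule integral_mono_AE)
      show "integrable M (\<lambda>p. F y * (hit n (a / y / A p) - z n ((b - \<bar>B p\<bar>) / A p)))"
        by (intro integrable_mult_right Bochner_Integration.integrable_diff hit_integrable zi)
      show "AE p in M. F y * (hit n (a / y / A p) - z n ((b - \<bar>B p\<bar>) / A p)) \<le> F ((a - b - B p) / A p)"
        using A_pos
      proof eventually_elim
        case (elim p)
        \<comment> \<open>The hypothesis is used at levels a / A and (b - |B|) / A. Their difference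
          is (a - b + |B|) / A, at least (a - b - B) / A, so the sign of B is irrelevant.\<close>
        have "F y * (hit n ((a / A p) / y) - z n ((b - \<bar>B p\<bar>) / A p)) \<le> F (a / A p - (b - \<bar>B p\<bar>) / A p)"
          by (rule Suc.IH)
        also have "a / A p - (b - \<bar>B p\<bar>) / A p = (a - b + \<bar>B p\<bar>) / A p" by (simp add: diff_divide_distrib add_divide_distrib)
        also have "F \<dots> \<le> F ((a - b - B p) / A p)"
          using elim by (intro antimonoD[OF F(1)] divide_right_mono) auto
        finally show ?case by (simp add: mult.commute)
      qed
    qed (rule Fi)
    also have "\<dots> \<le> F (a - b)" by (rule Fge)
    finally show ?thesis .
  qed
qed

text \<open>Strict positivity of F at every level is the unboundedness of the support; it provides
  F(y) > 0 at a level y that can be chosen after all other constants. The comparison is made at a =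
  2t and b = t.\<close>

lemma tail_limit_pos:
  fixes F :: "real \<Rightarrow> real"
  assumes B [measurable]: "B \<in> borel_measurable M" and BW: "\<And>p. A p > 0 \<Longrightarrow> 1 + \<bar>B p\<bar> + A p \<le> W p"
    and F: "antimono F" "\<And>t. 0 < F t" "\<And>t. F t \<le> 1"
    and Fge: "\<And>t. (\<integral>p. F ((t - B p) / A p) \<partial>M) \<le> F t"
    and lim: "((\<lambda>t. t powr \<alpha> * F t) \<longlongrightarrow> CL) at_top"
  shows "CL > 0"
proof -
  \<comment> \<open>The perpetuity with B replaced by its absolute value. Its iterates from 0 have
    the tails \<open>z n\<close>, which measure the accumulated additive part.\<close>
  define \<Phi> where "\<Phi> z = A (fst z) * snd z + \<bar>B (fst z)\<bar>" for z :: "'a \<times> real"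
  have \<Phi>m [measurable]: "\<Phi> \<in> borel_measurable (M \<Otimes>\<^sub>M borel)" unfolding \<Phi>_def by measurable
  have \<Phi>: "driven \<Phi>"
    unfolding driven_def
  proof (intro conjI allI impI \<Phi>m)
    fix p and x :: real assume a: "A p > 0"
    have "\<bar>\<Phi> (p, x)\<bar> \<le> \<bar>A p * x\<bar> + \<bar>B p\<bar>" by (simp add: \<Phi>_def)
    then show "1 + \<bar>\<Phi> (p, x)\<bar> \<le> A p * (1 + \<bar>x\<bar>) + W p"
      using BW[OF a] a by (simp add: abs_mult algebra_simps)
    show "\<bar>max 0 (\<Phi> (p, x)) - max 0 (A p * x)\<bar> + A p \<le> W p"
      using BW[OF a] by (simp add: \<Phi>_def)
  qed
  define N where "N = rec_nat (return borel (0::real)) (\<lambda>_ \<nu>. distr (M \<Otimes>\<^sub>M \<nu>) borel \<Phi>)"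
  have N0: "N 0 = return borel 0" and NS: "N (Suc n) = distr (M \<Otimes>\<^sub>M N n) borel \<Phi>" for n
    by (simp_all add: N_def)
  have Ns: "sets (N n) = sets borel" for n by (cases n) (auto simp: N0 NS)
  have Np: "prob_space (N n)" for n
  proof (induction n)
    case 0
    then show ?case by (simp add: N0 prob_space_return)
  next
    case (Suc n)
    interpret N: prob_space "N n" by fact
    interpret P: pair_prob_space M "N n" ..
    note Ns[measurable_cong]
    show ?case unfolding NS by (rule P.P.prob_space_distr) measurable
  qed
  define z where "z n t = measure (N n) {t<..}" for n t
  have zanti: "antimono (z n)" for n
    unfolding z_def using prob_space.finite_measure[OF Np] Ns by (rule antimono_tail)
  have z0: "0 \<le> z n t" and z1: "z n t \<le> 1" for n t
    using prob_space.prob_le_1[OF Np] by (auto simp: z_def)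
  note [measurable] = borel_measurable_antimono[OF zanti]
  have zi: "integrable M (\<lambda>p. z n ((t - \<bar>B p\<bar>) / A p))" for n t
    by (rule integrable_const_bound[where B=1]) (use z0 z1 in auto)
  have zS: "z (Suc n) t = (\<integral>p. z n ((t - \<bar>B p\<bar>) / A p) \<partial>M)" for n t
  proof -
    have "z (Suc n) t = (\<integral>p. measure (N n) {x. t < \<Phi> (p, x)} \<partial>M)"
      unfolding z_def NS by (rule tail_distr[OF Np Ns \<Phi>m])
    also have "\<dots> = (\<integral>p. z n ((t - \<bar>B p\<bar>) / A p) \<partial>M)"
    proof (rule integral_cong_AE)
      show "(\<lambda>p. measure (N n) {x. t < \<Phi> (p, x)}) \<in> borel_measurable M"
        using tail_pair(2)[OF Np Ns \<Phi>m] by auto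
      show "AE p in M. measure (N n) {x. t < \<Phi> (p, x)} = z n ((t - \<bar>B p\<bar>) / A p)"
        using A_pos
      proof eventually_elim
        case (elim p)
        then have "{x. t < \<Phi> (p, x)} = {(t - \<bar>B p\<bar>) / A p<..}" by (auto simp: \<Phi>_def field_simps)
        then show ?case by (simp add: z_def)
      qed
    qed measurable
    finally show ?thesis .
  qed
  have z00: "z 0 t = (if t < 0 then 1 else 0)" for t
    by (simp add: z_def N0 measure_return indicator_def)
  have zneg: "z n t = 1" if "t < 0" for n t
    using that
  proof (induction n arbitrary: t)
    case (Suc n)
    have "z (Suc n) t = (\<integral>p. 1 \<partial>M)"
      unfolding zS
    proof (rule integral_cong_AE)
      show "AE p in M. z n ((t - \<bar>B p\<bar>) / A p) = 1"
        using A_pos by eventually_elim (intro Suc.IH divide_neg_pos, use Suc.prems in auto)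
    qed auto
    then show ?case using prob_space by simp
  qed (simp add: z00)
  \<comment> \<open>The iterates start at 0 and receive nonnegative increments |B|, so one further
    step can only enlarge the tail. This provides the monotonicity that
    \<open>iterates_tail_bound\<close> asks for.\<close>
  have zinc: "z n t \<le> z (Suc n) t" for n t
  proof (induction n arbitrary: t)
    case 0
    then show ?case using zneg[of t "Suc 0"] z0 by (auto simp: z00)
  next
    case (Suc n)
    have "(\<integral>p. z n ((t - \<bar>B p\<bar>) / A p) \<partial>M) \<le> (\<integral>p. z (Suc n) ((t - \<bar>B p\<bar>) / A p) \<partial>M)"
      by (intro integral_mono zi Suc.IH)
    then show ?case by (simp only: zS[of n t] zS[of "Suc n" t])
  qed
  obtain C where C: "C \<ge> 0" "\<And>n t. t > 0 \<Longrightarrow> z n t \<le> C * t powr (- \<alpha>)"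
    using iterates_tail_bound[of \<Phi> N, OF \<Phi> Np Ns NS N0 zinc[unfolded z_def]] unfolding z_def by blast
  obtain v c where v: "c > 0" "\<And>t. (\<lambda>n. hit n t) \<longlonglongrightarrow> v t" "((\<lambda>t. t powr \<alpha> * v t) \<longlongrightarrow> c) at_top"
    using hit_limit by blast
  \<comment> \<open>Chosen after C so that (c / 2) (y / 2)^\<alpha> = C + 1: the hitting term is
    eventually at least (C + 1) t^(-\<alpha>) and exceeds the perpetuity bound C t^(-\<alpha>) by
    t^(-\<alpha>). Halving c leaves room for the limit.\<close>
  define y where "y = 2 * (2 * (C + 1) / c) powr (1 / \<alpha>)"
  have y: "y > 0" using C v(1) by (simp add: y_def)
  have yc: "(c / 2) * (y / 2) powr \<alpha> = C + 1" using C v(1) alpha_pos by (simp add: y_def powr_powr)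
  have Fv: "F y * (v (2 * t / y) - C * t powr (- \<alpha>)) \<le> F t" if t: "t > 0" for t
  proof -
    have "F y * (hit n (2 * t / y) - C * t powr (- \<alpha>)) \<le> F t" for n
    proof -
      have "F y * (hit n (2 * t / y) - C * t powr (- \<alpha>)) \<le> F y * (hit n (2 * t / y) - z n t)"
        using C(2)[OF t, of n] less_imp_le[OF F(2)] by (intro mult_left_mono) auto
      also have "\<dots> \<le> F (2 * t - t)"
        by (rule tail_comparison[where z=z and B=B])
           (use F(1,3) less_imp_le[OF F(2)] Fge zanti z0 z1 zneg zS y in auto)
      finally show ?thesis by simp
    qed
    moreover have "(\<lambda>n. F y * (hit n (2 * t / y) - C * t powr (- \<alpha>))) \<longlonglongrightarrow> F y * (v (2 * t / y) - C * t powr (- \<alpha>))"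
      by (intro tendsto_intros v)
    ultimately show ?thesis by (intro LIMSEQ_le_const2) auto
  qed
  have "filterlim (\<lambda>t::real. (2 / y) * t) at_top at_top"
    using y by (intro filterlim_tendsto_pos_mult_at_top[OF tendsto_const _ filterlim_ident]) auto
  from filterlim_compose[OF v(3) this]
  have "eventually (\<lambda>t. c / 2 < ((2 / y) * t) powr \<alpha> * v ((2 / y) * t)) at_top"
    by (rule order_tendstoD(1)) (use v(1) in auto)
  then have "eventually (\<lambda>t. F y \<le> t powr \<alpha> * F t) at_top"
    using eventually_gt_at_top[of 0]
  proof eventually_elim
    case (elim t)
    have "(y / 2) powr \<alpha> * (c / 2) \<le> (y / 2) powr \<alpha> * (((2 / y) * t) powr \<alpha> * v ((2 / y) * t))"
      using elim by (intro mult_left_mono) auto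
    also have "\<dots> = t powr \<alpha> * v (2 * t / y)"
      using y by (simp add: mult.assoc[symmetric] powr_mult[symmetric])
    finally have "C + 1 \<le> t powr \<alpha> * v (2 * t / y)" using yc by (simp add: mult.commute)
    then have "1 \<le> t powr \<alpha> * v (2 * t / y) - C * (t powr \<alpha> * t powr (- \<alpha>))"
      using elim by (simp add: powr_minus)
    then have "F y * 1 \<le> F y * (t powr \<alpha> * v (2 * t / y) - C * (t powr \<alpha> * t powr (- \<alpha>)))"
      using F(2) by (intro mult_left_mono) (auto intro: less_imp_le)
    also have "\<dots> = t powr \<alpha> * (F y * (v (2 * t / y) - C * t powr (- \<alpha>)))" by (simp add: algebra_simps)
    also have "\<dots> \<le> t powr \<alpha> * F t" using Fv elim by (intro mult_left_mono) auto
    finally show ?case by simp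
  qed
  then have "F y \<le> CL" by (intro tendsto_lowerbound[OF lim]) auto
  then show ?thesis using F(2)[of y] by linarith
qed

text \<open>The excess over L is multiplied by at most A in each step. Its \<beta>-moment I is
  finite and by stationarity satisfies I \<le> qb I with qb < 1, so it vanishes.\<close>

lemma stationary_bounded:
  assumes \<Psi>: "driven \<Psi>" and \<nu>: "prob_space \<nu>" "sets \<nu> = sets borel" "\<nu> = distr (M \<Otimes>\<^sub>M \<nu>) borel \<Psi>"
    and contr: "AE p in M. \<forall>x. \<Psi> (p, x) \<le> L + A p * max 0 (x - L)"
  shows "measure \<nu> {L<..} = 0"
proof -
  interpret N: prob_space \<nu> by fact
  interpret P: pair_prob_space M \<nu> ..
  note \<nu>(2)[measurable_cong]
  have \<Psi>m [measurable]: "\<Psi> \<in> borel_measurable (M \<Otimes>\<^sub>M borel)" using \<Psi> by (simp add: driven_def)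
  define I where "I = (\<integral>\<^sup>+ x. ennreal (max 0 (x - L) powr \<beta>) \<partial>\<nu>)"
  have "I \<le> (\<integral>\<^sup>+ x. ennreal ((1 + \<bar>L\<bar>) powr \<beta>) * ennreal ((1 + \<bar>x\<bar>) powr \<beta>) \<partial>\<nu>)"
    unfolding I_def
  proof (rule nn_integral_mono)
    fix x
    have "max 0 (x - L) \<le> (1 + \<bar>L\<bar>) * (1 + \<bar>x\<bar>)"
    proof -
      have "0 \<le> \<bar>L\<bar> * \<bar>x\<bar>" by simp
      then have "max 0 (x - L) \<le> 1 + \<bar>L\<bar> + \<bar>x\<bar> + \<bar>L\<bar> * \<bar>x\<bar>" by linarith
      then show ?thesis by (simp add: algebra_simps)
    qed
    then have "max 0 (x - L) powr \<beta> \<le> ((1 + \<bar>L\<bar>) * (1 + \<bar>x\<bar>)) powr \<beta>" using beta by (intro powr_mono2) auto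
    then show "ennreal (max 0 (x - L) powr \<beta>) \<le> ennreal ((1 + \<bar>L\<bar>) powr \<beta>) * ennreal ((1 + \<bar>x\<bar>) powr \<beta>)"
      by (simp add: ennreal_mult[symmetric] powr_mult ennreal_leI)
  qed
  also have "\<dots> < \<infinity>" using moment_stationary[OF \<Psi> \<nu>]
    by (subst nn_integral_cmult) (auto simp: ennreal_mult_less_top)
  finally have fin: "I < \<infinity>" .
  have "I = (\<integral>\<^sup>+ x. ennreal (max 0 (x - L) powr \<beta>) \<partial>distr (M \<Otimes>\<^sub>M \<nu>) borel \<Psi>)"
    unfolding I_def using \<nu>(3) by simp
  also have "\<dots> = (\<integral>\<^sup>+ z. ennreal (max 0 (\<Psi> z - L) powr \<beta>) \<partial>(M \<Otimes>\<^sub>M \<nu>))"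
    by (subst nn_integral_distr) auto
  also have "\<dots> = (\<integral>\<^sup>+ p. \<integral>\<^sup>+ x. ennreal (max 0 (\<Psi> (p, x) - L) powr \<beta>) \<partial>\<nu> \<partial>M)"
    by (subst N.nn_integral_fst[symmetric]) auto
  also have "\<dots> \<le> (\<integral>\<^sup>+ p. \<integral>\<^sup>+ x. ennreal (A p powr \<beta>) * ennreal (max 0 (x - L) powr \<beta>) \<partial>\<nu> \<partial>M)"
  proof (rule nn_integral_mono_AE, use contr A_pos in eventually_elim, rule nn_integral_mono)
    fix p x assume p: "\<forall>x. \<Psi> (p, x) \<le> L + A p * max 0 (x - L)" "A p > 0"
    have "max 0 (\<Psi> (p, x) - L) \<le> A p * max 0 (x - L)" using p(1)[rule_format, of x] p(2) by simp
    then have "max 0 (\<Psi> (p, x) - L) powr \<beta> \<le> (A p * max 0 (x - L)) powr \<beta>" using beta by (intro powr_mono2) auto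
    then show "ennreal (max 0 (\<Psi> (p, x) - L) powr \<beta>) \<le> ennreal (A p powr \<beta>) * ennreal (max 0 (x - L) powr \<beta>)"
      by (simp add: ennreal_mult[symmetric] powr_mult ennreal_leI)
  qed
  also have "\<dots> = (\<integral>\<^sup>+ p. ennreal (A p powr \<beta>) * I \<partial>M)"
    unfolding I_def by (intro nn_integral_cong nn_integral_cmult) measurable
  also have "\<dots> = ennreal qb * I" by (subst nn_integral_multc) (auto simp: A_beta)
  finally have le: "I \<le> ennreal qb * I" .
  have "I = 0"
  proof -
    obtain i where i: "I = ennreal i" "i \<ge> 0" using fin by (cases I) auto
    then have "i \<le> qb * i" using le A_beta by (simp add: ennreal_mult[symmetric])
    then have "i * (1 - qb) \<le> 0" by (simp add: algebra_simps)
    then have "i \<le> 0" using A_beta by (simp add: mult_le_0_iff)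
    then show ?thesis using i by simp
  qed
  then have "AE x in \<nu>. ennreal (max 0 (x - L) powr \<beta>) = 0"
    unfolding I_def by (subst (asm) nn_integral_0_iff_AE) auto
  then have "AE x in \<nu>. x \<notin> {L<..}"
    by eventually_elim (auto simp: max_def split: if_splits)
  then have "emeasure \<nu> {L<..} = 0"
    by (subst (asm) AE_iff_measurable[of "{L<..}"]) (auto simp: \<nu>(2) sets_eq_imp_space_eq[OF \<nu>(2)])
  then show ?thesis by (simp add: measure_def)
qed

end

section \<open>The Letac model\<close>

lemma powr_sum4_le:
  fixes a b c d \<alpha> :: real
  assumes "0 \<le> a" "0 \<le> b" "0 \<le> c" "0 \<le> d" "0 < \<alpha>"
  shows "(a + b + c + d) powr \<alpha> \<le> 4 powr \<alpha> * (a powr \<alpha> + b powr \<alpha> + c powr \<alpha> + d powr \<alpha>)"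
proof -
  define m where "m = Max {a, b, c, d}"
  have m: "a \<le> m" "b \<le> m" "c \<le> m" "d \<le> m" "m \<in> {a, b, c, d}"
    unfolding m_def by (auto intro!: Max_ge)
  have "(a + b + c + d) powr \<alpha> \<le> (4 * m) powr \<alpha>" using m assms by (intro powr_mono2) auto
  also have "\<dots> = 4 powr \<alpha> * m powr \<alpha>" by (simp add: powr_mult)
  also have "m powr \<alpha> \<le> a powr \<alpha> + b powr \<alpha> + c powr \<alpha> + d powr \<alpha>"
    using m(5) by (auto simp: add_increasing add_increasing2)
  finally show ?thesis by (simp add: mult_left_mono)
qed

lemma measurable_triple [measurable]:
  "fst \<in> borel_measurable (borel :: (real \<times> real \<times> real) measure)"
  "(\<lambda>p. fst (snd p)) \<in> borel_measurable (borel :: (real \<times> real \<times> real) measure)"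
  "(\<lambda>p. snd (snd p)) \<in> borel_measurable (borel :: (real \<times> real \<times> real) measure)"
  by (intro borel_measurable_continuous_onI continuous_intros)+

text \<open>The summand |a| |c| accounts for the constant branch ac + b of the Letac map. The
  absolute value of a makes the weight at least 1 at every point, also where a is not
  positive.\<close>

definition letac_weight :: "real \<times> real \<times> real \<Rightarrow> real" where
  "letac_weight p = 1 + \<bar>fst p\<bar> + \<bar>fst (snd p)\<bar> + \<bar>fst p\<bar> * \<bar>snd (snd p)\<bar>"

lemma letac_map_eq: "letac_map (p, x) = max (fst p * x + fst (snd p)) (fst p * snd (snd p) + fst (snd p))"
  by (simp add: letac_map_def split_def)

lemma cramer_factor_letac:
  fixes \<mu> :: "(real \<times> real \<times> real) measure" and \<alpha> :: real
  assumes prob: "prob_space \<mu>" and sets_mu: "sets \<mu> = sets borel"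
    and Apos: "AE (a, b, c) in \<mu>. a > 0" and alpha_pos: "\<alpha> > 0"
    and cramer: "(\<integral>\<^sup>+ (a, b, c). ennreal (a powr \<alpha>) \<partial>\<mu>) = 1"
    and mom_B: "(\<integral>\<^sup>+ (a, b, c). ennreal (\<bar>b\<bar> powr \<alpha> + a powr \<alpha> * max 0 (ln a)) \<partial>\<mu>) < \<infinity>"
    and nonarith: "\<not> log_arithmetic \<mu>"
    and mom_C: "(\<integral>\<^sup>+ (a, b, c). ennreal (a powr \<alpha> * \<bar>c\<bar> powr \<alpha>) \<partial>\<mu>) < \<infinity>"
  shows "cramer_factor \<mu> fst letac_weight \<alpha>"
proof -
  interpret prob_space \<mu> by fact
  note sets_mu[measurable_cong]
  have pos: "AE p in \<mu>. fst p > 0" using Apos by (simp add: split_def)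
  show ?thesis
  proof
    show "fst \<in> borel_measurable \<mu>" by measurable
    show "letac_weight \<in> borel_measurable \<mu>" unfolding letac_weight_def by measurable
    show "AE p in \<mu>. fst p > 0" by (rule pos)
    show "1 \<le> letac_weight p" for p by (simp add: letac_weight_def)
    show "0 < \<alpha>" by fact
    show cr: "(\<integral>\<^sup>+ p. ennreal (fst p powr \<alpha>) \<partial>\<mu>) = 1" using cramer by (simp add: split_def)
    have mB: "(\<integral>\<^sup>+ p. ennreal (\<bar>fst (snd p)\<bar> powr \<alpha> + fst p powr \<alpha> * max 0 (ln (fst p))) \<partial>\<mu>) < \<infinity>"
      using mom_B by (simp add: split_def)
    have mC: "(\<integral>\<^sup>+ p. ennreal (fst p powr \<alpha> * \<bar>snd (snd p)\<bar> powr \<alpha>) \<partial>\<mu>) < \<infinity>"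
      using mom_C by (simp add: split_def)
    show "(\<integral>\<^sup>+ p. ennreal (fst p powr \<alpha> * max 0 (ln (fst p))) \<partial>\<mu>) < \<infinity>"
      by (rule order.strict_trans1[OF nn_integral_mono mB]) (auto intro!: ennreal_leI)
    have mB': "(\<integral>\<^sup>+ p. ennreal (\<bar>fst (snd p)\<bar> powr \<alpha>) \<partial>\<mu>) < \<infinity>"
      by (rule order.strict_trans1[OF nn_integral_mono mB]) (auto intro!: ennreal_leI)
    have "(\<integral>\<^sup>+ p. ennreal (letac_weight p powr \<alpha>) \<partial>\<mu>)
       \<le> (\<integral>\<^sup>+ p. ennreal (4 powr \<alpha>) * (1 + ennreal (fst p powr \<alpha>) + ennreal (\<bar>fst (snd p)\<bar> powr \<alpha>) + ennreal (fst p powr \<alpha> * \<bar>snd (snd p)\<bar> powr \<alpha>)) \<partial>\<mu>)"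
    proof (rule nn_integral_mono_AE, use pos in eventually_elim)
      case (elim p)
      have "letac_weight p powr \<alpha> \<le> 4 powr \<alpha> * (1 powr \<alpha> + \<bar>fst p\<bar> powr \<alpha> + \<bar>fst (snd p)\<bar> powr \<alpha> + (\<bar>fst p\<bar> * \<bar>snd (snd p)\<bar>) powr \<alpha>)"
        unfolding letac_weight_def by (rule powr_sum4_le) (use alpha_pos in auto)
      also have "\<dots> = 4 powr \<alpha> * (1 + fst p powr \<alpha> + \<bar>fst (snd p)\<bar> powr \<alpha> + fst p powr \<alpha> * \<bar>snd (snd p)\<bar> powr \<alpha>)"
        using elim by (simp add: powr_mult)
      finally have "ennreal (letac_weight p powr \<alpha>) \<le> ennreal (4 powr \<alpha> * (1 + fst p powr \<alpha> + \<bar>fst (snd p)\<bar> powr \<alpha> + fst p powr \<alpha> * \<bar>snd (snd p)\<bar> powr \<alpha>))"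
        by (rule ennreal_leI)
      then show ?case by (simp add: ennreal_mult)
    qed
    also have "\<dots> < \<infinity>"
      using cr mB' mC by (simp add: nn_integral_cmult nn_integral_add ennreal_mult_less_top emeasure_space_1)
    finally show "(\<integral>\<^sup>+ p. ennreal (letac_weight p powr \<alpha>) \<partial>\<mu>) < \<infinity>" .
    show "\<not> (AE p in \<mu>. \<exists>k::int. ln (fst p) = d * of_int k)" if "d > 0" for d
      using nonarith that unfolding log_arithmetic_def by (auto simp: split_def)
  qed
qed

lemma emeasure_open_pos:
  assumes "x \<in> measure_support M" "open U" "x \<in> U" "sets M = sets borel"
  shows "emeasure M U > 0"
proof -
  obtain e where "e > 0" "ball x e \<subseteq> U" using assms by (meson open_contains_ball)
  moreover have "emeasure M (ball x e) \<le> emeasure M U"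
    using calculation assms by (intro emeasure_mono) auto
  ultimately show ?thesis using assms(1) unfolding measure_support_def by (force intro: order.strict_trans2)
qed

locale letac_model = cramer_factor \<mu> fst letac_weight \<alpha>
  for \<mu> :: "(real \<times> real \<times> real) measure" and \<alpha> :: real +
  fixes \<nu> :: "real measure"
  assumes sets_mu [measurable_cong]: "sets \<mu> = sets borel" and stationary: "letac_stationary \<mu> \<nu>"
begin

lemma nu: "prob_space \<nu>" "sets \<nu> = sets borel" "\<nu> = distr (\<mu> \<Otimes>\<^sub>M \<nu>) borel letac_map"
  using stationary unfolding letac_stationary_def by blast+

lemma measurable_letac_map [measurable]: "letac_map \<in> borel_measurable (\<mu> \<Otimes>\<^sub>M borel)"
proof -
  have "letac_map = (\<lambda>z. max (fst (fst z) * snd z + fst (snd (fst z))) (fst (fst z) * snd (snd (fst z)) + fst (snd (fst z))))"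
    by (rule ext) (simp add: letac_map_eq[symmetric])
  also have "\<dots> \<in> borel_measurable (\<mu> \<Otimes>\<^sub>M borel)" by measurable
  finally show ?thesis .
qed

lemma driven_letac: "driven letac_map"
  unfolding driven_def
proof (intro conjI allI impI measurable_letac_map)
  fix p :: "real \<times> real \<times> real" and x :: real
  obtain a b c where p: "p = (a, b, c)" by (cases p)
  assume "fst p > 0"
  then have a: "a > 0" by (simp add: p)
  have ax: "\<bar>a * x\<bar> = a * \<bar>x\<bar>" and ac: "\<bar>a * c\<bar> = a * \<bar>c\<bar>" using a by (auto simp: abs_mult)
  have w: "letac_weight p = 1 + a + \<bar>b\<bar> + a * \<bar>c\<bar>" using a by (simp add: letac_weight_def p)
  have m: "letac_map (p, x) = max (a * x + b) (a * c + b)" by (simp add: letac_map_eq p)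
  show "1 + \<bar>letac_map (p, x)\<bar> \<le> fst p * (1 + \<bar>x\<bar>) + letac_weight p"
    unfolding m w using ax ac a by (simp add: p distrib_left)
  show "\<bar>max 0 (letac_map (p, x)) - max 0 (fst p * x)\<bar> + fst p \<le> letac_weight p"
    unfolding m w using ax ac a by (simp add: p) linarith
qed

section \<open>The stationary tail and the support of the coefficient law\<close>

abbreviation tail :: "real \<Rightarrow> real" where "tail t \<equiv> measure \<nu> {t<..}"

lemma antimono_letac_tail: "antimono tail"
  using prob_space.finite_measure[OF nu(1)] nu(2) by (rule antimono_tail)

lemma tail_eq: "tail t = (\<integral>p. measure \<nu> {x. t < letac_map (p, x)} \<partial>\<mu>)"
  using tail_distr[OF nu(1,2) measurable_letac_map, of t] nu(3) by simp

lemma AE_support: "AE p in \<mu>. p \<in> measure_support \<mu>"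
  by (rule AE_measure_support[OF sets_mu])

lemma support_nonempty: obtains p where "p \<in> measure_support \<mu>"
proof -
  have "\<exists>p. p \<in> measure_support \<mu>"
    by (rule eventually_happens'[OF _ AE_support]) (simp add: ae_filter_eq_bot_iff emeasure_space_1)
  then show thesis using that by blast
qed

text \<open>If a \<le> 1 on the support, then ln A \<le> 0 almost surely and the tilted drift, the
  mean of A^\<alpha> ln A, would not be positive. An expanding point guarantees N3 <
  \<infinity>.\<close>

lemma support_expanding: obtains p where "p \<in> measure_support \<mu>" "fst p > 1"
proof -
  have "\<exists>p\<in>measure_support \<mu>. fst p > 1"
  proof (rule ccontr)
    assume "\<not> ?thesis"
    then have "AE p in \<mu>. fst p \<le> 1" using AE_support by (auto elim!: eventually_mono simp: not_less)
    with A_pos have "AE p in \<mu>. 0 \<le> - (fst p powr \<alpha> * ln (fst p))"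
      by eventually_elim (simp add: mult_nonneg_nonpos)
    then have "0 \<le> (\<integral>p. - (fst p powr \<alpha> * ln (fst p)) \<partial>\<mu>)" by (rule integral_nonneg_AE)
    then have "(\<integral>p. fst p powr \<alpha> * ln (fst p) \<partial>\<mu>) \<le> 0" by simp
    moreover have "tilt.drift = (\<integral>p. fst p powr \<alpha> * ln (fst p) \<partial>\<mu>)"
      unfolding tilt.drift_def by (rule integral_tilt) measurable
    ultimately show False using tilt.drift_pos by simp
  qed
  then show thesis using that by blast
qed

text \<open>The tail is an average over p of section probabilities. If it were 0, almost all
  sections would be null, whereas an open neighbourhood of a support point has positive
  mass.\<close>

lemma tail_pos_if_open:
  assumes U: "open U" "q \<in> U" "q \<in> measure_support \<mu>"
    and d: "\<And>p. p \<in> U \<Longrightarrow> fst p > 0 \<Longrightarrow> measure \<nu> {x. t < letac_map (p, x)} > 0"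
  shows "tail t > 0"
proof (rule ccontr)
  assume "\<not> tail t > 0"
  then have "(\<integral>p. measure \<nu> {x. t < letac_map (p, x)} \<partial>\<mu>) = 0"
    using tail_eq[of t] measure_nonneg[of \<nu> "{t<..}"] by linarith
  then have "AE p in \<mu>. measure \<nu> {x. t < letac_map (p, x)} = 0"
    by (subst (asm) integral_nonneg_eq_0_iff_AE[OF tail_pair(2)[OF nu(1,2) measurable_letac_map]]) auto
  with A_pos have "AE p in \<mu>. p \<notin> U" by eventually_elim (use d in force)
  then have "emeasure \<mu> U = 0"
    using U(1) by (subst (asm) AE_iff_measurable[of U]) (auto simp: sets_mu sets_eq_imp_space_eq[OF sets_mu])
  with emeasure_open_pos[OF U(3,1,2) sets_mu] show False by simp
qed

lemma sets_letac_section: "{x. t < letac_map (p, x)} \<in> sets \<nu>"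
  unfolding letac_map_eq nu(2) by measurable

lemma tail_pos_const:
  assumes q: "q \<in> measure_support \<mu>" and t: "t < fst q * snd (snd q) + fst (snd q)"
  shows "tail t > 0"
proof (rule tail_pos_if_open[OF _ _ q])
  show "open {p :: real \<times> real \<times> real. t < fst p * snd (snd p) + fst (snd p)}"
    by (intro open_Collect_less continuous_intros)
  show "q \<in> {p. t < fst p * snd (snd p) + fst (snd p)}" using t by simp
  fix p :: "real \<times> real \<times> real" assume "p \<in> {p. t < fst p * snd (snd p) + fst (snd p)}"
  then have "{x. t < letac_map (p, x)} = space \<nu>"
    using sets_eq_imp_space_eq[OF nu(2)] by (auto simp: letac_map_eq)
  then show "measure \<nu> {x. t < letac_map (p, x)} > 0" using prob_space.prob_space[OF nu(1)] by simp
qed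

text \<open>The strict inequality persists for coefficients near q, and for those with a > 0 every x
  > y is sent above t by the affine branch.\<close>

lemma tail_pos_step:
  assumes q: "q \<in> measure_support \<mu>" and y: "tail y > 0" and t: "t < fst q * y + fst (snd q)"
  shows "tail t > 0"
proof (rule tail_pos_if_open[OF _ _ q])
  show "open {p :: real \<times> real \<times> real. t < fst p * y + fst (snd p)}"
    by (intro open_Collect_less continuous_intros)
  show "q \<in> {p. t < fst p * y + fst (snd p)}" using t by simp
  fix p :: "real \<times> real \<times> real" assume p: "p \<in> {p. t < fst p * y + fst (snd p)}" "fst p > 0"
  have "{y<..} \<subseteq> {x. t < letac_map (p, x)}"
  proof
    fix x assume "x \<in> {y<..}"
    then have "fst p * y \<le> fst p * x" using p(2) by simp
    then show "x \<in> {x. t < letac_map (p, x)}" using p(1) by (simp add: letac_map_eq)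
  qed
  then have "tail y \<le> measure \<nu> {x. t < letac_map (p, x)}"
    by (rule finite_measure.finite_measure_mono[OF prob_space.finite_measure[OF nu(1)] _ sets_letac_section])
  then show "measure \<nu> {x. t < letac_map (p, x)} > 0" using y by simp
qed

text \<open>The right end point \<open>S\<close> of the support satisfies \<open>aS + b \<le> S\<close> for all \<open>(a, b, c)\<close> in the
  support, so it lies between the fixed points that define \<open>N2\<close> and \<open>N3\<close>.\<close>
lemma tail_pos:
  assumes "N3 \<mu> < max (N1 \<mu>) (N2 \<mu>)"
  shows "tail t > 0"
proof (rule ccontr)
  assume t: "\<not> tail t > 0"
  define T where "T = {y. tail y > 0}"
  have bdd: "bdd_above T"
  proof (rule bdd_aboveI[where M=t])
    fix y assume "y \<in> T"
    then show "y \<le> t" using t antimonoD[OF antimono_letac_tail, of t y] by (force simp: T_def not_le)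
  qed
  obtain p where "p \<in> measure_support \<mu>" by (rule support_nonempty)
  then have "fst p * snd (snd p) + fst (snd p) - 1 \<in> T" unfolding T_def by (auto intro: tail_pos_const)
  then have ne: "T \<noteq> {}" by auto
  define S where "S = Sup T"
  have le_S: "y \<le> S" if "tail y > 0" for y
    unfolding S_def using that bdd by (intro cSup_upper) (auto simp: T_def)
  have const: "fst q * snd (snd q) + fst (snd q) \<le> S" if q: "q \<in> measure_support \<mu>" for q
    by (rule dense_le) (auto intro: le_S tail_pos_const[OF q])
  have affine: "fst q * S + fst (snd q) \<le> S" if q: "q \<in> measure_support \<mu>" for q
  proof (rule ccontr)
    assume "\<not> ?thesis"
    then have g: "fst q * S + fst (snd q) - S > 0" by simp
    \<comment> \<open>A level y in T within e of S loses at most |a| e in the affine map, which is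
      less than the overshoot aS + b - S; the summand 1 in the denominator makes this strict and
      excludes division by 0.\<close>
    define e where "e = (fst q * S + fst (snd q) - S) / (\<bar>fst q\<bar> + 1)"
    have e: "e > 0" "e * (\<bar>fst q\<bar> + 1) = fst q * S + fst (snd q) - S" using g by (auto simp: e_def)
    obtain y where y: "y \<in> T" "S - e < y" using e less_cSup_iff[OF ne bdd, of "S - e"] by (auto simp: S_def)
    have "y \<le> S" using y le_S by (auto simp: T_def)
    then have "\<bar>fst q * (S - y)\<bar> \<le> \<bar>fst q\<bar> * e" using y(2) by (simp add: abs_mult mult_left_mono)
    then have "S < fst q * y + fst (snd q)" using e by (simp add: algebra_simps abs_le_iff)
    then obtain z where "S < z" "z < fst q * y + fst (snd q)" using dense by blast
    then show False using tail_pos_step[OF q, of y z] y le_S[of z] by (auto simp: T_def)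
  qed
  obtain q where q: "q \<in> measure_support \<mu>" "fst q > 1" "ereal (fst (snd q) / (1 - fst q)) < max (N1 \<mu>) (N2 \<mu>)"
    using assms unfolding N3_def by (subst (asm) Inf_less_iff) auto
  have qS: "S \<le> fst (snd q) / (1 - fst q)"
    using affine[OF q(1)] q(2) by (simp add: field_simps)
  from q(3) consider "ereal (fst (snd q) / (1 - fst q)) < N1 \<mu>" | "ereal (fst (snd q) / (1 - fst q)) < N2 \<mu>"
    by (auto simp: less_max_iff_disj)
  then show False
  proof cases
    case 1
    then obtain r where r: "r \<in> measure_support \<mu>" "fst (snd q) / (1 - fst q) < fst r * snd (snd r) + fst (snd r)"
      unfolding N1_def by (subst (asm) less_Sup_iff) (auto simp: split_def)
    then show False using const[OF r(1)] qS by simp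
  next
    case 2
    then obtain r where r: "r \<in> measure_support \<mu>" "fst r < 1" "fst (snd q) / (1 - fst q) < fst (snd r) / (1 - fst r)"
      unfolding N2_def by (subst (asm) less_Sup_iff) auto
    have "fst (snd r) / (1 - fst r) \<le> S" using affine[OF r(1)] r(2) by (simp add: field_simps)
    then show False using r(3) qS by simp
  qed
qed

text \<open>L = max N1 N2 is a barrier: ac + b \<le> L by N1, and aL + b \<le> L by N2 when a < 1,
  by L \<le> N3 when a > 1, and by b \<le> 0 when a = 1. Beyond L the excess then grows by a factor
  of at most a, as \<open>stationary_bounded\<close> requires.\<close>

lemma tail_bounded:
  assumes noA1: "AE p in \<mu>. \<not> (fst p = 1 \<and> fst (snd p) > 0)" and N: "max (N1 \<mu>) (N2 \<mu>) \<le> N3 \<mu>"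
  obtains L where "tail L = 0"
proof -
  have N1_ge: "ereal (fst p * snd (snd p) + fst (snd p)) \<le> N1 \<mu>" if "p \<in> measure_support \<mu>" for p
    unfolding N1_def by (rule Sup_upper) (use that in \<open>force simp: split_def\<close>)
  have N2_ge: "ereal (fst (snd p) / (1 - fst p)) \<le> N2 \<mu>" if "p \<in> measure_support \<mu>" "fst p < 1" for p
    unfolding N2_def by (rule Sup_upper) (use that in \<open>force simp: split_def\<close>)
  have N3_le: "N3 \<mu> \<le> ereal (fst (snd p) / (1 - fst p))" if "p \<in> measure_support \<mu>" "fst p > 1" for p
    unfolding N3_def by (rule Inf_lower) (use that in \<open>force simp: split_def\<close>)
  obtain p where p: "p \<in> measure_support \<mu>" by (rule support_nonempty)
  obtain q where q: "q \<in> measure_support \<mu>" "fst q > 1" by (rule support_expanding)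
  \<comment> \<open>The barrier is a real number: an expanding support point makes N3, hence the
    maximum, less than \<infinity>, and any support point makes N1 larger than -\<infinity>.\<close>
  obtain L where L: "max (N1 \<mu>) (N2 \<mu>) = ereal L"
  proof (cases "max (N1 \<mu>) (N2 \<mu>)")
    case PInf
    then show thesis using N N3_le[OF q] by simp
  next
    case MInf
    then have "N1 \<mu> = - \<infinity>" by (metis ereal_infty_less_eq(2) max.cobounded1)
    then show thesis using N1_ge[OF p] by simp
  qed (use that in auto)
  have "measure \<nu> {L<..} = 0"
  proof (rule stationary_bounded[OF driven_letac nu])
    show "AE p in \<mu>. \<forall>x. letac_map (p, x) \<le> L + fst p * max 0 (x - L)"
      using AE_support A_pos noA1
    proof eventually_elim
      case (elim p)
      have "ereal (fst p * snd (snd p) + fst (snd p)) \<le> ereal L"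
        using N1_ge[OF elim(1)] L by (metis max.cobounded1 order_trans)
      then have c: "fst p * snd (snd p) + fst (snd p) \<le> L" by simp
      consider "fst p < 1" | "fst p = 1" | "fst p > 1" by linarith
      then have b: "fst p * L + fst (snd p) \<le> L"
      proof cases
        case 1
        have "ereal (fst (snd p) / (1 - fst p)) \<le> ereal L"
          using N2_ge[OF elim(1) 1] L by (metis max.cobounded2 order_trans)
        then show ?thesis using 1 by (simp add: field_simps)
      next
        case 2
        then show ?thesis using elim(3) by simp
      next
        case 3
        have "ereal L \<le> ereal (fst (snd p) / (1 - fst p))"
          using N3_le[OF elim(1) 3] N L by (metis order_trans)
        then show ?thesis using 3 by (simp add: field_simps)
      qed
      show ?case
      proof
        fix x
        have "fst p * x \<le> fst p * (L + max 0 (x - L))" using elim(2) by (intro mult_left_mono) auto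
        moreover have "0 \<le> fst p * max 0 (x - L)" using elim(2) by simp
        ultimately show "letac_map (p, x) \<le> L + fst p * max 0 (x - L)"
          using b c by (simp add: letac_map_eq distrib_left)
      qed
    qed
  qed
  then show thesis by (rule that)
qed

text \<open>Keeping only the affine branch of the maximum gives the one-sided inequality for F in
  \<open>tail_comparison\<close>.\<close>

lemma tail_superharmonic: "(\<integral>p. tail ((t - fst (snd p)) / fst p) \<partial>\<mu>) \<le> tail t"
  unfolding tail_eq[of t]
proof (rule integral_mono_AE)
  note [measurable] = borel_measurable_antimono[OF antimono_letac_tail]
  show "integrable \<mu> (\<lambda>p. tail ((t - fst (snd p)) / fst p))"
    by (rule integrable_const_bound[where B=1]) (auto simp: prob_space.prob_le_1[OF nu(1)])
  show "integrable \<mu> (\<lambda>p. measure \<nu> {x. t < letac_map (p, x)})"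
    by (rule tail_pair(2)[OF nu(1,2) measurable_letac_map])
  show "AE p in \<mu>. tail ((t - fst (snd p)) / fst p) \<le> measure \<nu> {x. t < letac_map (p, x)}"
    using A_pos
  proof eventually_elim
    case (elim p)
    then have "{(t - fst (snd p)) / fst p<..} \<subseteq> {x. t < letac_map (p, x)}"
      by (auto simp: letac_map_eq field_simps)
    then show ?case
      by (rule finite_measure.finite_measure_mono[OF prob_space.finite_measure[OF nu(1)] _ sets_letac_section])
  qed
qed

end

theorem theorem3p4:
  fixes \<mu> :: "(real \<times> real \<times> real) measure" and \<nu> :: "real measure" and \<alpha> :: real
  assumes prob: "prob_space \<mu>" and sets_mu: "sets \<mu> = sets borel"
    and Apos: "AE (a, b, c) in \<mu>. a > 0"
    and neg_drift: "(\<integral>\<^sup>+ (a, b, c). ennreal (max 0 (ln a)) \<partial>\<mu>)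
                      < (\<integral>\<^sup>+ (a, b, c). ennreal (max 0 (- ln a)) \<partial>\<mu>)"
    and alpha_pos: "\<alpha> > 0"
    and cramer: "(\<integral>\<^sup>+ (a, b, c). ennreal (a powr \<alpha>) \<partial>\<mu>) = 1"
    and mom_B: "(\<integral>\<^sup>+ (a, b, c). ennreal (\<bar>b\<bar> powr \<alpha> + a powr \<alpha> * max 0 (ln a)) \<partial>\<mu>) < \<infinity>"
    and nonarith: "\<not> log_arithmetic \<mu>"
    and mom_C: "(\<integral>\<^sup>+ (a, b, c). ennreal (a powr \<alpha> * \<bar>c\<bar> powr \<alpha>) \<partial>\<mu>) < \<infinity>"
    and stat: "letac_stationary \<mu> \<nu>"
    and noA1: "measure \<mu> {(a, b, c). a = 1 \<and> b > 0} = 0"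
  shows "\<exists>CL\<ge>0. ((\<lambda>t. t powr \<alpha> * measure \<nu> {t<..}) \<longlongrightarrow> CL) at_top \<and>
           (CL > 0 \<longleftrightarrow> N3 \<mu> < max (N1 \<mu>) (N2 \<mu>))"
proof -
  interpret cramer_factor \<mu> fst letac_weight \<alpha>
    by (rule cramer_factor_letac) fact+
  interpret letac_model \<mu> \<alpha> \<nu>
    by unfold_locales fact+
  obtain CL where CL: "CL \<ge> 0" "((\<lambda>t. t powr \<alpha> * tail t) \<longlongrightarrow> CL) at_top"
    by (rule stationary_tail[OF driven_letac nu])
  have "CL > 0 \<longleftrightarrow> N3 \<mu> < max (N1 \<mu>) (N2 \<mu>)"
  proof
    assume N: "N3 \<mu> < max (N1 \<mu>) (N2 \<mu>)"
    show "CL > 0"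
    proof (rule tail_limit_pos[OF _ _ antimono_letac_tail tail_pos[OF N] _ tail_superharmonic CL(2)])
      show "(\<lambda>p. fst (snd p)) \<in> borel_measurable \<mu>" by measurable
      show "1 + \<bar>fst (snd p)\<bar> + fst p \<le> letac_weight p" if "fst p > 0" for p :: "real \<times> real \<times> real"
        using that by (simp add: letac_weight_def)
      show "tail t \<le> 1" for t by (rule prob_space.prob_le_1[OF nu(1)])
    qed
  next
    assume "CL > 0"
    show "N3 \<mu> < max (N1 \<mu>) (N2 \<mu>)"
    proof (rule ccontr)
      assume "\<not> ?thesis"
      then have N: "max (N1 \<mu>) (N2 \<mu>) \<le> N3 \<mu>" by (simp only: not_less)
      have "AE p in \<mu>. \<not> (fst p = 1 \<and> fst (snd p) > 0)"
      proof (rule AE_I[where N="{p. fst p = 1 \<and> fst (snd p) > 0}"])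
        show "emeasure \<mu> {p. fst p = 1 \<and> fst (snd p) > 0} = 0"
          using noA1 by (simp add: emeasure_eq_measure split_def)
        show "{p. fst p = 1 \<and> fst (snd p) > 0} \<in> sets \<mu>"
          unfolding sets_mu by measurable
      qed auto
      then obtain L where L: "tail L = 0" using tail_bounded N by blast
      \<comment> \<open>A tail that vanishes at L vanishes at every larger level, so the limit would
        be 0, contrary to CL > 0.\<close>
      have "eventually (\<lambda>t. 0 = t powr \<alpha> * tail t) at_top"
        using eventually_ge_at_top[of L]
      proof eventually_elim
        case (elim t)
        have "tail t \<le> 0" using antimonoD[OF antimono_letac_tail elim] L by simp
        then show ?case by (simp add: measure_le_0_iff)
      qed
      then have "((\<lambda>t. t powr \<alpha> * tail t) \<longlongrightarrow> 0) at_top"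
        by (rule Lim_transform_eventually[OF tendsto_const])
      then show False using CL(2) \<open>CL > 0\<close> tendsto_unique[OF trivial_limit_at_top_linorder] by fastforce
    qed
  qed
  then show ?thesis using CL by blast
qed

end
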